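(* Let $m\ge 2$ and $k\ge 2$. Consider a control-affine system $\Sigma_{aff}:\ \dot x=f(x)+\sum_{i=0}^m u_ig_i(x)$ with smooth vector fields $f,g_0,\dots,g_m$ on an open subset $X$ of $\mathbb{R}^{km+1}$, and fix $x^*\in X$. Let $\mathcal{G}=\mathrm{span}\{g_0,\dots,g_m\}$, with derived flag $\mathcal{G}^i$. Then $\Sigma_{aff}$ is locally, around $x^*$, static feedback equivalent to the triangular form $TCh_m^k$ if and only if the following conditions are satisfied (in a neighborhood of $x^*$): (m-Ch1) $\mathcal{G}^{k-1}=TX$; (m-Ch2) $\mathcal{G}^{k-2}$ is of constant rank $(k-1)m+1$ and contains an involutive subdistribution $\mathcal{L}$ that has constant corank one in $\mathcal{G}^{k-2}$; (m-Ch3) $\mathcal{G}^0(x^* )$ is not contained in $\mathcal{L}(x^* )$; (m-Comp) $[f,\mathcal{C}^i]\subset\mathcal{G}^i$ for $1\le i\le k-2$, where $\mathcal{C}^i$ is the characteristic distribution of $\mathcal{G}^i$.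
   Context: Smooth means $C^\infty$. For a distribution $\mathcal{G}$, the derived flag is $\mathcal{G}^0=\mathcal{G}$, $\mathcal{G}^{i+1}=\mathcal{G}^i+[\mathcal{G}^i,\mathcal{G}^i]$, $i\ge 0$. The characteristic distribution of a distribution $\mathcal{D}$ is $\mathcal{C}=\{c\in\mathcal{D}:[c,\mathcal{D}]\subset\mathcal{D}\}$. Static feedback equivalence: two control-affine systems are locally static feedback equivalent if one is transformed into the other by a local diffeomorphism $z=\phi(x)$ of the state space and a feedback transformation $u=\alpha(x)+\beta(x)v$ with $\alpha,\beta$ smooth and $\beta(x)$ an invertible matrix. "Around $x^*$" means that the equivalence is defined in a neighborhood of $x^*$, with $z$ in a neighborhood of $z^*=\phi(x^* )$. The triangular form $TCh_m^k$ is the class of systems with state $(z_0,z^j_i)$, $1\le j\le k$, $1\le i\le m$, and controls $(v_0,v_1,\dots,v_m)$ $$\dot z_0=v_0,\qquad \dot z_i^j=f_i^j(z_0,\bar z^{j+1})+z_i^{j+1}v_0\ \ (1\le j\le k-1,\ 1\le i\le m),\qquad \dot z_i^k=v_i\ \ (1\le i\le m),$$ where $\bar z^j=(z_1^1,\dots,z_m^1,z_1^2,\dots,z_m^2,\dots,z_1^j,\dots,z_m^j)$ and the $f_i^j$ are smooth functions of the indicated variables. *)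

theory Defs
  imports "HOL-Analysis.Analysis"
begin

section \<open>Smooth maps\<close>

text \<open>Derivatives are taken at the points of \<open>S\<close> in the full space, so the notions are meant for open
  \<open>S\<close>; on finite-dimensional spaces \<open>C_k_on n S f\<close> is then the usual \<open>C\<^sup>n\<close> on \<open>S\<close>.\<close>

primrec C_k_on ::
    "nat \<Rightarrow> 'a::real_normed_vector set \<Rightarrow> ('a \<Rightarrow> 'b::real_normed_vector) \<Rightarrow> bool" where
  "C_k_on 0 S f \<longleftrightarrow> continuous_on S f"
| "C_k_on (Suc n) S f \<longleftrightarrow>
     (\<forall>x\<in>S. f differentiable (at x)) \<and>
     (\<forall>v. C_k_on n S (\<lambda>x. frechet_derivative f (at x) v))"

definition smooth_on ::
    "'a::real_normed_vector set \<Rightarrow> ('a \<Rightarrow> 'b::real_normed_vector) \<Rightarrow> bool" where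
  "smooth_on S f \<longleftrightarrow> (\<forall>n. C_k_on n S f)"

section \<open>Distributions\<close>

definition lie_bracket ::
    "('a::real_normed_vector \<Rightarrow> 'a) \<Rightarrow> ('a \<Rightarrow> 'a) \<Rightarrow> 'a \<Rightarrow> 'a" where
  "lie_bracket v w x = frechet_derivative w (at x) (v x) - frechet_derivative v (at x) (w x)"

text \<open>A distribution assigns to each point a linear subspace of the tangent space. Brackets of
  distributions are always formed from their local smooth sections.\<close>

type_synonym 'a distribution = "'a \<Rightarrow> 'a set"

definition section_on ::
    "'a::real_normed_vector set \<Rightarrow> 'a distribution \<Rightarrow> ('a \<Rightarrow> 'a) \<Rightarrow> bool" where
  "section_on V D v \<longleftrightarrow> open V \<and> smooth_on V v \<and> (\<forall>x\<in>V. v x \<in> D x)"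

definition smooth_distribution_on ::
    "'a::real_normed_vector set \<Rightarrow> 'a distribution \<Rightarrow> bool" where
  "smooth_distribution_on U D \<longleftrightarrow>
     (\<forall>x\<in>U. \<exists>V S. open V \<and> x \<in> V \<and> V \<subseteq> U \<and> finite S \<and> (\<forall>s\<in>S. smooth_on V s) \<and>
        (\<forall>y\<in>V. D y = span ((\<lambda>s. s y) ` S)))"

definition derived :: "'a::real_normed_vector distribution \<Rightarrow> 'a distribution" where
  "derived D x = span (D x \<union>
     {lie_bracket v w x | v w. \<exists>V. x \<in> V \<and> section_on V D v \<and> section_on V D w})"

definition derived_flag :: "'a::real_normed_vector distribution \<Rightarrow> nat \<Rightarrow> 'a distribution" where
  "derived_flag D i = (derived ^^ i) D"

definition involutive_on :: "'a::real_normed_vector set \<Rightarrow> 'a distribution \<Rightarrow> bool" where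
  "involutive_on U D \<longleftrightarrow>
     (\<forall>V v w. V \<subseteq> U \<and> section_on V D v \<and> section_on V D w \<longrightarrow>
        (\<forall>x\<in>V. lie_bracket v w x \<in> D x))"

definition constant_rank_on :: "'a::real_normed_vector set \<Rightarrow> 'a distribution \<Rightarrow> nat \<Rightarrow> bool" where
  "constant_rank_on U D r \<longleftrightarrow> (\<forall>x\<in>U. dim (D x) = r)"

definition constant_corank_one_in ::
    "'a::real_normed_vector set \<Rightarrow> 'a distribution \<Rightarrow> 'a distribution \<Rightarrow> bool" where
  "constant_corank_one_in U L D \<longleftrightarrow> (\<forall>x\<in>U. L x \<subseteq> D x \<and> dim (L x) + 1 = dim (D x))"

definition characteristic_section_on ::
    "'a::real_normed_vector set \<Rightarrow> 'a distribution \<Rightarrow> ('a \<Rightarrow> 'a) \<Rightarrow> bool" where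
  "characteristic_section_on V D c \<longleftrightarrow> section_on V D c \<and>
     (\<forall>W d. W \<subseteq> V \<and> section_on W D d \<longrightarrow> (\<forall>x\<in>W. lie_bracket c d x \<in> D x))"

definition characteristic_distribution ::
    "'a::real_normed_vector distribution \<Rightarrow> 'a distribution" where
  "characteristic_distribution D x = {c x | c. \<exists>V. x \<in> V \<and> characteristic_section_on V D c}"

definition field_bracket_subset_on ::
    "'a::real_normed_vector set \<Rightarrow> ('a \<Rightarrow> 'a) \<Rightarrow> 'a distribution \<Rightarrow> 'a distribution \<Rightarrow> bool" where
  "field_bracket_subset_on U f C D \<longleftrightarrow>
     (\<forall>V c. V \<subseteq> U \<and> section_on V C c \<longrightarrow> (\<forall>x\<in>V. lie_bracket f c x \<in> D x))"

section \<open>Control-affine systems and static feedback equivalence\<close>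

definition control_affine ::
    "('a::real_normed_vector \<Rightarrow> 'a) \<Rightarrow> ('c::finite \<Rightarrow> 'a \<Rightarrow> 'a) \<Rightarrow> 'a \<Rightarrow> real ^ 'c \<Rightarrow> 'a" where
  "control_affine f g x u = f x + (\<Sum>i\<in>UNIV. (u $ i) *\<^sub>R g i x)"

definition control_distribution ::
    "('c::finite \<Rightarrow> 'a::real_normed_vector \<Rightarrow> 'a) \<Rightarrow> 'a distribution" where
  "control_distribution g x = span (range (\<lambda>i. g i x))"

definition locally_static_feedback_equivalent ::
    "'a::real_normed_vector set \<Rightarrow> ('a \<Rightarrow> 'a) \<Rightarrow> ('c::finite \<Rightarrow> 'a \<Rightarrow> 'a) \<Rightarrow> 'a \<Rightarrow>
     'b::real_normed_vector set \<Rightarrow> ('b \<Rightarrow> 'b) \<Rightarrow> ('c \<Rightarrow> 'b \<Rightarrow> 'b) \<Rightarrow> bool" where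
  "locally_static_feedback_equivalent X f g xstar Z f' g' \<longleftrightarrow>
     (\<exists>U V \<phi> \<psi> (\<alpha> :: 'a \<Rightarrow> real ^ 'c) (\<beta> :: 'a \<Rightarrow> real ^ 'c ^ 'c).
        open U \<and> xstar \<in> U \<and> U \<subseteq> X \<and> open V \<and> V \<subseteq> Z \<and>
        homeomorphism U V \<phi> \<psi> \<and> smooth_on U \<phi> \<and> smooth_on V \<psi> \<and>
        smooth_on U \<alpha> \<and> smooth_on U \<beta> \<and> (\<forall>x\<in>U. invertible (\<beta> x)) \<and>
        (\<forall>x\<in>U. \<forall>v. frechet_derivative \<phi> (at x) (control_affine f g x (\<alpha> x + \<beta> x *v v)) =
                    control_affine f' g' (\<phi> x) v))"

section \<open>The triangular form\<close>

text \<open>Here \<open>m = CARD('m)\<close>. The controls are indexed by \<open>'m option\<close>: \<open>None\<close> stands for the index \<open>0\<close>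
  and \<open>Some i\<close> for the indices \<open>1, \<dots>, m\<close>. The bijection \<open>c\<close> names the coordinates of the state
  space: \<open>z $ c None\<close> is \<open>z\<^sub>0\<close>, and \<open>z $ c (Some (i, j))\<close> is the coordinate with lower index \<open>i\<close> and
  upper index \<open>j\<close>. It exists only if \<open>CARD('n) = k * CARD('m) + 1\<close>.

  As the form is used locally, the functions \<open>h i j\<close> only need to be defined on an open set \<open>Z\<close>.
  A function on \<open>Z\<close> that is smooth and constant on the fibres of a coordinate projection is the same
  as a smooth function on the (open) projection of \<open>Z\<close>.\<close>

definition TCh_form_on ::
    "nat \<Rightarrow> (real ^ 'n) set \<Rightarrow> (real ^ 'n \<Rightarrow> real ^ 'n) \<Rightarrow>
     ('m::finite option \<Rightarrow> real ^ 'n \<Rightarrow> real ^ 'n) \<Rightarrow> bool" where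
  "TCh_form_on k Z f g \<longleftrightarrow>
     (\<exists>(c :: ('m \<times> nat) option \<Rightarrow> 'n) (h :: 'm \<Rightarrow> nat \<Rightarrow> real ^ 'n \<Rightarrow> real).
        bij_betw c (insert None (Some ` (UNIV \<times> {1..k}))) UNIV \<and>
        (\<forall>i. \<forall>j\<in>{1..<k}. smooth_on Z (h i j) \<and>
           (\<forall>z\<in>Z. \<forall>z'\<in>Z.
              z $ c None = z' $ c None \<and>
              (\<forall>i'. \<forall>l\<in>{1..j + 1}. z $ c (Some (i', l)) = z' $ c (Some (i', l))) \<longrightarrow>
              h i j z = h i j z')) \<and>
        (\<forall>z\<in>Z. \<forall>v.
           control_affine f g z v $ c None = v $ None \<and>
           (\<forall>i. \<forall>j\<in>{1..<k}. control_affine f g z v $ c (Some (i, j)) =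
              h i j z + z $ c (Some (i, j + 1)) * v $ None) \<and>
           (\<forall>i. control_affine f g z v $ c (Some (i, k)) = v $ Some i)))"

definition locally_equivalent_to_TCh ::
    "nat \<Rightarrow> (real ^ 'n) set \<Rightarrow> (real ^ 'n \<Rightarrow> real ^ 'n) \<Rightarrow>
     ('m::finite option \<Rightarrow> real ^ 'n \<Rightarrow> real ^ 'n) \<Rightarrow> real ^ 'n \<Rightarrow> bool" where
  "locally_equivalent_to_TCh k X f g xstar \<longleftrightarrow>
     (\<exists>(Z :: (real ^ 'n) set) f' g'. open Z \<and> TCh_form_on k Z f' g' \<and>
        locally_static_feedback_equivalent X f g xstar Z f' g')"

end

theory Submission
  imports Defs
begin

text \<open>
  Write \<open>\<omega>\<^sup>l = dz\<^sup>l - z\<^sup>l\<^sup>+\<^sup>1 dz\<^sub>0\<close> for the (vector-valued) contact forms. If two fields \<open>v\<close>, \<open>w\<close> are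
  annihilated by \<open>\<omega>\<^sup>l\<close>, then \<open>\<omega>\<^sup>l([v, w]) = dz\<^sup>l\<^sup>+\<^sup>1(v) dz\<^sub>0(w) - dz\<^sup>l\<^sup>+\<^sup>1(w) dz\<^sub>0(v)\<close>, and this
  identity carries the whole argument. In the coordinates of the triangular form it shows that
  \<open>\<G>\<^sup>i\<close> is the common kernel of \<open>\<omega>\<^sup>1, \<dots>, \<omega>\<^sup>k\<^sup>-\<^sup>1\<^sup>-\<^sup>i\<close>, that \<open>\<C>\<^sup>i\<close> is the common kernel of \<open>dz\<^sub>0\<close> and
  \<open>dz\<^sup>1, \<dots>, dz\<^sup>k\<^sup>-\<^sup>i\<close>, and that (m-Comp) says precisely that \<open>\<omega>\<^sup>l(f)\<close>, which is invariant under
  feedback, depends on \<open>z\<^sub>0, z\<^sup>1, \<dots>, z\<^sup>l\<^sup>+\<^sup>1\<close> only.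

  Conversely, Frobenius' theorem yields \<open>m + 1\<close> first integrals \<open>z\<^sub>0, z\<^sup>1\<close> of \<open>\<L>\<close> and a control field
  \<open>w\<close> with \<open>dz\<^sub>0(w) = 1\<close>; put \<open>z\<^sup>l\<^sup>+\<^sup>1 = dz\<^sup>l(w)\<close>. As \<open>\<G>\<^sup>k\<^sup>-\<^sup>2\<close> is spanned by \<open>\<L>\<close> and \<open>w\<close>, it is annihilated by
  \<open>\<omega>\<^sup>1\<close>, and bracketing with \<open>w\<close> shows by descending induction that \<open>\<omega>\<^sup>1, \<dots>, \<omega>\<^sup>k\<^sup>-\<^sup>1\<^sup>-\<^sup>i\<close> annihilate
  \<open>\<G>\<^sup>i\<close>. Since \<open>\<G>\<^sup>k\<^sup>-\<^sup>1\<close> is the whole tangent space, the identity then makes \<open>dz\<^sup>l\<close> map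
  \<open>\<G>\<^sup>k\<^sup>-\<^sup>l \<inter> ker dz\<^sub>0\<close> onto \<open>\<real>\<^sup>m\<close> for every \<open>l\<close>, so that the \<open>z\<close> are coordinates.

  For Frobenius' theorem let \<open>P x\<close> be the projection onto \<open>\<L>(x)\<close> along a fixed complement of
  \<open>\<L>(x\<^sup>*)\<close>. The fields \<open>P a\<close> commute, and the endpoint of the curve \<open>w' = - P w (\<pi> p)\<close>, \<open>w 0 = p\<close>
  (with \<open>\<pi> = P x\<^sup>*\<close>) gives the first integrals as functions of \<open>p\<close>. For small \<open>p\<close> the integral equation
  is a contraction on \<open>C([0, 1])\<close> with constant \<open>1/2\<close>; its derivative in \<open>p\<close> solves a linear equation
  of the same kind, whence smoothness by induction on the order of differentiation.
\<close>

section \<open>Calculus of smooth maps\<close>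

text \<open>The facts on flags, characteristic fields and the drift are proved for any map
  \<open>\<phi>\<close> with bijective derivative, so that necessity can use them for the given
  equivalence and sufficiency for the map it constructs. During the construction that map is not yet
  a chart: the contact relations on G^i are derived for the smooth functions z alone, and their
  independence is shown at x* and spread by the inverse function theorem. The intermediate G^i come
  without a rank condition. To apply the bracket identity to a tangent vector, it is extended to a
  local section, which is possible because G^i is generated by smooth fields and their brackets. For
  (m-Comp) two one-sided facts do the work: coordinate fields are characteristic sections, and
  characteristic sections lie in the coordinate kernel. The order of differentiability refers to
  fixed directions, so a direction that moves with the point is expanded in a finite basis. Curves
  form an infinite-dimensional space; maps on it are differentiated by explicit formulas made of
  products, compositions and integrals, a class closed under differentiation.\<close>

abbreviation fderiv :: "('a::real_normed_vector \<Rightarrow> 'b::real_normed_vector) \<Rightarrow> 'a \<Rightarrow> 'a \<Rightarrow> 'b" (\<open>\<partial>\<close>) where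
  "\<partial> f x \<equiv> frechet_derivative f (at x)"

section \<open>Closure of finite differentiability under algebra and composition\<close>

lemma frechet_derivative_eqI: "(f has_derivative f') (at x) \<Longrightarrow> \<partial> f x = f'"
  using frechet_derivative_at by force

text \<open>On an open set the values of a map determine its derivatives, which are taken in the
  full space; without openness two maps that agree on the set could differ in their derivatives
  there.\<close>

lemma C_k_on_cong:
  assumes "open S" "C_k_on n S f" "\<And>x. x \<in> S \<Longrightarrow> f x = g x"
  shows "C_k_on n S g"
  using assms(2,3)
proof (induction n arbitrary: f g)
  case 0
  then show ?case by (simp cong: continuous_on_cong)
next
  case (Suc n)
  have der: "(g has_derivative \<partial> f x) (at x)" if "x \<in> S" for x
  proof (rule has_derivative_transform_within_open[OF _ \<open>open S\<close> that])
    show "(f has_derivative \<partial> f x) (at x)"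
      using Suc.prems(1) that by (simp add: frechet_derivative_works)
  qed (use Suc.prems in auto)
  have "C_k_on n S (\<lambda>x. \<partial> g x v)" for v
    by (rule Suc.IH[of "\<lambda>x. \<partial> f x v"])
      (use Suc.prems in \<open>auto simp: frechet_derivative_eqI[OF der]\<close>)
  then show ?case using der by (auto simp: differentiable_def)
qed

text \<open>Any explicit derivative may replace the one chosen by \<open>frechet_derivative\<close>;
  the later inductions on the order end with this rule.\<close>

lemma C_k_on_SucI:
  assumes "open S" "\<And>x. x \<in> S \<Longrightarrow> (f has_derivative f' x) (at x)" "\<And>v. C_k_on n S (\<lambda>x. f' x v)"
  shows "C_k_on (Suc n) S f"
proof -
  have "C_k_on n S (\<lambda>x. \<partial> f x v)" for v
    by (rule C_k_on_cong[OF assms(1,3)]) (simp add: frechet_derivative_eqI[OF assms(2)])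
  then show ?thesis
    using assms(2) by (auto simp: differentiable_def)
qed

lemma C_k_on_imp_continuous_on: "C_k_on n S f \<Longrightarrow> continuous_on S f"
  by (cases n) (auto intro: differentiable_imp_continuous_on differentiable_at_imp_differentiable_on)

lemma C_k_on_SucD: "C_k_on (Suc n) S f \<Longrightarrow> C_k_on n S f"
proof (induction n arbitrary: f)
  case 0
  then show ?case using C_k_on_imp_continuous_on[of "Suc 0"] by auto
next
  case (Suc n)
  show ?case
    unfolding C_k_on.simps(2)[of n] using Suc.prems Suc.IH[of "\<lambda>x. \<partial> f x _"]
    by auto
qed

lemma C_k_on_has_derivative:
  "C_k_on (Suc n) S f \<Longrightarrow> x \<in> S \<Longrightarrow> (f has_derivative \<partial> f x) (at x)"
  by (simp add: frechet_derivative_works)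

lemma C_k_on_subset: "C_k_on n S f \<Longrightarrow> T \<subseteq> S \<Longrightarrow> C_k_on n T f"
  by (induction n arbitrary: f) (auto intro: continuous_on_subset)

lemma C_k_on_const: "C_k_on n S (\<lambda>x. c)"
  by (induction n arbitrary: c) auto

lemma C_k_on_bounded_linear:
  assumes "bounded_linear L" "open S" "C_k_on n S f"
  shows "C_k_on n S (\<lambda>x. L (f x))"
  using assms(3)
proof (induction n arbitrary: f)
  case 0
  then show ?case using assms(1) by (simp add: bounded_linear.continuous_on)
next
  case (Suc n)
  show ?case
    by (rule C_k_on_SucI[OF assms(2), where f'="\<lambda>x v. L (\<partial> f x v)"])
      (use Suc in \<open>auto intro!: bounded_linear.has_derivative[OF assms(1)]
          simp: frechet_derivative_works\<close>)
qed

lemma C_k_on_add: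
  assumes "open S" "C_k_on n S f" "C_k_on n S g"
  shows "C_k_on n S (\<lambda>x. f x + g x)"
  using assms(2,3)
proof (induction n arbitrary: f g)
  case 0
  then show ?case by (simp add: continuous_on_add)
next
  case (Suc n)
  show ?case
    by (rule C_k_on_SucI[OF assms(1), where
          f'="\<lambda>x v. \<partial> f x v + \<partial> g x v"])
      (use Suc in \<open>auto intro!: has_derivative_add simp: frechet_derivative_works\<close>)
qed

lemma C_k_on_sum:
  assumes "open S" "\<And>i. i \<in> I \<Longrightarrow> C_k_on n S (f i)"
  shows "C_k_on n S (\<lambda>x. \<Sum>i\<in>I. f i x)"
  using assms(2)
  by (induction I rule: infinite_finite_induct) (auto intro: C_k_on_const C_k_on_add[OF assms(1)])

text \<open>The Leibniz rule is stated for an abstract product \<open>pr\<close> because the same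
  argument serves multiplication, scaling and the pointwise product of curves.\<close>

lemma C_k_on_bounded_bilinear:
  assumes "bounded_bilinear pr" "open S" "C_k_on n S f" "C_k_on n S g"
  shows "C_k_on n S (\<lambda>x. pr (f x) (g x))"
  using assms(3,4)
proof (induction n arbitrary: f g)
  case 0
  then show ?case using assms(1) by (simp add: bounded_bilinear.continuous_on)
next
  case (Suc n)
  show ?case
  proof (rule C_k_on_SucI[OF assms(2)])
    show "((\<lambda>x. pr (f x) (g x)) has_derivative (\<lambda>v. pr (f x) (\<partial> g x v) +
        pr (\<partial> f x v) (g x))) (at x)" if "x \<in> S" for x
      by (rule bounded_bilinear.FDERIV[OF assms(1)]) (use Suc.prems that C_k_on_has_derivative in auto)
    have "C_k_on n S f" "C_k_on n S g"
      using Suc.prems by (auto intro: C_k_on_SucD simp del: C_k_on.simps)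
    then show "C_k_on n S (\<lambda>x. pr (f x) (\<partial> g x v) +
        pr (\<partial> f x v) (g x))" for v
      using Suc by (intro C_k_on_add assms(2)) auto
  qed
qed

text \<open>Differentiability of order \<open>n\<close> speaks of fixed directions; this expansion
  reduces a direction depending on the point to finitely many fixed ones.\<close>

lemma frechet_derivative_basis:
  fixes g :: "'b::euclidean_space \<Rightarrow> 'c::real_normed_vector"
  assumes "g differentiable (at y)"
  shows "\<partial> g y v = (\<Sum>b\<in>Basis. (v \<bullet> b) *\<^sub>R \<partial> g y b)"
proof -
  have "linear (\<partial> g y)"
    using assms by (rule linear_frechet_derivative)
  then have "\<partial> g y (\<Sum>b\<in>Basis. (v \<bullet> b) *\<^sub>R b) = (\<Sum>b\<in>Basis. (v \<bullet> b) *\<^sub>R \<partial> g y b)"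
    by (simp add: linear_sum linear_scale)
  then show ?thesis by (simp add: euclidean_representation)
qed

text \<open>The chain rule is written as a sum over \<open>Basis\<close> so that each term is a
  coordinate of the derivative of \<open>f\<close> times a composition
  \<open>\<partial> g (f x) b\<close>, to which the induction hypothesis applies.\<close>

lemma C_k_on_compose:
  fixes g :: "'b::euclidean_space \<Rightarrow> 'c::real_normed_vector"
  assumes "open S" "open T" "C_k_on n S f" "C_k_on n T g" "f ` S \<subseteq> T"
  shows "C_k_on n S (\<lambda>x. g (f x))"
  using assms(3,4,5)
proof (induction n arbitrary: f g)
  case 0
  then show ?case by (auto intro: continuous_on_compose2)
next
  case (Suc n)
  have f: "C_k_on n S f"
    using Suc.prems(1) by (rule C_k_on_SucD)
  show ?case
  proof (rule C_k_on_SucI[OF assms(1)])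
    show "((\<lambda>x. g (f x)) has_derivative
        (\<lambda>v. \<Sum>b\<in>Basis. (\<partial> f x v \<bullet> b) *\<^sub>R \<partial> g (f x) b)) (at x)"
      if "x \<in> S" for x
    proof -
      have "f x \<in> T" using that Suc.prems by auto
      then have "g differentiable (at (f x))" using Suc.prems by auto
      then have *: "(\<Sum>b\<in>Basis. (v \<bullet> b) *\<^sub>R \<partial> g (f x) b) = \<partial> g (f x) v" for v
        by (rule frechet_derivative_basis[symmetric])
      show ?thesis
        unfolding * by (rule has_derivative_compose[of f "\<partial> f x" x UNIV])
          (use Suc.prems that \<open>f x \<in> T\<close> in \<open>auto simp flip: frechet_derivative_works\<close>)
    qed
    show "C_k_on n S (\<lambda>x. \<Sum>b\<in>Basis. (\<partial> f x v \<bullet> b) *\<^sub>R \<partial> g (f x) b)"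
      for v
      by (intro C_k_on_sum assms(1) C_k_on_bounded_bilinear[OF bounded_bilinear_scaleR]
          C_k_on_bounded_linear[OF bounded_linear_inner_left] Suc.IH[OF f])
        (use Suc.prems in auto)
  qed
qed

text \<open>One order is lost in \<open>f\<close> and none in \<open>v\<close>, as differentiating
  along \<open>v\<close> does not differentiate \<open>v\<close>.\<close>

lemma C_k_on_lie:
  fixes v :: "'a::euclidean_space \<Rightarrow> 'a"
  assumes "open S" "C_k_on (Suc n) S f" "C_k_on n S v"
  shows "C_k_on n S (\<lambda>x. \<partial> f x (v x))"
proof (rule C_k_on_cong[OF assms(1)])
  show "C_k_on n S (\<lambda>x. \<Sum>b\<in>Basis. (v x \<bullet> b) *\<^sub>R \<partial> f x b)"
    using assms by (intro C_k_on_sum C_k_on_bounded_bilinear[OF bounded_bilinear_scaleR]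
      C_k_on_bounded_linear[OF bounded_linear_inner_left]) auto
  show "(\<Sum>b\<in>Basis. (v x \<bullet> b) *\<^sub>R \<partial> f x b) = \<partial> f x (v x)"
    if "x \<in> S" for x
    using assms that frechet_derivative_basis[of f x "v x"] by auto
qed

text \<open>The derivative of the reciprocal is a product containing the reciprocal itself, so order
  \<open>n\<close> yields order \<open>n + 1\<close>. The factor \<open>- 1\<close> is kept as a
  product to stay within the Leibniz rule.\<close>

lemma C_k_on_inverse:
  fixes f :: "'a::real_normed_vector \<Rightarrow> real"
  assumes "open S" "C_k_on n S f" "\<And>x. x \<in> S \<Longrightarrow> f x \<noteq> 0"
  shows "C_k_on n S (\<lambda>x. inverse (f x))"
  using assms(2)
proof (induction n)
  case 0
  then show ?case using assms(3) by (simp add: continuous_on_inverse)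
next
  case (Suc n)
  show ?case
  proof (rule C_k_on_SucI[OF assms(1)])
    show "((\<lambda>x. inverse (f x)) has_derivative (\<lambda>v. (- 1) * ((inverse (f x) * \<partial> f x v) * inverse (f x)))) (at x)"
      if "x \<in> S" for x
      using Deriv.has_derivative_inverse[OF assms(3)[OF that] C_k_on_has_derivative[OF Suc.prems that]] by simp
    have "C_k_on n S (\<lambda>x. inverse (f x))"
      using Suc by (auto intro: C_k_on_SucD simp del: C_k_on.simps)
    then show "C_k_on n S (\<lambda>x. (- 1) * ((inverse (f x) * \<partial> f x v) * inverse (f x)))" for v
      using Suc.prems by (intro C_k_on_bounded_bilinear[OF bounded_bilinear_mult] assms(1) C_k_on_const) auto
  qed
qed

section \<open>Smooth maps, and vectors and matrices of smooth functions\<close>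

lemma smooth_onD: "smooth_on S f \<Longrightarrow> C_k_on n S f"
  by (simp add: smooth_on_def)

lemma smooth_on_cong: "open S \<Longrightarrow> smooth_on S f \<Longrightarrow> (\<And>x. x \<in> S \<Longrightarrow> f x = g x) \<Longrightarrow> smooth_on S g"
  unfolding smooth_on_def using C_k_on_cong by blast

lemma smooth_on_subset: "smooth_on S f \<Longrightarrow> T \<subseteq> S \<Longrightarrow> smooth_on T f"
  unfolding smooth_on_def using C_k_on_subset by blast

lemma smooth_on_const [simp]: "smooth_on S (\<lambda>x. c)"
  by (simp add: smooth_on_def C_k_on_const)

lemma smooth_on_ident [simp]: "smooth_on S (\<lambda>x. x)"
proof -
  have "C_k_on n S (\<lambda>x. x)" for n
    by (cases n) (auto simp: C_k_on_const)
  then show ?thesis by (simp add: smooth_on_def)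
qed

lemma smooth_on_bounded_linear: "bounded_linear L \<Longrightarrow> open S \<Longrightarrow> smooth_on S f \<Longrightarrow> smooth_on S (\<lambda>x. L (f x))"
  by (simp add: smooth_on_def C_k_on_bounded_linear)

lemma smooth_on_add: "open S \<Longrightarrow> smooth_on S f \<Longrightarrow> smooth_on S g \<Longrightarrow> smooth_on S (\<lambda>x. f x + g x)"
  by (simp add: smooth_on_def C_k_on_add)

lemma smooth_on_sum: "open S \<Longrightarrow> (\<And>i. i \<in> I \<Longrightarrow> smooth_on S (f i)) \<Longrightarrow> smooth_on S (\<lambda>x. \<Sum>i\<in>I. f i x)"
  by (simp add: smooth_on_def C_k_on_sum)

lemma smooth_on_bounded_bilinear:
  "bounded_bilinear pr \<Longrightarrow> open S \<Longrightarrow> smooth_on S f \<Longrightarrow> smooth_on S g \<Longrightarrow> smooth_on S (\<lambda>x. pr (f x) (g x))"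
  by (simp add: smooth_on_def C_k_on_bounded_bilinear)

lemmas smooth_on_mult = smooth_on_bounded_bilinear[OF bounded_bilinear_mult]
lemmas smooth_on_scaleR = smooth_on_bounded_bilinear[OF bounded_bilinear_scaleR]

lemma smooth_on_minus: "open S \<Longrightarrow> smooth_on S f \<Longrightarrow> smooth_on S (\<lambda>x. - f x)"
  by (rule smooth_on_bounded_linear[OF bounded_linear_minus[OF bounded_linear_ident]])

lemma smooth_on_diff: "open S \<Longrightarrow> smooth_on S f \<Longrightarrow> smooth_on S g \<Longrightarrow> smooth_on S (\<lambda>x. f x - g x)"
  using smooth_on_add[of S f "\<lambda>x. - g x"] smooth_on_minus[of S g] by simp

lemma smooth_on_compose:
  fixes g :: "'b::euclidean_space \<Rightarrow> 'c::real_normed_vector"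
  shows "open S \<Longrightarrow> open T \<Longrightarrow> smooth_on S f \<Longrightarrow> smooth_on T g \<Longrightarrow> f ` S \<subseteq> T \<Longrightarrow> smooth_on S (\<lambda>x. g (f x))"
  by (simp add: smooth_on_def C_k_on_compose)

lemma smooth_on_inverse:
  fixes f :: "'a::real_normed_vector \<Rightarrow> real"
  shows "open S \<Longrightarrow> smooth_on S f \<Longrightarrow> (\<And>x. x \<in> S \<Longrightarrow> f x \<noteq> 0) \<Longrightarrow> smooth_on S (\<lambda>x. inverse (f x))"
  by (simp add: smooth_on_def C_k_on_inverse)

lemma smooth_on_frechet_derivative:
  fixes v :: "'a::euclidean_space \<Rightarrow> 'a"
  shows "open S \<Longrightarrow> smooth_on S f \<Longrightarrow> smooth_on S v \<Longrightarrow> smooth_on S (\<lambda>x. \<partial> f x (v x))"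
  unfolding smooth_on_def using C_k_on_lie by blast

lemma smooth_on_imp_differentiable: "smooth_on S f \<Longrightarrow> x \<in> S \<Longrightarrow> f differentiable (at x)"
  using smooth_onD[of S f 1] by simp

lemma smooth_on_has_derivative:
  "smooth_on S f \<Longrightarrow> x \<in> S \<Longrightarrow> (f has_derivative \<partial> f x) (at x)"
  using smooth_on_imp_differentiable frechet_derivative_works by blast

lemma smooth_on_imp_continuous_on: "smooth_on S f \<Longrightarrow> continuous_on S f"
  using smooth_onD[of S f 0] by simp

lemma smooth_on_nth: "open S \<Longrightarrow> smooth_on S f \<Longrightarrow> smooth_on S (\<lambda>x. f x $ i)"
  by (rule smooth_on_bounded_linear[OF bounded_linear_vec_nth])

lemma C_k_on_vec:
  fixes f :: "'i::finite \<Rightarrow> 'a::real_normed_vector \<Rightarrow> real"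
  assumes "open S" "\<And>i. C_k_on n S (f i)"
  shows "C_k_on n S (\<lambda>x. \<chi> i. f i x)"
proof (rule C_k_on_cong[OF assms(1)])
  show "C_k_on n S (\<lambda>x. \<Sum>i\<in>UNIV. f i x *\<^sub>R axis i (1::real))"
    by (intro C_k_on_sum C_k_on_bounded_linear[OF bounded_linear_scaleR_left] assms)
  show "(\<Sum>i\<in>UNIV. f i x *\<^sub>R axis i (1::real)) = (\<chi> i. f i x)" if "x \<in> S" for x
    by (simp add: vec_eq_iff axis_def if_distrib cong: if_cong)
qed

lemma smooth_on_vec:
  fixes f :: "'i::finite \<Rightarrow> 'a::real_normed_vector \<Rightarrow> real"
  shows "open S \<Longrightarrow> (\<And>i. smooth_on S (f i)) \<Longrightarrow> smooth_on S (\<lambda>x. \<chi> i. f i x)"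
  by (simp add: smooth_on_def C_k_on_vec)

lemma smooth_on_matrix:
  fixes A :: "'a::real_normed_vector \<Rightarrow> real^'n^'m"
  assumes "open S" "\<And>i j. smooth_on S (\<lambda>x. A x $ i $ j)"
  shows "smooth_on S A"
proof (rule smooth_on_cong[OF assms(1)])
  show "smooth_on S (\<lambda>x. \<Sum>i\<in>UNIV. \<Sum>j\<in>UNIV. A x $ i $ j *\<^sub>R axis i (axis j (1::real)))"
    by (intro smooth_on_sum smooth_on_bounded_linear[OF bounded_linear_scaleR_left] assms)
  show "(\<Sum>i\<in>UNIV. \<Sum>j\<in>UNIV. A x $ i $ j *\<^sub>R axis i (axis j (1::real))) = A x" if "x \<in> S" for x
  proof -
    have "(\<Sum>i\<in>UNIV. \<Sum>j\<in>UNIV. A x $ i $ j *\<^sub>R axis i (axis j (1::real))) $ a $ b = A x $ a $ b" for a b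
    proof -
      have "(\<Sum>i\<in>UNIV. \<Sum>j\<in>UNIV. A x $ i $ j *\<^sub>R axis i (axis j (1::real))) $ a $ b
          = (\<Sum>i\<in>UNIV. \<Sum>j\<in>UNIV. if i = a then if j = b then A x $ i $ j else 0 else 0)"
        by (auto intro!: sum.cong simp: axis_def)
      also have "\<dots> = (\<Sum>i\<in>UNIV. if i = a then \<Sum>j\<in>UNIV. if j = b then A x $ i $ j else 0 else 0)"
        by (intro sum.cong) auto
      finally show ?thesis by simp
    qed
    then show ?thesis by (simp add: vec_eq_iff)
  qed
qed

section \<open>Inverse matrices and the inverse function theorem\<close>

lemma matrix_inv_mult:
  fixes A :: "real^'n^'n"
  assumes "invertible A"
  shows "A *v (matrix_inv A *v v) = v" "matrix_inv A *v (A *v v) = v"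
proof -
  have "\<exists>A'. A ** A' = mat 1 \<and> A' ** A = mat 1"
    using assms by (simp add: invertible_def)
  then have "A ** matrix_inv A = mat 1 \<and> matrix_inv A ** A = mat 1"
    unfolding matrix_inv_def by (rule someI_ex)
  then show "A *v (matrix_inv A *v v) = v" "matrix_inv A *v (A *v v) = v"
    by (simp_all add: matrix_vector_mul_assoc)
qed

lemma C_k_on_det:
  fixes A :: "'a::real_normed_vector \<Rightarrow> real^'n^'n"
  assumes "open S" "\<And>i j. C_k_on n S (\<lambda>x. A x $ i $ j)"
  shows "C_k_on n S (\<lambda>x. det (A x))"
proof -
  have *: "C_k_on n S (\<lambda>x. \<Prod>i\<in>I. A x $ i $ p i)" for I p
    by (induction I rule: infinite_finite_induct)
      (auto intro: C_k_on_const C_k_on_bounded_bilinear[OF bounded_bilinear_mult] assms)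
  show ?thesis
    unfolding det_def by (intro C_k_on_sum assms(1) C_k_on_bounded_bilinear[OF bounded_bilinear_mult] C_k_on_const *)
qed

text \<open>Cramer's rule: the solution of a linear system is a quotient of determinants, which are
  polynomials in the entries. The order \<open>n\<close> is kept explicit so that the result can
  serve inside an induction on it.\<close>

lemma C_k_on_matrix_inv_mult:
  fixes A :: "'a::real_normed_vector \<Rightarrow> real^'n^'n"
  assumes "open S" "\<And>i j. C_k_on n S (\<lambda>x. A x $ i $ j)" "\<And>i. C_k_on n S (\<lambda>x. b x $ i)"
    and "\<And>x. x \<in> S \<Longrightarrow> invertible (A x)"
  shows "C_k_on n S (\<lambda>x. matrix_inv (A x) *v b x)"
proof (rule C_k_on_cong[OF assms(1)])
  show "C_k_on n S (\<lambda>x. \<chi> k. det(\<chi> i j. if j=k then b x$i else A x$i$j) * inverse (det (A x)))"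
  proof (intro C_k_on_vec C_k_on_bounded_bilinear[OF bounded_bilinear_mult] assms(1) C_k_on_det C_k_on_inverse)
    show "C_k_on n S (\<lambda>x. (\<chi> i j. if j = k then b x $ i else A x $ i $ j) $ i $ j)" for k i j
      by (cases "j = k") (simp_all add: assms)
  qed (use assms in \<open>simp_all add: invertible_det_nz\<close>)
  show "(\<chi> k. det(\<chi> i j. if j=k then b x$i else A x$i$j) * inverse (det (A x))) = matrix_inv (A x) *v b x"
    if "x \<in> S" for x
  proof -
    have "A x *v (matrix_inv (A x) *v b x) = b x"
      using assms(4)[OF that] by (simp add: matrix_inv_mult)
    then show ?thesis
      using cramer[of "A x"] assms(4)[OF that] by (simp add: divide_inverse invertible_det_nz)
  qed
qed

lemma smooth_on_matrix_inv_mult: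
  fixes A :: "'a::real_normed_vector \<Rightarrow> real^'n^'n"
  assumes "open S" "\<And>i j. smooth_on S (\<lambda>x. A x $ i $ j)" "\<And>i. smooth_on S (\<lambda>x. b x $ i)"
    and "\<And>x. x \<in> S \<Longrightarrow> invertible (A x)"
  shows "smooth_on S (\<lambda>x. matrix_inv (A x) *v b x)"
  using assms C_k_on_matrix_inv_mult unfolding smooth_on_def by blast

lemma smooth_on_matrix_inv:
  fixes A :: "'a::real_normed_vector \<Rightarrow> real^'n^'n"
  assumes "open S" "\<And>i j. smooth_on S (\<lambda>x. A x $ i $ j)" "\<And>x. x \<in> S \<Longrightarrow> invertible (A x)"
  shows "smooth_on S (\<lambda>x. matrix_inv (A x))"
proof (rule smooth_on_matrix[OF assms(1)])
  fix i j
  have *: "(\<lambda>x. matrix_inv (A x) $ i $ j) = (\<lambda>x. (matrix_inv (A x) *v axis j 1) $ i)"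
    by (simp add: matrix_vector_mult_def axis_def if_distrib cong: if_cong)
  show "smooth_on S (\<lambda>x. matrix_inv (A x) $ i $ j)"
    unfolding * by (intro smooth_on_nth smooth_on_matrix_inv_mult assms) simp
qed

text \<open>Bootstrap: the local inverse \<open>g\<close> has a derivative inverse to
  \<open>\<partial> f (g y)\<close>. If \<open>g\<close> is of order \<open>n\<close>, so are the
  entries of that matrix and, by Cramer's rule, its inverse; hence \<open>g\<close> is of order
  \<open>n + 1\<close>.\<close>

lemma smooth_inverse_function_theorem:
  fixes f :: "real^'n \<Rightarrow> real^'n"
  assumes "open U" "smooth_on U f" "x0 \<in> U" "inj (\<partial> f x0)"
  obtains U' V g where "open U'" "U' \<subseteq> U" "x0 \<in> U'" "open V" "f x0 \<in> V" "homeomorphism U' V f g"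
    "smooth_on V g" "\<And>x. x \<in> U' \<Longrightarrow> bij (\<partial> f x)"
proof -
  define f' where "f' = (\<lambda>x. Blinfun (\<partial> f x))"
  have bl: "bounded_linear (\<partial> f x)" if "x \<in> U" for x
    using smooth_on_has_derivative[OF assms(2) that] has_derivative_bounded_linear by blast
  have f': "blinfun_apply (f' x) = \<partial> f x" if "x \<in> U" for x
    unfolding f'_def using bl[OF that] by (rule bounded_linear_Blinfun_apply)
  have derf: "(f has_derivative blinfun_apply (f' x)) (at x)" if "x \<in> U" for x
    using smooth_on_has_derivative[OF assms(2) that] f'[OF that] by simp
  have contf: "continuous_on U f'"
  proof (rule continuous_on_blinfun_componentwise)
    fix i :: "real^'n"
    have "continuous_on U (\<lambda>x. \<partial> f x i)"
      using smooth_onD[OF assms(2), of 1] by simp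
    then show "continuous_on U (\<lambda>x. blinfun_apply (f' x) i)"
      by (simp add: f' cong: continuous_on_cong)
  qed
  obtain h where h: "linear h" "h \<circ> \<partial> f x0 = id"
    using linear_injective_left_inverse[of "\<partial> f x0"] assms(4) bl[OF assms(3)]
    by (auto simp: linear_conv_bounded_linear)
  have "Blinfun h o\<^sub>L f' x0 = id_blinfun"
    using h f'[OF assms(3)]
    by (intro blinfun_eqI) (simp add: bounded_linear_Blinfun_apply linear_conv_bounded_linear pointfree_idE)
  then obtain U' V g g' where *: "open U'" "U' \<subseteq> U" "x0 \<in> U'" "open V" "f x0 \<in> V" "homeomorphism U' V f g"
    "\<And>y. y \<in> V \<Longrightarrow> (g has_derivative (g' y)) (at y)"
    "\<And>y. y \<in> V \<Longrightarrow> g' y = inv (blinfun_apply (f'(g y)))"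
    "\<And>y. y \<in> V \<Longrightarrow> bij (blinfun_apply (f'(g y)))"
    using inverse_function_theorem[OF assms(1) derf contf assms(3)] by blast
  have gU: "g y \<in> U'" if "y \<in> V" for y
    using *(6) that by (auto simp: homeomorphism_def)
  define A where "A = (\<lambda>y. matrix (\<partial> f (g y)))"
  have Av: "A y *v v = \<partial> f (g y) v" if "y \<in> V" for y v
    unfolding A_def using bl[of "g y"] gU[OF that] *(2)
    by (intro matrix_works) (auto intro: bounded_linear.linear simp: linear_matrix_vector_mul_eq)
  have bijA: "bij ((*v) (A y))" if "y \<in> V" for y
  proof -
    have "(*v) (A y) = blinfun_apply (f' (g y))"
      using Av[OF that] f'[of "g y"] gU[OF that] *(2) by (intro ext) (simp add: subset_iff)
    then show ?thesis using *(9)[OF that] by simp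
  qed
  have inv: "invertible (A y)" if "y \<in> V" for y
    using bijA[OF that] by (simp add: invertible_left_inverse matrix_left_invertible_injective bij_is_inj)
  have g'v: "g' y v = matrix_inv (A y) *v v" if "y \<in> V" for y v
  proof -
    have "(*v) (A y) = blinfun_apply (f' (g y))"
      using Av[OF that] f'[of "g y"] gU[OF that] *(2) by (intro ext) (simp add: subset_iff)
    then have "g' y v = inv ((*v) (A y)) v"
      using *(8)[OF that] by simp
    also have "\<dots> = matrix_inv (A y) *v v"
      using bijA[OF that] matrix_inv_mult(1)[OF inv[OF that]] by (metis bij_inv_eq_iff)
    finally show ?thesis .
  qed
  have "C_k_on n V g" for n
  proof (induction n)
    case 0
    then show ?case using *(6) by (simp add: homeomorphism_def)
  next
    case (Suc n)
    show ?case
    proof (rule C_k_on_SucI[OF *(4)])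
      show "(g has_derivative (\<lambda>v. matrix_inv (A y) *v v)) (at y)" if "y \<in> V" for y
        using *(7)[OF that] g'v[OF that] by (metis (no_types, lifting) ext)
      have A: "C_k_on n V (\<lambda>y. A y $ i $ j)" for i j
      proof -
        have "C_k_on n V (\<lambda>y. \<partial> f (g y) (axis j 1))"
          by (rule C_k_on_compose[OF *(4) assms(1) Suc])
            (use smooth_onD[OF assms(2), of "Suc n"] gU *(2) in auto)
        from C_k_on_bounded_linear[OF bounded_linear_vec_nth[of i] *(4) this] show ?thesis
          by (simp add: A_def matrix_def)
      qed
      show "C_k_on n V (\<lambda>y. matrix_inv (A y) *v v)" for v
        by (rule C_k_on_matrix_inv_mult[OF *(4) A C_k_on_const inv])
    qed
  qed
  then have "smooth_on V g" by (simp add: smooth_on_def)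
  moreover have "bij (\<partial> f x)" if "x \<in> U'" for x
  proof -
    have "f x \<in> V" "g (f x) = x" using *(6) that by (auto simp: homeomorphism_def)
    then show ?thesis using *(9)[of "f x"] f'[of x] *(2) that by auto
  qed
  ultimately show thesis using that *(1-6) by blast
qed

section \<open>Symmetry of second derivatives and the bracket as a commutator\<close>

text \<open>The mean value theorem twice: for the increment in direction \<open>b\<close> as a
  function of the step along \<open>a\<close>, and for the derivative along \<open>a\<close> as a
  function of the step along \<open>b\<close>. The second difference itself is symmetric in
  \<open>a\<close> and \<open>b\<close>.\<close>

lemma second_difference_eq:
  fixes f :: "'a::real_normed_vector \<Rightarrow> real"
  assumes "\<And>s t. 0 \<le> s \<Longrightarrow> s \<le> h \<Longrightarrow> 0 \<le> t \<Longrightarrow> t \<le> h \<Longrightarrow> x + s *\<^sub>R a + t *\<^sub>R b \<in> S"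
    and "C_k_on 2 S f" "h > 0"
  shows "\<exists>s t. 0 \<le> s \<and> s \<le> h \<and> 0 \<le> t \<and> t \<le> h \<and>
    f (x + h *\<^sub>R a + h *\<^sub>R b) - f (x + h *\<^sub>R a) - f (x + h *\<^sub>R b) + f x =
    h * h * \<partial> (\<lambda>y. \<partial> f y a) (x + s *\<^sub>R a + t *\<^sub>R b) b"
proof -
  let ?D = "\<lambda>y. \<partial> f y a"
  have d1: "(f has_derivative \<partial> f y) (at y)" if "y \<in> S" for y
    using assms(2) that by (simp add: numeral_2_eq_2 frechet_derivative_works)
  have d2: "(?D has_derivative \<partial> ?D y) (at y)" if "y \<in> S" for y
    using assms(2) that by (simp add: numeral_2_eq_2 frechet_derivative_works)
  define p where "p s = f (x + s *\<^sub>R a + h *\<^sub>R b) - f (x + s *\<^sub>R a)" for s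
  have p: "(p has_derivative (\<lambda>r. r * (?D (x + s *\<^sub>R a + h *\<^sub>R b) - ?D (x + s *\<^sub>R a)))) (at s)"
    if "0 \<le> s" "s \<le> h" for s
  proof -
    have S: "x + s *\<^sub>R a + h *\<^sub>R b \<in> S" "x + s *\<^sub>R a \<in> S"
      using assms(1)[of s h] assms(1)[of s 0] that assms(3) by auto
    have "(p has_derivative (\<lambda>r. \<partial> f (x + s *\<^sub>R a + h *\<^sub>R b) (r *\<^sub>R a)
        - \<partial> f (x + s *\<^sub>R a) (r *\<^sub>R a))) (at s)"
      unfolding p_def
      by (intro has_derivative_diff
          has_derivative_compose[of "\<lambda>s. x + s *\<^sub>R a + h *\<^sub>R b" _ s UNIV f, OF _ d1[OF S(1)]]
          has_derivative_compose[of "\<lambda>s. x + s *\<^sub>R a" _ s UNIV f, OF _ d1[OF S(2)]])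
        (auto intro!: derivative_eq_intros)
    moreover have "\<partial> f y (r *\<^sub>R a) = r * ?D y" if "y \<in> S" for y r
      using linear_scale[OF has_derivative_linear[OF d1[OF that]]] by simp
    ultimately show ?thesis using S by (simp add: right_diff_distrib)
  qed
  have "continuous_on {0..h} p"
    by (rule continuous_at_imp_continuous_on) (auto intro: has_derivative_continuous[OF p])
  then obtain s where s: "0 < s" "s < h" "p h - p 0 = (h - 0) * (?D (x + s *\<^sub>R a + h *\<^sub>R b) - ?D (x + s *\<^sub>R a))"
    using mvt[OF assms(3), of p "\<lambda>s r. r * (?D (x + s *\<^sub>R a + h *\<^sub>R b) - ?D (x + s *\<^sub>R a))"] p by auto
  define q where "q t = ?D (x + s *\<^sub>R a + t *\<^sub>R b)" for t
  have q: "(q has_derivative (\<lambda>r. r * \<partial> ?D (x + s *\<^sub>R a + t *\<^sub>R b) b)) (at t)"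
    if "0 \<le> t" "t \<le> h" for t
  proof -
    have S: "x + s *\<^sub>R a + t *\<^sub>R b \<in> S"
      using assms(1)[of s t] that s by auto
    have "(q has_derivative (\<lambda>r. \<partial> ?D (x + s *\<^sub>R a + t *\<^sub>R b) (r *\<^sub>R b))) (at t)"
      unfolding q_def by (intro has_derivative_compose[of "\<lambda>t. x + s *\<^sub>R a + t *\<^sub>R b" _ t UNIV ?D, OF _ d2[OF S]]) (auto intro!: derivative_eq_intros)
    then show ?thesis using linear_scale[OF has_derivative_linear[OF d2[OF S]]] by simp
  qed
  have "continuous_on {0..h} q"
    by (rule continuous_at_imp_continuous_on) (auto intro: has_derivative_continuous[OF q])
  then obtain t where t: "0 < t" "t < h" "q h - q 0 = (h - 0) * \<partial> ?D (x + s *\<^sub>R a + t *\<^sub>R b) b"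
    using mvt[OF assms(3), of q "\<lambda>t r. r * \<partial> ?D (x + s *\<^sub>R a + t *\<^sub>R b) b"] q by auto
  have "f (x + h *\<^sub>R a + h *\<^sub>R b) - f (x + h *\<^sub>R a) - f (x + h *\<^sub>R b) + f x = p h - p 0"
    by (simp add: p_def)
  also have "\<dots> = h * (q h - q 0)"
    using s by (simp add: q_def)
  also have "\<dots> = h * h * \<partial> ?D (x + s *\<^sub>R a + t *\<^sub>R b) b"
    using t by simp
  finally show ?thesis using s t by (intro exI[of _ s] exI[of _ t]) auto
qed

text \<open>Both mixed derivatives, at points near \<open>x\<close>, equal the same second
  difference divided by \<open>h * h\<close>; continuity carries this to \<open>x\<close>.\<close>

lemma second_derivative_symmetric_real:
  fixes f :: "'a::real_normed_vector \<Rightarrow> real"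
  assumes "open S" "C_k_on 2 S f" "x \<in> S"
  shows "\<partial> (\<lambda>y. \<partial> f y a) x b =
    \<partial> (\<lambda>y. \<partial> f y b) x a"
proof -
  let ?A = "\<lambda>x. \<partial> (\<lambda>y. \<partial> f y a) x b"
  let ?B = "\<lambda>x. \<partial> (\<lambda>y. \<partial> f y b) x a"
  have cont: "continuous_on S ?A" "continuous_on S ?B"
    using assms(2) by (simp_all add: numeral_2_eq_2)
  have "dist (?A x) (?B x) \<le> e" if "e > 0" for e
  proof -
    obtain d1 where d1: "d1 > 0" "\<And>y. y \<in> S \<Longrightarrow> dist y x < d1 \<Longrightarrow> dist (?A y) (?A x) < e/2"
      using cont(1) assms(3) \<open>e > 0\<close> unfolding continuous_on_iff by (metis half_gt_zero)
    obtain d2 where d2: "d2 > 0" "\<And>y. y \<in> S \<Longrightarrow> dist y x < d2 \<Longrightarrow> dist (?B y) (?B x) < e/2"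
      using cont(2) assms(3) \<open>e > 0\<close> unfolding continuous_on_iff by (metis half_gt_zero)
    obtain d3 where d3: "d3 > 0" "ball x d3 \<subseteq> S"
      using assms(1,3) open_contains_ball by blast
    define d where "d = min d1 (min d2 d3)"
    define N where "N = norm a + norm b + 1"
    \<comment> \<open>With this step the parallelogram with sides \<open>h *\<^sub>R a\<close> and
      \<open>h *\<^sub>R b\<close> stays within d / 2 of \<open>x\<close>; the summand 1 in
      \<open>N\<close> allows both directions to vanish.\<close>
    define h where "h = d / (2 * N)"
    have nz: "N > 0" by (simp add: N_def add_nonneg_pos)
    have "d > 0" "h > 0" using d1 d2 d3 nz by (auto simp: d_def h_def)
    have near: "dist (x + s *\<^sub>R a + t *\<^sub>R b) x < d" if "0 \<le> s" "s \<le> h" "0 \<le> t" "t \<le> h" for s t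
    proof -
      have "dist (x + s *\<^sub>R a + t *\<^sub>R b) x \<le> s * norm a + t * norm b"
        using that norm_triangle_ineq[of "s *\<^sub>R a" "t *\<^sub>R b"] by (simp add: dist_norm add.assoc)
      also have "\<dots> \<le> h * norm a + h * norm b"
        using that by (intro add_mono mult_right_mono) auto
      also have "\<dots> \<le> h * N"
        using \<open>h > 0\<close> by (simp add: N_def algebra_simps)
      also have "\<dots> = d / 2"
        using nz by (simp add: h_def)
      also have "\<dots> < d"
        using \<open>d > 0\<close> by simp
      finally show ?thesis .
    qed
    have inS: "x + s *\<^sub>R a + t *\<^sub>R b \<in> S" if "0 \<le> s" "s \<le> h" "0 \<le> t" "t \<le> h" for s t
      using near[OF that] d3(2) by (auto simp: d_def dist_commute)
    have inS': "x + t *\<^sub>R b + s *\<^sub>R a \<in> S" if "0 \<le> t" "t \<le> h" "0 \<le> s" "s \<le> h" for s t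
      using inS[OF that(3,4,1,2)] by (simp add: algebra_simps)
    obtain s t where st: "0 \<le> s" "s \<le> h" "0 \<le> t" "t \<le> h"
      "f (x + h *\<^sub>R a + h *\<^sub>R b) - f (x + h *\<^sub>R a) - f (x + h *\<^sub>R b) + f x = h * h * ?A (x + s *\<^sub>R a + t *\<^sub>R b)"
      using second_difference_eq[of h x a b S f, OF inS assms(2) \<open>h > 0\<close>] by blast
    obtain s' t' where st': "0 \<le> t'" "t' \<le> h" "0 \<le> s'" "s' \<le> h"
      "f (x + h *\<^sub>R b + h *\<^sub>R a) - f (x + h *\<^sub>R b) - f (x + h *\<^sub>R a) + f x = h * h * ?B (x + t' *\<^sub>R b + s' *\<^sub>R a)"
      using second_difference_eq[of h x b a S f, OF inS' assms(2) \<open>h > 0\<close>] by blast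
    have "h * h * ?A (x + s *\<^sub>R a + t *\<^sub>R b) = h * h * ?B (x + s' *\<^sub>R a + t' *\<^sub>R b)"
      using st(5) st'(5) by (simp add: algebra_simps)
    then have eq: "?A (x + s *\<^sub>R a + t *\<^sub>R b) = ?B (x + s' *\<^sub>R a + t' *\<^sub>R b)"
      using \<open>h > 0\<close> by simp
    have "dist (?A (x + s *\<^sub>R a + t *\<^sub>R b)) (?A x) < e/2"
      by (rule d1(2)) (use near[OF st(1-4)] inS[OF st(1-4)] in \<open>auto simp: d_def\<close>)
    moreover have "dist (?B (x + s' *\<^sub>R a + t' *\<^sub>R b)) (?B x) < e/2"
      by (rule d2(2)) (use near[OF st'(3,4,1,2)] inS[OF st'(3,4,1,2)] in \<open>auto simp: d_def\<close>)
    ultimately show ?thesis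
      using eq dist_triangle3[of "?A x" "?B x" "?A (x + s *\<^sub>R a + t *\<^sub>R b)"] by simp
  qed
  then have "dist (?A x) (?B x) \<le> 0"
    by (rule field_le_epsilon, simp)
  then show ?thesis by simp
qed

lemma frechet_derivative_bounded_linear:
  assumes "bounded_linear L" "f differentiable (at x)"
  shows "\<partial> (\<lambda>y. L (f y)) x v = L (\<partial> f x v)"
  using frechet_derivative_eqI[OF bounded_linear.has_derivative[OF assms(1)], of f "\<partial> f x" x]
    assms(2) by (simp add: frechet_derivative_works)

lemma second_derivative_symmetric:
  fixes f :: "'a::real_normed_vector \<Rightarrow> 'b::euclidean_space"
  assumes "open S" "smooth_on S f" "x \<in> S"
  shows "\<partial> (\<lambda>y. \<partial> f y a) x b =
    \<partial> (\<lambda>y. \<partial> f y b) x a"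
proof (rule euclidean_eqI)
  fix c :: 'b
  let ?f = "\<lambda>y. f y \<bullet> c"
  have sm: "smooth_on S ?f"
    by (rule smooth_on_bounded_linear[OF bounded_linear_inner_left assms(1,2)])
  have *: "\<partial> (\<lambda>y. \<partial> ?f y a) x b
      = \<partial> (\<lambda>y. \<partial> f y a) x b \<bullet> c" for a b
  proof -
    have d: "(\<lambda>y. \<partial> f y a) differentiable (at x)"
      using smooth_onD[OF assms(2), of 2] assms(3) by (simp add: numeral_2_eq_2)
    have "\<partial> (\<lambda>y. \<partial> ?f y a) x
      = \<partial> (\<lambda>y. \<partial> f y a \<bullet> c) x"
    proof (rule frechet_derivative_transform_within_open[symmetric, OF _ assms(1,3)])
      show "(\<lambda>y. \<partial> f y a \<bullet> c) differentiable at x"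
        using d by (rule differentiable_compose[OF bounded_linear_imp_differentiable[OF bounded_linear_inner_left]])
      show "\<partial> f y a \<bullet> c = \<partial> ?f y a" if "y \<in> S" for y
        using frechet_derivative_bounded_linear[OF bounded_linear_inner_left smooth_on_imp_differentiable[OF assms(2) that]]
        by simp
    qed
    then show ?thesis
      using frechet_derivative_bounded_linear[OF bounded_linear_inner_left d] by simp
  qed
  show "\<partial> (\<lambda>y. \<partial> f y a) x b \<bullet> c =
      \<partial> (\<lambda>y. \<partial> f y b) x a \<bullet> c"
    using second_derivative_symmetric_real[OF assms(1) smooth_onD[OF sm] assms(3), of a b]
    unfolding * by simp
qed

text \<open>Product rule with both factors moving: \<open>\<partial> f\<close> with frozen argument
  \<open>w x\<close> contributes the second derivative, the moving argument the first.\<close>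

lemma frechet_derivative_lie:
  fixes f :: "'a::euclidean_space \<Rightarrow> 'b::euclidean_space"
  assumes "open S" "smooth_on S f" "x \<in> S" "w differentiable (at x)"
  shows "\<partial> (\<lambda>y. \<partial> f y (w y)) x u =
    \<partial> (\<lambda>y. \<partial> f y (w x)) x u +
    \<partial> f x (\<partial> w x u)"
proof -
  let ?D = "\<lambda>b y. \<partial> f y b"
  have d: "?D b differentiable (at x)" for b
    using smooth_onD[OF assms(2), of 2] assms(3) by (simp add: numeral_2_eq_2)
  have exp: "?D v y = (\<Sum>b\<in>Basis. (v \<bullet> b) *\<^sub>R ?D b y)" if "y \<in> S" for y v
    by (rule frechet_derivative_basis[OF smooth_on_imp_differentiable[OF assms(2) that]])
  have "((\<lambda>y. ?D (w y) y) has_derivative (\<lambda>u. \<Sum>b\<in>Basis. (w x \<bullet> b) *\<^sub>R \<partial> (?D b) x u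
      + (\<partial> w x u \<bullet> b) *\<^sub>R ?D b x)) (at x)"
  proof (rule has_derivative_transform_within_open[OF _ assms(1,3)])
    show "((\<lambda>y. \<Sum>b\<in>Basis. (w y \<bullet> b) *\<^sub>R ?D b y) has_derivative (\<lambda>u. \<Sum>b\<in>Basis. (w x \<bullet> b) *\<^sub>R \<partial> (?D b) x u
      + (\<partial> w x u \<bullet> b) *\<^sub>R ?D b x)) (at x)"
      using d assms(4) unfolding frechet_derivative_works
      by (intro has_derivative_sum has_derivative_scaleR bounded_linear.has_derivative[OF bounded_linear_inner_left]) auto
  qed (use exp in auto)
  note 1 = frechet_derivative_eqI[OF this]
  have "(?D (w x) has_derivative (\<lambda>u. \<Sum>b\<in>Basis. (w x \<bullet> b) *\<^sub>R \<partial> (?D b) x u)) (at x)"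
  proof (rule has_derivative_transform_within_open[OF _ assms(1,3)])
    show "((\<lambda>y. \<Sum>b\<in>Basis. (w x \<bullet> b) *\<^sub>R ?D b y) has_derivative (\<lambda>u. \<Sum>b\<in>Basis. (w x \<bullet> b) *\<^sub>R \<partial> (?D b) x u)) (at x)"
      using d unfolding frechet_derivative_works
      by (intro has_derivative_sum has_derivative_scaleR_right) auto
  qed (use exp in auto)
  note 2 = frechet_derivative_eqI[OF this]
  show ?thesis
    unfolding 1 2 by (simp add: sum.distrib exp[OF assms(3), symmetric])
qed

text \<open>The second-derivative terms are symmetric and cancel, so the bracket is the commutator
  of derivations; the sign convention of \<open>lie_bracket\<close> makes \<open>v\<close> act last
  in the positive term.\<close>

lemma lie_bracket_derivation:
  fixes f :: "'a::euclidean_space \<Rightarrow> 'b::euclidean_space"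
  assumes "open S" "smooth_on S f" "x \<in> S" "v differentiable (at x)" "w differentiable (at x)"
  shows "\<partial> f x (lie_bracket v w x) =
    \<partial> (\<lambda>y. \<partial> f y (w y)) x (v x) -
    \<partial> (\<lambda>y. \<partial> f y (v y)) x (w x)"
  unfolding frechet_derivative_lie[OF assms(1-3,5)] frechet_derivative_lie[OF assms(1-4)] lie_bracket_def
  using second_derivative_symmetric[OF assms(1-3), of "w x" "v x"]
    linear_frechet_derivative[OF smooth_on_imp_differentiable[OF assms(2,3)]]
  by (simp add: linear_diff)

section \<open>Smooth dependence on parameters\<close>

text \<open>Formal differentiation of the fixed point equation gives a linear equation for the
  derivative, uniquely solvable because \<open>T'\<close> contracts in its second argument. The
  contraction of \<open>T\<close> is stated between \<open>\<xi> p\<close> and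
  \<open>\<xi> p0\<close>, since in the application \<open>T\<close> contracts on a ball of
  curves.\<close>

lemma fixed_point_has_derivative:
  fixes T :: "'p::real_normed_vector \<times> 'f::{real_normed_vector,complete_space} \<Rightarrow> 'f" and \<xi> :: "'p \<Rightarrow> 'f"
  assumes P: "open P" "p0 \<in> P"
    and fp: "\<And>p. p \<in> P \<Longrightarrow> \<xi> p = T (p, \<xi> p)"
    and contr: "\<And>p. p \<in> P \<Longrightarrow> norm (T (p, \<xi> p) - T (p, \<xi> p0)) \<le> norm (\<xi> p - \<xi> p0) / 2"
    and T': "(T has_derivative T') (at (p0, \<xi> p0))"
    and contr': "\<And>\<eta>. norm (T' (0, \<eta>)) \<le> norm \<eta> / 2"
  shows "\<exists>D. (\<xi> has_derivative D) (at p0) \<and> (\<forall>h. D h = T' (h, D h))"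
proof -
  interpret T': bounded_linear T' using T' by (rule has_derivative_bounded_linear)
  have diff: "T' (h, a) - T' (h, b) = T' (0, a - b)" for h a b
    by (simp add: T'.diff[symmetric])
  \<comment> \<open>Absorption: the part \<open>b\<close> is at most half of \<open>a\<close> and
    moves to the left. Uniqueness, boundedness of \<open>D\<close>, the Lipschitz bound and the
    remainder estimate all come from this inequality.\<close>
  have half: "norm a \<le> 2 * norm c" if "a = c + b" "norm b \<le> norm a / 2" for a b c :: 'f
    using norm_triangle_ineq[of c b] that by simp
  have uniq: "a = b" if "a = T' (h, a)" "b = T' (h, b)" for a b h
  proof -
    have "a - b = T' (0, a - b)" using diff[of h a b] that by simp
    then have "norm (a - b) \<le> 2 * norm (0::'f)"
      using half[of "a - b" 0 "T' (0, a - b)"] contr'[of "a - b"] by auto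
    then show ?thesis by simp
  qed
  have "\<exists>!\<eta>. T' (h, \<eta>) = \<eta>" for h
    by (rule banach_fix_type[of "1/2"]) (use contr' in \<open>auto simp: dist_norm diff\<close>)
  then obtain D where D: "\<And>h. T' (h, D h) = D h" by metis
  obtain K where K: "K > 0" "\<And>z. norm (T' z) \<le> norm z * K" using T'.pos_bounded by blast
  have "bounded_linear D"
  proof (rule bounded_linear_intro[of _ "2 * K"])
    show "D (h + h') = D h + D h'" for h h'
      by (rule uniq[of _ "h + h'"]) (use D T'.add[of "(h, D h)" "(h', D h')"] in auto)
    show "D (r *\<^sub>R h) = r *\<^sub>R D h" for r h
      by (rule uniq[of _ "r *\<^sub>R h"]) (use D T'.scaleR[of r "(h, D h)"] in auto)
    show "norm (D h) \<le> norm h * (2 * K)" for h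
    proof -
      have "D h = T' (h, 0) + T' (0, D h)"
        using D[of h] T'.add[of "(h, 0)" "(0, D h)"] by simp
      then have "norm (D h) \<le> 2 * norm (T' (h, 0))" using contr' by (rule half)
      also have "\<dots> \<le> 2 * (norm h * K)" using K(2)[of "(h, 0)"] by (simp add: norm_Pair)
      finally show ?thesis by (simp add: algebra_simps)
    qed
  qed
  obtain dP where dP: "dP > 0" "ball p0 dP \<subseteq> P" using P open_contains_ball by blast
  have T'alt: "\<exists>d>0. \<forall>z. norm (z - (p0, \<xi> p0)) < d \<longrightarrow>
      norm (T z - T (p0, \<xi> p0) - T' (z - (p0, \<xi> p0))) \<le> e * norm (z - (p0, \<xi> p0))" if "e > 0" for e
    using T' that unfolding has_derivative_at_alt by blast
  obtain d1 where d1: "d1 > 0" "\<And>z. norm (z - (p0, \<xi> p0)) < d1 \<Longrightarrow>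
      norm (T z - T (p0, \<xi> p0) - T' (z - (p0, \<xi> p0))) \<le> 1 * norm (z - (p0, \<xi> p0))"
    using T'alt[of 1] by auto
  \<comment> \<open>\<open>K\<close> bounds \<open>T'\<close>, 1 is the tolerance of the
    linearisation within radius \<open>d1\<close>, and the factor 2 is the price of
    absorption.\<close>
  define C where "C = 2 * (K + 1)"
  have "C > 0" using K by (simp add: C_def)
  \<comment> \<open>A Lipschitz bound must precede differentiability: the error of linearising
    \<open>T\<close> is small relative to the increment of the pair of parameter and fixed point,
    and this bound makes it small relative to the increment of the parameter.\<close>
  have lip: "norm (\<xi> p - \<xi> p0) \<le> C * norm (p - p0)" if "norm (p - p0) < min dP d1" for p
  proof -
    have "p \<in> P" using that dP by (auto simp: dist_norm norm_minus_commute subset_iff)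
    have "\<xi> p - \<xi> p0 = (T (p, \<xi> p0) - T (p0, \<xi> p0)) + (T (p, \<xi> p) - T (p, \<xi> p0))"
      using fp[OF \<open>p \<in> P\<close>] fp[OF P(2)] by simp
    then have "norm (\<xi> p - \<xi> p0) \<le> 2 * norm (T (p, \<xi> p0) - T (p0, \<xi> p0))"
      using contr[OF \<open>p \<in> P\<close>] by (rule half)
    also have "norm (T (p, \<xi> p0) - T (p0, \<xi> p0)) \<le>
        norm (T (p, \<xi> p0) - T (p0, \<xi> p0) - T' (p - p0, 0)) + norm (T' (p - p0, 0))"
      by (metis norm_triangle_sub add.commute)
    also have "\<dots> \<le> norm (p - p0) + norm (p - p0) * K"
      using d1(2)[of "(p, \<xi> p0)"] K(2)[of "(p - p0, 0)"] that by (intro add_mono) (simp_all add: norm_Pair)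
    finally show ?thesis by (simp add: C_def algebra_simps)
  qed
  have "(\<xi> has_derivative D) (at p0)"
    unfolding has_derivative_at_alt
  proof (intro conjI allI impI)
    show "bounded_linear D" by fact
    fix e :: real assume "e > 0"
    \<comment> \<open>Absorption doubles the error, and the increment of the pair is at most 1 + C
      times that of the parameter.\<close>
    define e' where "e' = e / 2 / (1 + C)"
    have "1 + C \<noteq> 0" using \<open>C > 0\<close> by simp
    then have "e' * (1 + C) = e / 2" using e'_def nonzero_eq_divide_eq by blast
    then have "2 * (e' * (1 + C)) = e" by linarith
    moreover have "e' > 0" using \<open>e > 0\<close> \<open>C > 0\<close> by (simp add: e'_def)
    ultimately have e': "e' > 0" "2 * (e' * (1 + C)) = e" by simp_all
    obtain d2 where d2: "d2 > 0" "\<And>z. norm (z - (p0, \<xi> p0)) < d2 \<Longrightarrow>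
        norm (T z - T (p0, \<xi> p0) - T' (z - (p0, \<xi> p0))) \<le> e' * norm (z - (p0, \<xi> p0))"
      using T'alt[OF e'(1)] by auto
    define d where "d = min (min dP d1) (d2 / (1 + C))"
    have "d > 0" using dP d1 d2 \<open>C > 0\<close> by (simp add: d_def)
    moreover have "norm (\<xi> p - \<xi> p0 - D (p - p0)) \<le> e * norm (p - p0)" if p: "norm (p - p0) < d" for p
    proof -
      have "p \<in> P" using p dP by (auto simp: d_def dist_norm norm_minus_commute subset_iff)
      define z where "z = (p - p0, \<xi> p - \<xi> p0)"
      have "norm z \<le> norm (p - p0) + norm (\<xi> p - \<xi> p0)"
        unfolding z_def norm_Pair by (rule sqrt_sum_squares_le_sum) auto
      also have "\<dots> \<le> (1 + C) * norm (p - p0)"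
        using lip[of p] p by (simp add: d_def algebra_simps)
      finally have z: "norm z \<le> (1 + C) * norm (p - p0)" .
      also have "\<dots> < d2" using p \<open>C > 0\<close> by (simp add: d_def field_simps)
      finally have zd: "norm z < d2" .
      let ?R = "T (p, \<xi> p) - T (p0, \<xi> p0) - T' z"
      have R: "norm ?R \<le> e' * norm z"
        using d2(2)[of "(p, \<xi> p)"] zd by (simp add: z_def)
      let ?\<Delta> = "\<xi> p - \<xi> p0 - D (p - p0)"
      have "T' z - D (p - p0) = T' (0, ?\<Delta>)"
        using diff[of "p - p0" "\<xi> p - \<xi> p0" "D (p - p0)"] D[of "p - p0"] by (simp add: z_def)
      then have "?\<Delta> = ?R + T' (0, ?\<Delta>)"
        using fp[OF \<open>p \<in> P\<close>] fp[OF P(2)] by (simp add: algebra_simps)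
      then have "norm ?\<Delta> \<le> 2 * norm ?R" using contr' by (rule half)
      also have "\<dots> \<le> 2 * (e' * ((1 + C) * norm (p - p0)))"
        using R z e'(1) by (meson mult_left_mono order_trans less_imp_le zero_le_numeral)
      also have "\<dots> = e * norm (p - p0)" unfolding e'(2)[symmetric] by (simp add: algebra_simps)
      finally show ?thesis .
    qed
    ultimately show "\<exists>d>0. \<forall>y. norm (y - p0) < d \<longrightarrow> norm (\<xi> y - \<xi> p0 - D (y - p0)) \<le> e * norm (y - p0)"
      by blast
  qed
  then show ?thesis using D by metis
qed

subsection \<open>Operators on bounded continuous curves\<close>

type_synonym 'e curve = "real \<Rightarrow>\<^sub>C 'e"

definition curve_mult :: "real curve \<Rightarrow> 'e::real_normed_vector curve \<Rightarrow> 'e curve" where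
  "curve_mult f g = Bcontfun (\<lambda>t. f t *\<^sub>R g t)"

text \<open>\<open>Bcontfun\<close> returns the intended curve for bounded continuous arguments
  only; this holds when the curve stays well inside a ball on which \<open>f\<close> is continuous,
  whence the radius conditions below.\<close>

definition curve_comp :: "('e::real_normed_vector \<Rightarrow> 'd::real_normed_vector) \<Rightarrow> 'e curve \<Rightarrow> 'd curve" where
  "curve_comp f w = Bcontfun (\<lambda>t. f (w t))"

text \<open>Curves on \<open>[0, 1]\<close> are extended to the real line by constants, so that the space of bounded
  continuous functions from the library applies.\<close>

definition clamp01 :: "real \<Rightarrow> real" where
  "clamp01 t = max 0 (min 1 t)"

definition curve_integral :: "'e::euclidean_space curve \<Rightarrow> 'e curve" where
  "curve_integral w = Bcontfun (\<lambda>t. integral {0..clamp01 t} w)"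

lemma clamp01: "clamp01 t \<in> {0..1}" "t \<in> {0..1} \<Longrightarrow> clamp01 t = t" "clamp01 (clamp01 t) = clamp01 t"
  by (auto simp: clamp01_def)

lemma continuous_on_clamp01: "continuous_on S clamp01"
  unfolding clamp01_def by (intro continuous_intros)

lemma apply_Bcontfun: "continuous_on UNIV f \<Longrightarrow> (\<And>t. norm (f t) \<le> b) \<Longrightarrow> apply_bcontfun (Bcontfun f) t = f t"
  using Bcontfun_inverse[OF bcontfun_normI] by metis

lemma curve_mult_apply: "apply_bcontfun (curve_mult f g) t = f t *\<^sub>R g t"
  unfolding curve_mult_def
proof (rule apply_Bcontfun)
  show "continuous_on UNIV (\<lambda>t. f t *\<^sub>R g t)" by (intro continuous_intros) simp_all
  show "norm (f t *\<^sub>R g t) \<le> norm f * norm g" for t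
    using norm_bounded[of f t] norm_bounded[of g t] by (simp add: mult_mono)
qed

lemma norm_curve_mult: "norm (curve_mult a b) \<le> norm a * norm b"
  by (rule norm_bound) (simp add: curve_mult_apply mult_mono norm_bounded[of a, unfolded real_norm_def] norm_bounded[of b])

lemma bounded_bilinear_curve_mult: "bounded_bilinear curve_mult"
proof
  show "\<exists>K. \<forall>a b. norm (curve_mult a b) \<le> norm a * norm b * K"
    by (intro exI[of _ 1]) (simp add: norm_curve_mult)
qed (auto intro!: bcontfun_eqI simp: curve_mult_apply algebra_simps)

text \<open>The range of \<open>w\<close> lies in the closed ball of radius \<open>norm w\<close>,
  which is compact and inside the open ball, so the composition is bounded.\<close>

lemma curve_comp_apply:
  fixes f :: "'e::euclidean_space \<Rightarrow> 'd::real_normed_vector"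
  assumes "continuous_on (ball 0 r) f" "norm w < r"
  shows "apply_bcontfun (curve_comp f w) t = f (w t)"
proof -
  have sub: "range (apply_bcontfun w) \<subseteq> cball 0 (norm w)"
    using norm_bounded[of w] by auto
  have cont: "continuous_on (cball 0 (norm w)) f"
    using assms by (auto intro: continuous_on_subset)
  then have "compact (f ` cball 0 (norm w))"
    by (simp add: compact_continuous_image)
  then obtain b where b: "\<And>x. x \<in> cball 0 (norm w) \<Longrightarrow> norm (f x) \<le> b"
    by (meson compact_imp_bounded bounded_iff imageI)
  show ?thesis
    unfolding curve_comp_def
  proof (rule apply_Bcontfun)
    show "continuous_on UNIV (\<lambda>t. f (apply_bcontfun w t))"
      by (rule continuous_on_compose2[OF cont]) (use sub in auto)
    show "norm (f (apply_bcontfun w t)) \<le> b" for t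
      using sub by (intro b) blast
  qed
qed

lemma curve_inner_apply: "apply_bcontfun (curve_comp (\<lambda>x. x \<bullet> b) w) t = w t \<bullet> b"
  for w :: "'e::euclidean_space curve"
  by (rule curve_comp_apply[of "norm w + 1"]) (auto intro: continuous_intros)

lemma norm_curve_inner: "b \<in> Basis \<Longrightarrow> norm (curve_comp (\<lambda>x. x \<bullet> b) w) \<le> norm w"
  for w :: "'e::euclidean_space curve"
  by (rule norm_bound) (auto simp: curve_inner_apply intro: order_trans[OF Basis_le_norm norm_bounded])

lemma bounded_linear_curve_inner:
  "b \<in> Basis \<Longrightarrow> bounded_linear (curve_comp (\<lambda>x::'e::euclidean_space. x \<bullet> b))"
  by (rule bounded_linear_intro[of _ 1])
    (auto intro!: bcontfun_eqI norm_curve_inner simp: curve_inner_apply inner_left_distrib)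

lemma curve_integral_bound: "norm (integral {0..clamp01 t} w) \<le> norm w"
  for w :: "'e::euclidean_space curve"
proof -
  have "norm (integral {0..clamp01 t} (apply_bcontfun w)) \<le> norm w * (clamp01 t - 0)"
    by (rule integral_bound) (use clamp01(1)[of t] norm_bounded[of w] in auto)
  also have "\<dots> \<le> norm w"
    using clamp01(1)[of t] by (simp add: mult_left_le)
  finally show ?thesis .
qed

lemma integrable_curve: "apply_bcontfun w integrable_on {a..b}" for w :: "'e::euclidean_space curve"
  by (rule integrable_continuous_real) simp

lemma curve_integral_apply: "apply_bcontfun (curve_integral w) t = integral {0..clamp01 t} w"
  unfolding curve_integral_def
proof (rule apply_Bcontfun)
  have *: "continuous_on {0..1} (\<lambda>t. integral {0..t} w)"
    by (rule indefinite_integral_continuous_1) (rule integrable_curve)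
  show "continuous_on UNIV (\<lambda>t. integral {0..clamp01 t} w)"
    by (rule continuous_on_compose2[OF * continuous_on_clamp01]) (use clamp01 in auto)
qed (rule curve_integral_bound)

lemma norm_curve_integral: "norm (curve_integral w) \<le> norm w"
  by (rule norm_bound) (simp add: curve_integral_apply curve_integral_bound)

lemma bounded_linear_curve_integral: "bounded_linear curve_integral"
  by (rule bounded_linear_intro[of _ 1])
    (auto intro!: bcontfun_eqI norm_curve_integral integrable_curve
      intro: integral_add simp: curve_integral_apply plus_bcontfun.rep_eq scaleR_bcontfun.rep_eq)

lemma curve_integral_linear:
  "curve_integral 0 = 0" "curve_integral (v + w) = curve_integral v + curve_integral w"
  "curve_integral (v - w) = curve_integral v - curve_integral w"
  using bounded_linear.linear[OF bounded_linear_curve_integral] by (rule linear_0 linear_add linear_diff)+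

lemma bounded_linear_const_curve: "bounded_linear (const_bcontfun :: 'e::real_normed_vector \<Rightarrow> 'e curve)"
  by (rule bounded_linear_intro[of _ 1]) (auto intro!: bcontfun_eqI norm_bound)

lemma bounded_linear_apply_curve: "bounded_linear (\<lambda>w. apply_bcontfun w t)"
  by (rule bounded_linear_intro[of _ 1]) (auto simp: norm_bounded)

lemma norm_sum_Basis_le:
  fixes v :: "'e::euclidean_space" and B :: real
  assumes "\<And>b. b \<in> Basis \<Longrightarrow> norm (c b) \<le> B"
  shows "norm (\<Sum>b\<in>Basis. (v \<bullet> b) *\<^sub>R c b) \<le> (DIM('e) * B) * norm v"
proof -
  have "norm (\<Sum>b\<in>Basis. (v \<bullet> b) *\<^sub>R c b) \<le> (\<Sum>b\<in>(Basis::'e set). norm v * B)"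
    by (rule sum_norm_le) (auto intro!: mult_mono assms simp: Basis_le_norm order_trans[OF norm_ge_zero assms])
  then show ?thesis by (simp add: algebra_simps)
qed

text \<open>The partial derivatives of \<open>f\<close> are uniformly continuous on a compact ball,
  so the linearisation error is uniform in time. The derivative is spelled out by products and
  compositions of curves so that it can be differentiated again.\<close>

lemma curve_comp_has_derivative:
  fixes f :: "'e::euclidean_space \<Rightarrow> 'd::euclidean_space"
  assumes "C_k_on 1 (ball 0 r) f" "norm w < r"
  shows "(curve_comp f has_derivative
    (\<lambda>v. \<Sum>b\<in>Basis. curve_mult (curve_comp (\<lambda>x. x \<bullet> b) v) (curve_comp (\<lambda>x. \<partial> f x b) w))) (at w)"
    (is "(_ has_derivative ?D) _")
proof -
  let ?Df = "\<lambda>b x. \<partial> f x b"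
  have diff: "f differentiable (at x)" if "x \<in> ball 0 r" for x
    using assms(1) that by simp
  have contD: "continuous_on (ball 0 r) (?Df b)" for b
    using assms(1) by simp
  have contf: "continuous_on (ball 0 r) f"
    using assms(1) by (rule C_k_on_imp_continuous_on)
  have D: "apply_bcontfun (?D v) t = \<partial> f (w t) (v t)" for v t
  proof -
    have "w t \<in> ball 0 r" using norm_bounded[of w t] assms(2) by simp
    have sum: "apply_bcontfun (\<Sum>b\<in>I. F b) t = (\<Sum>b\<in>I. apply_bcontfun (F b) t)" for F and I :: "'e set"
      by (induction I rule: infinite_finite_induct) (auto simp: plus_bcontfun.rep_eq zero_bcontfun.rep_eq)
    show ?thesis
      using frechet_derivative_basis[OF diff[OF \<open>w t \<in> ball 0 r\<close>], of "v t"]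
      by (simp add: sum curve_mult_apply curve_inner_apply curve_comp_apply[OF contD assms(2)])
  qed
  show ?thesis
    unfolding has_derivative_at_alt
  proof (intro conjI allI impI)
    show "bounded_linear ?D"
      by (intro bounded_linear_sum bounded_linear_compose[OF bounded_bilinear.bounded_linear_left[OF bounded_bilinear_curve_mult]]
          bounded_linear_curve_inner)
    fix e :: real assume "e > 0"
    \<comment> \<open>An intermediate radius leaves room for the perturbed curves \<open>u\<close>
      inside a compact ball.\<close>
    define \<rho> where "\<rho> = (norm w + r) / 2"
    have \<rho>: "norm w < \<rho>" "\<rho> < r" using assms(2) by (auto simp: \<rho>_def)
    have sub: "cball 0 \<rho> \<subseteq> ball (0::'e) r" using \<rho> by auto
    \<comment> \<open>The norm of a linear map is at most DIM times the largest image of a basis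
      vector; the division absorbs this factor.\<close>
    define \<epsilon> where "\<epsilon> = e / DIM('e)"
    have "\<epsilon> > 0" and dim_eps: "real DIM('e) * \<epsilon> = e" using \<open>e > 0\<close> by (auto simp: \<epsilon>_def)
    have "\<exists>d>0. \<forall>x\<in>cball 0 \<rho>. \<forall>y\<in>cball 0 \<rho>. dist y x < d \<longrightarrow> dist (?Df b y) (?Df b x) < \<epsilon>" for b
    proof -
      have "uniformly_continuous_on (cball 0 \<rho>) (?Df b)"
        by (rule compact_uniformly_continuous[OF continuous_on_subset[OF contD sub] compact_cball])
      then show ?thesis using \<open>\<epsilon> > 0\<close> unfolding uniformly_continuous_on_def by blast
    qed
    then obtain d where d: "\<And>b. d b > 0"
      "\<And>b x y. x \<in> cball 0 \<rho> \<Longrightarrow> y \<in> cball 0 \<rho> \<Longrightarrow> dist y x < d b \<Longrightarrow> dist (?Df b y) (?Df b x) < \<epsilon>"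
      by metis
    define \<delta> where "\<delta> = min (\<rho> - norm w) (Min (d ` Basis))"
    have "\<delta> > 0" using \<rho> d(1) by (simp add: \<delta>_def)
    have \<delta>d: "\<delta> \<le> d b" if "b \<in> Basis" for b
      using that by (simp add: \<delta>_def min.coboundedI2)
    have "norm (curve_comp f u - curve_comp f w - ?D (u - w)) \<le> e * norm (u - w)" if "norm (u - w) < \<delta>" for u
    proof (rule norm_bound)
      fix t
      have ut: "norm (u t - w t) \<le> norm (u - w)"
        using norm_bounded[of "u - w" t] by (simp add: minus_bcontfun.rep_eq)
      have "norm u \<le> norm (u - w) + norm w" by (metis norm_triangle_sub add.commute)
      then have "norm u < r" using that \<rho> by (simp add: \<delta>_def)
      let ?S = "cball 0 \<rho> \<inter> ball (w t) \<delta>"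
      have wt: "w t \<in> ?S" using norm_bounded[of w t] \<rho> \<open>\<delta> > 0\<close> by simp
      have uS: "u t \<in> ?S"
        using norm_bounded[of u t] \<open>norm u \<le> norm (u - w) + norm w\<close> that ut
        by (auto simp: \<delta>_def dist_norm norm_minus_commute)
      have conv: "convex ?S" by (intro convex_Int convex_cball convex_ball)
      have "norm (f (u t) - f (w t) - \<partial> f (w t) (u t - w t)) \<le> norm (u t - w t) * e"
      proof (rule differentiable_bound_linearization[where S="?S"])
        show "w t + s *\<^sub>R (u t - w t) \<in> ?S" if "s \<in> {0..1}" for s
          using convexD_alt[OF conv wt uS, of s] that by (simp add: algebra_simps)
        show "(f has_derivative \<partial> f x) (at x within ?S)" if "x \<in> ?S" for x
        proof -
          have "x \<in> ball 0 r" using that sub by blast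
          from diff[OF this] show ?thesis
            unfolding frechet_derivative_works by (rule has_derivative_at_withinI)
        qed
        show "onorm (\<partial> f x - \<partial> f (w t)) \<le> e" if "x \<in> ?S" for x
        proof (rule onorm_le)
          fix v
          have x: "x \<in> cball 0 \<rho>" "dist x (w t) < \<delta>" using that by (auto simp: dist_commute)
          have *: "norm (?Df b x - ?Df b (w t)) \<le> \<epsilon>" if "b \<in> Basis" for b
            using d(2)[of "w t" x b] wt x \<delta>d[OF that] by (simp add: dist_norm)
          have "(\<partial> f x - \<partial> f (w t)) v
              = (\<Sum>b\<in>Basis. (v \<bullet> b) *\<^sub>R (?Df b x - ?Df b (w t)))"
            using frechet_derivative_basis[OF diff, of x v] frechet_derivative_basis[OF diff, of "w t" v] x wt sub
            by (simp add: scaleR_diff_right sum_subtractf subset_iff)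
          then show "norm ((\<partial> f x - \<partial> f (w t)) v) \<le> e * norm v"
            using norm_sum_Basis_le[where v=v, OF *] dim_eps by simp
        qed
      qed (rule wt)
      also have "\<dots> \<le> e * norm (u - w)" using ut \<open>e > 0\<close> by (simp add: mult.commute)
      finally show "norm (apply_bcontfun (curve_comp f u - curve_comp f w - ?D (u - w)) t) \<le> e * norm (u - w)"
        by (simp only: minus_bcontfun.rep_eq D curve_comp_apply[OF contf \<open>norm u < r\<close>] curve_comp_apply[OF contf assms(2)])
    qed
    then show "\<exists>d>0. \<forall>y. norm (y - w) < d \<longrightarrow> norm (curve_comp f y - curve_comp f w - ?D (y - w)) \<le> e * norm (y - w)"
      using \<open>\<delta> > 0\<close> by blast
  qed
qed

text \<open>The derivative contains compositions with the partial derivatives of \<open>f\<close>,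
  so the induction runs over all smooth \<open>f\<close> at once.\<close>

lemma C_k_on_curve_comp:
  fixes f :: "'e::euclidean_space \<Rightarrow> 'd::euclidean_space" and w :: "'p::real_normed_vector \<Rightarrow> 'e curve"
  assumes "open P" "\<And>p. p \<in> P \<Longrightarrow> norm (w p) < r" "C_k_on n P w" "smooth_on (ball 0 r) f"
  shows "C_k_on n P (\<lambda>p. curve_comp f (w p))"
  using assms(3,4)
proof (induction n arbitrary: f)
  case 0
  show ?case
  proof (simp, rule continuous_at_imp_continuous_on, rule ballI)
    fix p assume "p \<in> P"
    have "isCont (curve_comp f) (w p)"
      by (rule has_derivative_continuous[OF curve_comp_has_derivative[OF smooth_onD[OF 0(2)] assms(2)[OF \<open>p \<in> P\<close>]]])
    moreover have "isCont w p"
      using 0(1) assms(1) \<open>p \<in> P\<close> by (simp add: continuous_on_eq_continuous_at)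
    ultimately show "isCont (\<lambda>p. curve_comp f (w p)) p" by (rule isCont_o2[rotated])
  qed
next
  case (Suc n)
  show ?case
  proof (rule C_k_on_SucI[OF assms(1)])
    show "((\<lambda>p. curve_comp f (w p)) has_derivative (\<lambda>v. \<Sum>b\<in>Basis.
        curve_mult (curve_comp (\<lambda>x. x \<bullet> b) (\<partial> w p v)) (curve_comp (\<lambda>x. \<partial> f x b) (w p)))) (at p)"
      if "p \<in> P" for p
      by (rule has_derivative_compose[OF C_k_on_has_derivative[OF Suc.prems(1) that]
            curve_comp_has_derivative[OF smooth_onD[OF Suc.prems(2)] assms(2)[OF that]]])
    have "smooth_on (ball 0 r) (\<lambda>x. \<partial> f x b)" for b
      by (rule smooth_on_frechet_derivative[OF _ Suc.prems(2)]) auto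
    then show "C_k_on n P (\<lambda>p. \<Sum>b\<in>Basis.
        curve_mult (curve_comp (\<lambda>x. x \<bullet> b) (\<partial> w p v)) (curve_comp (\<lambda>x. \<partial> f x b) (w p)))"
      for v
      using Suc.prems by (intro C_k_on_sum assms(1) C_k_on_bounded_bilinear[OF bounded_bilinear_curve_mult]
          C_k_on_bounded_linear[OF bounded_linear_curve_inner] Suc.IH C_k_on_SucD[OF Suc.prems(1)]) auto
  qed
qed

section \<open>Linear Volterra equations and smooth dependence on initial values\<close>

text \<open>The Volterra operator that integrates M(s) applied to \<eta>(s) from 0 to t; the curve
  \<open>M b\<close> is the column of the matrix M for the basis vector \<open>b\<close>.\<close>

definition curve_volterra :: "('e::euclidean_space \<Rightarrow> 'e curve) \<Rightarrow> 'e curve \<Rightarrow> 'e curve" where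
  "curve_volterra M \<eta> = curve_integral (\<Sum>b\<in>Basis. curve_mult (curve_comp (\<lambda>x. x \<bullet> b) \<eta>) (M b))"


lemma curve_volterra_diff: "curve_volterra M (a - b) = curve_volterra M a - curve_volterra M b"
  unfolding curve_volterra_def
  by (simp add: linear_diff[OF bounded_linear.linear[OF bounded_linear_curve_inner]] bounded_bilinear.diff_left[OF bounded_bilinear_curve_mult]
      sum_subtractf curve_integral_linear)

text \<open>The derivative of a solution solves an equation with the same kernel \<open>M\<close>
  and another inhomogeneous term. So order \<open>n\<close> for all such equations gives order
  \<open>n + 1\<close>, and the base case, continuity, comes from the contraction.\<close>

lemma volterra_solution_C_k_on:
  fixes \<xi> :: "'p::real_normed_vector \<Rightarrow> 'e::euclidean_space curve"
  assumes P: "open P" 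
    and contr: "\<And>p \<eta>. p \<in> P \<Longrightarrow> norm (curve_volterra (\<lambda>b. M b p) \<eta>) \<le> norm \<eta> / 2"
    and "\<And>b. b \<in> Basis \<Longrightarrow> C_k_on n P (M b)" "C_k_on n P \<beta>"
    and "\<And>p. p \<in> P \<Longrightarrow> \<xi> p = \<beta> p + curve_volterra (\<lambda>b. M b p) (\<xi> p)"
  shows "C_k_on n P \<xi>"
  using assms(3-5)
proof (induction n arbitrary: \<beta> \<xi>)
  case 0
  have "isCont \<xi> p0" if "p0 \<in> P" for p0
  proof -
    \<comment> \<open>With the solution frozen at \<open>p0\<close> the right-hand side is
      continuous in \<open>p\<close>; the contraction bounds the change of the solution by twice the
      change of \<open>g\<close>.\<close>
    define g where "g p = \<beta> p + curve_volterra (\<lambda>b. M b p) (\<xi> p0)" for p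
    have "continuous_on P g"
      unfolding g_def curve_volterra_def using 0
      by (intro continuous_intros bounded_linear.continuous_on[OF bounded_linear_curve_integral]
          bounded_bilinear.continuous_on[OF bounded_bilinear_curve_mult]) auto
    then have "isCont g p0" using P that by (simp add: continuous_on_eq_continuous_at)
    then have "((\<lambda>p. 2 * norm (g p - g p0)) \<longlongrightarrow> 2 * norm (g p0 - g p0)) (at p0)"
      unfolding isCont_def by (intro tendsto_intros)
    then have lim: "((\<lambda>p. 2 * norm (g p - g p0)) \<longlongrightarrow> 0) (at p0)" by simp
    have "norm (\<xi> p - \<xi> p0) \<le> 2 * norm (g p - g p0)" if "p \<in> P" for p
    proof -
      have "\<xi> p - \<xi> p0 = (g p - g p0) + curve_volterra (\<lambda>b. M b p) (\<xi> p - \<xi> p0)"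
        using 0(3)[OF that] 0(3)[OF \<open>p0 \<in> P\<close>] by (simp add: g_def curve_volterra_diff)
      then have "norm (\<xi> p - \<xi> p0) \<le> norm (g p - g p0) + norm (curve_volterra (\<lambda>b. M b p) (\<xi> p - \<xi> p0))"
        by (metis norm_triangle_ineq)
      then show ?thesis using contr[OF that, of "\<xi> p - \<xi> p0"] by simp
    qed
    then have "\<forall>\<^sub>F p in at p0. norm (\<xi> p - \<xi> p0) \<le> 2 * norm (g p - g p0)"
      by (rule eventually_mono[OF eventually_at_in_open'[OF P \<open>p0 \<in> P\<close>]])
    from Lim_null_comparison[OF this lim] have "((\<lambda>p. \<xi> p - \<xi> p0) \<longlongrightarrow> 0) (at p0)" .
    then show ?thesis unfolding isCont_def by (rule LIM_zero_cancel)
  qed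
  then show ?case by (simp add: continuous_at_imp_continuous_on)
next
  case (Suc n)
  have M: "C_k_on n P (M b)" if "b \<in> Basis" for b using Suc.prems(1)[OF that] by (rule C_k_on_SucD)
  have \<xi>: "C_k_on n P \<xi>"
    by (rule Suc.IH[OF M C_k_on_SucD[OF Suc.prems(2)] Suc.prems(3)])
  let ?c = "\<lambda>b. curve_comp (\<lambda>x::'e. x \<bullet> b)"
  \<comment> \<open>The terms in which the derivative falls on \<open>\<beta>\<close> or
    \<open>M\<close>; the remaining one is the same Volterra operator applied to the derivative of
    \<open>\<xi>\<close>.\<close>
  define \<gamma> where "\<gamma> h p = \<partial> \<beta> p h
    + curve_integral (\<Sum>b\<in>Basis. curve_mult (?c b (\<xi> p)) (\<partial> (M b) p h))" for h p
  have "\<exists>D. (\<xi> has_derivative D) (at p0) \<and> (\<forall>h. D h = \<gamma> h p0 + curve_volterra (\<lambda>b. M b p0) (D h))" if "p0 \<in> P" for p0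
  proof -
    define T where "T = (\<lambda>z. \<beta> (fst z) + curve_volterra (\<lambda>b. M b (fst z)) (snd z))"
    define T' where "T' = (\<lambda>z. \<partial> \<beta> p0 (fst z) +
      curve_integral (\<Sum>b\<in>Basis. curve_mult (?c b (\<xi> p0)) (\<partial> (M b) p0 (fst z)) + curve_mult (?c b (snd z)) (M b p0)))"
    have lin: "\<partial> \<beta> p0 0 = 0" "b \<in> Basis \<Longrightarrow> \<partial> (M b) p0 0 = 0" for b
      using linear_0[OF has_derivative_linear[OF C_k_on_has_derivative[OF Suc.prems(2) that]]]
        linear_0[OF has_derivative_linear[OF C_k_on_has_derivative[OF Suc.prems(1) that]]] by auto
    have "\<exists>D. (\<xi> has_derivative D) (at p0) \<and> (\<forall>h. D h = T' (h, D h))"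
    proof (rule fixed_point_has_derivative[OF P that])
      show "\<xi> p = T (p, \<xi> p)" if "p \<in> P" for p using Suc.prems(3)[OF that] by (simp add: T_def)
      show "norm (T (p, \<xi> p) - T (p, \<xi> p0)) \<le> norm (\<xi> p - \<xi> p0) / 2" if "p \<in> P" for p
        using contr[OF that, of "\<xi> p - \<xi> p0"] by (simp add: T_def curve_volterra_diff)
      show "norm (T' (0, \<eta>)) \<le> norm \<eta> / 2" for \<eta>
        using contr[OF \<open>p0 \<in> P\<close>, of \<eta>] lin
        by (simp add: T'_def curve_volterra_def bounded_bilinear.zero_right[OF bounded_bilinear_curve_mult])
      have 1: "((\<lambda>z::'p \<times> 'e curve. F (fst z)) has_derivative (\<lambda>z. \<partial> F p0 (fst z))) (at (p0, \<xi> p0))"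
        if "C_k_on (Suc n) P F" for F :: "'p \<Rightarrow> 'e curve"
        by (rule has_derivative_compose[of fst fst "(p0, \<xi> p0)" UNIV F])
          (use C_k_on_has_derivative[OF that \<open>p0 \<in> P\<close>] in \<open>auto intro!: derivative_eq_intros\<close>)
      have 2: "((\<lambda>z::'p \<times> 'e curve. ?c b (snd z)) has_derivative (\<lambda>z. ?c b (snd z))) (at (p0, \<xi> p0))" if "b \<in> Basis" for b
        by (rule bounded_linear.has_derivative[OF bounded_linear_curve_inner[OF that]])
          (auto intro!: derivative_eq_intros)
      have 3: "((\<lambda>z::'p \<times> 'e curve. curve_mult (?c b (snd z)) (M b (fst z))) has_derivative
        (\<lambda>z. curve_mult (?c b (\<xi> p0)) (\<partial> (M b) p0 (fst z)) + curve_mult (?c b (snd z)) (M b p0)))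
        (at (p0, \<xi> p0))" if "b \<in> Basis" for b
        using bounded_bilinear.FDERIV[OF bounded_bilinear_curve_mult 2[OF that] 1[OF Suc.prems(1)[OF that]]] by simp
      show "(T has_derivative T') (at (p0, \<xi> p0))"
        unfolding T_def T'_def curve_volterra_def
        by (intro has_derivative_add bounded_linear.has_derivative[OF bounded_linear_curve_integral]
            has_derivative_sum 3 1 Suc.prems(2))
    qed
    moreover have "T' (h, v) = \<gamma> h p0 + curve_volterra (\<lambda>b. M b p0) v" for h v
      by (simp add: T'_def \<gamma>_def curve_volterra_def sum.distrib
          curve_integral_linear)
    ultimately show ?thesis by metis
  qed
  then obtain D where D: "\<And>p. p \<in> P \<Longrightarrow> (\<xi> has_derivative D p) (at p)"
    "\<And>p h. p \<in> P \<Longrightarrow> D p h = \<gamma> h p + curve_volterra (\<lambda>b. M b p) (D p h)"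
    by metis
  show ?case
  proof (rule C_k_on_SucI[OF P D(1)])
    fix h
    have "C_k_on n P (\<gamma> h)"
      unfolding \<gamma>_def using Suc.prems
      by (intro C_k_on_add C_k_on_bounded_linear[OF bounded_linear_curve_integral] C_k_on_sum P
          C_k_on_bounded_bilinear[OF bounded_bilinear_curve_mult] C_k_on_bounded_linear[OF bounded_linear_curve_inner] \<xi>) auto
    from Suc.IH[OF M this, of "\<lambda>p. D p h"] show "C_k_on n P (\<lambda>p. D p h)"
      using D(2) by blast
  qed
qed

lemma curve_comp_lipschitz:
  fixes f :: "'e::euclidean_space \<Rightarrow> 'd::euclidean_space"
  assumes "smooth_on (ball 0 r) f" "\<rho> < r" "norm u \<le> \<rho>" "norm w \<le> \<rho>"
    and B: "\<And>x b. x \<in> cball 0 \<rho> \<Longrightarrow> b \<in> Basis \<Longrightarrow> norm (\<partial> f x b) \<le> B"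
  shows "norm (curve_comp f u - curve_comp f w) \<le> (real DIM('e) * B) * norm (u - w)"
proof (rule norm_bound)
  fix t
  have sub: "cball 0 \<rho> \<subseteq> ball (0::'e) r" using assms(2) by auto
  have contf: "continuous_on (ball 0 r) f" using assms(1) by (rule smooth_on_imp_continuous_on)
  have "0 \<in> cball (0::'e) \<rho>" using order_trans[OF norm_ge_zero assms(3)] by simp
  then have "B \<ge> 0" using order_trans[OF norm_ge_zero B] nonempty_Basis by blast
  have "norm (f (u t) - f (w t)) \<le> (real DIM('e) * B) * norm (u t - w t)"
  proof (rule differentiable_bound[OF convex_cball])
    show "(f has_derivative \<partial> f x) (at x within cball 0 \<rho>)" if "x \<in> cball 0 \<rho>" for x
      using smooth_on_has_derivative[OF assms(1), of x] that sub by (blast intro: has_derivative_at_withinI)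
    show "onorm (\<partial> f x) \<le> real DIM('e) * B" if "x \<in> cball 0 \<rho>" for x
    proof (rule onorm_le)
      fix v
      have "f differentiable (at x)" using smooth_on_imp_differentiable[OF assms(1)] that sub by blast
      from frechet_derivative_basis[OF this, of v]
      show "norm (\<partial> f x v) \<le> real DIM('e) * B * norm v"
        using norm_sum_Basis_le[of "\<partial> f x" B v] B[OF that] by simp
    qed
    show "u t \<in> cball 0 \<rho>" "w t \<in> cball 0 \<rho>"
      using norm_bounded[of u t] norm_bounded[of w t] assms(3,4) by auto
  qed
  also have "\<dots> \<le> (real DIM('e) * B) * norm (u - w)"
    using norm_bounded[of "u - w" t] \<open>B \<ge> 0\<close> by (intro mult_left_mono) (auto simp: minus_bcontfun.rep_eq)
  finally show "norm (apply_bcontfun (curve_comp f u - curve_comp f w) t) \<le> (real DIM('e) * B) * norm (u - w)"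
    using assms(2-4) by (simp add: minus_bcontfun.rep_eq curve_comp_apply[OF contf])
qed

text \<open>The field is linear in the initial value \<open>p\<close> through the coefficients
  \<open>l i\<close>, hence small for small \<open>p\<close>: the Picard operator contracts on all
  of [0, 1] and smallness of \<open>p\<close> takes the place of a short time. The linearised
  equation and its contraction are exported to identify derivatives.\<close>

lemma ode_smooth_dependence_curve:
  fixes X :: "'e::euclidean_space \<Rightarrow> 'e \<Rightarrow> 'e" and l :: "'e \<Rightarrow> 'e \<Rightarrow> real"
  assumes r: "r > 0" and X: "\<And>i. i \<in> Basis \<Longrightarrow> smooth_on (ball 0 r) (X i)"
    and l: "\<And>i. i \<in> Basis \<Longrightarrow> bounded_linear (l i)"
  obtains \<delta> w where "\<delta> > 0" "smooth_on (ball 0 \<delta>) w" "\<And>p. p \<in> ball 0 \<delta> \<Longrightarrow> norm (w p) < r"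
    "\<And>p. p \<in> ball 0 \<delta> \<Longrightarrow> w p = const_bcontfun p + curve_integral (\<Sum>i\<in>Basis. l i p *\<^sub>R curve_comp (X i) (w p))"
    "\<And>p h. p \<in> ball 0 \<delta> \<Longrightarrow> \<partial> w p h =
      const_bcontfun h + curve_integral (\<Sum>i\<in>Basis. l i h *\<^sub>R curve_comp (X i) (w p)) +
      curve_volterra (\<lambda>b. \<Sum>i\<in>Basis. l i p *\<^sub>R curve_comp (\<lambda>x. \<partial> (X i) x b) (w p))
        (\<partial> w p h)"
    "\<And>p \<eta>. p \<in> ball 0 \<delta> \<Longrightarrow>
      norm (curve_volterra (\<lambda>b. \<Sum>i\<in>Basis. l i p *\<^sub>R curve_comp (\<lambda>x. \<partial> (X i) x b) (w p)) \<eta>) \<le> norm \<eta> / 2"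
proof -
  define \<rho> where "\<rho> = r / 2"
  have \<rho>: "\<rho> > 0" "\<rho> < r" using r by (auto simp: \<rho>_def)
  have sub: "cball 0 \<rho> \<subseteq> ball (0::'e) r" using \<rho> by auto
  let ?DX = "\<lambda>i b x. \<partial> (X i) x b"
  have DX: "smooth_on (ball 0 r) (?DX i b)" if "i \<in> Basis" for i b
    by (rule smooth_on_frechet_derivative[OF _ X[OF that]]) auto
  note contX = smooth_on_imp_continuous_on[OF X] and contDX = smooth_on_imp_continuous_on[OF DX]
  have bdd: "\<exists>B. \<forall>x\<in>cball 0 \<rho>. norm (f x) \<le> B" if "continuous_on (ball 0 r) f" for f :: "'e \<Rightarrow> 'e"
  proof -
    have "compact (f ` cball 0 \<rho>)"
      by (intro compact_continuous_image continuous_on_subset[OF that sub] compact_cball)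
    then show ?thesis by (meson compact_imp_bounded bounded_iff imageI)
  qed
  obtain B0 where B0: "\<And>i x. i \<in> Basis \<Longrightarrow> x \<in> cball 0 \<rho> \<Longrightarrow> norm (X i x) \<le> B0 i"
    using bdd[OF contX] by metis
  obtain B1 where B1: "\<And>i b x. i \<in> Basis \<Longrightarrow> x \<in> cball 0 \<rho> \<Longrightarrow> norm (?DX i b x) \<le> B1 i b"
    using bdd[OF contDX] by metis
  define B where "B = 1 + (\<Sum>i\<in>Basis. \<bar>B0 i\<bar>) + (\<Sum>i\<in>Basis. \<Sum>b\<in>Basis. \<bar>B1 i b\<bar>)"
  have B1B: "\<bar>B1 i b\<bar> \<le> (\<Sum>i\<in>Basis. \<Sum>b\<in>Basis. \<bar>B1 i b\<bar>)" if "i \<in> Basis" "b \<in> Basis" for i b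
  proof -
    have "\<bar>B1 i b\<bar> \<le> (\<Sum>b\<in>Basis. \<bar>B1 i b\<bar>)" using that by (intro member_le_sum) auto
    also have "\<dots> \<le> (\<Sum>i\<in>Basis. \<Sum>b\<in>Basis. \<bar>B1 i b\<bar>)"
      using that by (intro member_le_sum[of i Basis "\<lambda>i. \<Sum>b\<in>Basis. \<bar>B1 i b\<bar>"]) (auto intro: sum_nonneg)
    finally show ?thesis .
  qed
  have "(\<Sum>i\<in>(Basis::'e set). \<bar>B0 i\<bar>) \<ge> 0" "(\<Sum>i\<in>(Basis::'e set). \<Sum>b\<in>(Basis::'e set). \<bar>B1 i b\<bar>) \<ge> 0"
    by (auto intro: sum_nonneg)
  note nonneg = this
  have "B > 0" using nonneg unfolding B_def by linarith
  have BX: "norm (X i x) \<le> B" if "i \<in> Basis" "x \<in> cball 0 \<rho>" for i x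
  proof -
    have "\<bar>B0 i\<bar> \<le> (\<Sum>i\<in>Basis. \<bar>B0 i\<bar>)" using that by (intro member_le_sum) auto
    then show ?thesis using B0[OF that] nonneg unfolding B_def by linarith
  qed
  have BDX: "norm (?DX i b x) \<le> B" if "i \<in> Basis" "b \<in> Basis" "x \<in> cball 0 \<rho>" for i b x
    using B1[OF that(1,3), of b] B1B[OF that(1,2)] nonneg unfolding B_def by linarith
  define d where "d = real DIM('e)"
  have "d \<ge> 1" by (simp add: d_def)
  define s where "s p = (\<Sum>i\<in>Basis. \<bar>l i p\<bar>)" for p
  have s0: "s p \<ge> 0" for p by (simp add: s_def sum_nonneg)
  \<comment> \<open>The bound 1/2 gives the contraction; \<rho>/2, with initial values of norm at
    most \<rho>/2, keeps the ball of radius \<rho> invariant. The factor \<open>d * B\<close> bounds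
    the fields \<open>X i\<close> and their Lipschitz constants on that ball.\<close>
  define \<kappa> where "\<kappa> = min (1/2) (\<rho>/2) / (d * B)"
  have "\<kappa> > 0" using \<open>d \<ge> 1\<close> \<open>B > 0\<close> \<rho> by (simp add: \<kappa>_def)
  have "\<exists>e>0. \<forall>p. norm p < e \<longrightarrow> s p < \<kappa>"
  proof -
    have "continuous_on UNIV s"
      unfolding s_def by (intro continuous_intros bounded_linear.continuous_on[OF l])
    then have "\<exists>e>0. \<forall>p. dist p 0 < e \<longrightarrow> dist (s p) (s 0) < \<kappa>"
      using \<open>\<kappa> > 0\<close> unfolding continuous_on_iff by blast
    moreover have "s 0 = 0"
      unfolding s_def by (simp add: linear_0[OF bounded_linear.linear[OF l]])
    ultimately show ?thesis using s0 by (simp add: dist_norm)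
  qed
  then obtain e where e: "e > 0" "\<And>p. norm p < e \<Longrightarrow> s p < \<kappa>" by blast
  define \<delta> where "\<delta> = min e (\<rho> / 2)"
  have "\<delta> > 0" using e \<rho> by (simp add: \<delta>_def)
  let ?P = "ball (0::'e) \<delta>"
  have sB: "s p * (d * B) \<le> 1/2" "s p * (d * B) \<le> \<rho>/2" "norm p \<le> \<rho>/2" if "p \<in> ?P" for p
  proof -
    have "s p \<le> \<kappa>" using e(2)[of p] that by (simp add: \<delta>_def)
    then have "s p * (d * B) \<le> \<kappa> * (d * B)"
      using \<open>d \<ge> 1\<close> \<open>B > 0\<close> by (intro mult_right_mono) auto
    also have "\<dots> = min (1/2) (\<rho>/2)"
      using \<open>d \<ge> 1\<close> \<open>B > 0\<close> by (simp add: \<kappa>_def)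
    finally show "s p * (d * B) \<le> 1/2" "s p * (d * B) \<le> \<rho>/2" by auto
    show "norm p \<le> \<rho>/2" using that by (simp add: \<delta>_def)
  qed
  have lsum: "norm (\<Sum>i\<in>Basis. l i p *\<^sub>R F i) \<le> s p * C" if "\<And>i. i \<in> Basis \<Longrightarrow> norm (F i) \<le> C"
    for F :: "'e \<Rightarrow> 'e curve" and C p
    unfolding s_def sum_distrib_right
    by (rule sum_norm_le) (auto intro!: mult_left_mono that)
  define T where "T p x = const_bcontfun p + curve_integral (\<Sum>i\<in>Basis. l i p *\<^sub>R curve_comp (X i) x)" for p x
  have TT: "norm (T p x - T p y) \<le> norm (x - y) / 2" if "p \<in> ?P" "norm x \<le> \<rho>" "norm y \<le> \<rho>" for p x y
  proof -
    have "T p x - T p y = curve_integral (\<Sum>i\<in>Basis. l i p *\<^sub>R (curve_comp (X i) x - curve_comp (X i) y))"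
      by (simp add: T_def linear_diff[OF bounded_linear.linear[OF bounded_linear_curve_integral], symmetric]
          scaleR_diff_right sum_subtractf)
    then have "norm (T p x - T p y) \<le> norm (\<Sum>i\<in>Basis. l i p *\<^sub>R (curve_comp (X i) x - curve_comp (X i) y))"
      by (simp add: norm_curve_integral)
    also have "\<dots> \<le> s p * ((d * B) * norm (x - y))"
      by (rule lsum) (use curve_comp_lipschitz[OF X \<rho>(2) that(2,3)] BDX in \<open>simp add: d_def\<close>)
    also have "\<dots> \<le> norm (x - y) / 2"
      using mult_right_mono[OF sB(1)[OF that(1)], of "norm (x - y)"] by (simp add: mult.assoc)
    finally show ?thesis .
  qed
  have Tin: "norm (T p x) \<le> \<rho>" if "p \<in> ?P" "norm x \<le> \<rho>" for p x
  proof -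
    have "norm (curve_comp (X i) x) \<le> d * B" if "i \<in> Basis" for i
    proof (rule norm_bound)
      fix t
      have "x t \<in> cball 0 \<rho>" using norm_bounded[of x t] \<open>norm x \<le> \<rho>\<close> by simp
      then have "norm (X i (x t)) \<le> B" by (rule BX[OF that])
      also have "B \<le> d * B" using \<open>d \<ge> 1\<close> \<open>B > 0\<close> by simp
      finally show "norm (apply_bcontfun (curve_comp (X i) x) t) \<le> d * B"
        using \<open>norm x \<le> \<rho>\<close> \<rho> by (simp add: curve_comp_apply[OF contX[OF that]])
    qed
    then have "norm (\<Sum>i\<in>Basis. l i p *\<^sub>R curve_comp (X i) x) \<le> s p * (d * B)"
      by (rule lsum)
    from order_trans[OF norm_curve_integral order_trans[OF this sB(2)[OF that(1)]]]
    have 1: "norm (curve_integral (\<Sum>i\<in>Basis. l i p *\<^sub>R curve_comp (X i) x)) \<le> \<rho>/2" .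
    have 2: "norm (const_bcontfun p :: 'e curve) \<le> norm p" by (rule norm_bound) simp
    show ?thesis
      unfolding T_def using norm_triangle_mono[OF order_trans[OF 2 sB(3)[OF that(1)]] 1] by simp
  qed
  have "\<exists>x. norm x \<le> \<rho> \<and> T p x = x" if "p \<in> ?P" for p
  proof -
    have "\<exists>!x\<in>cball 0 \<rho>. T p x = x"
    proof (rule Banach_fix[of _ "1/2"])
      show "complete (cball (0::'e curve) \<rho>)" by (simp add: complete_eq_closed)
      show "cball (0::'e curve) \<rho> \<noteq> {}" using \<rho> by simp
      show "T p ` cball 0 \<rho> \<subseteq> cball 0 \<rho>" using Tin[OF that] by auto
      show "dist (T p x) (T p y) \<le> 1/2 * dist x y" if "x \<in> cball 0 \<rho>" "y \<in> cball 0 \<rho>" for x y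
        using TT[OF \<open>p \<in> ?P\<close>, of x y] that by (simp add: dist_norm)
    qed auto
    then show ?thesis by auto
  qed
  then obtain w where w: "\<And>p. p \<in> ?P \<Longrightarrow> norm (w p) \<le> \<rho>" "\<And>p. p \<in> ?P \<Longrightarrow> w p = T p (w p)" by metis
  have wr: "norm (w p) < r" if "p \<in> ?P" for p using w(1)[OF that] \<rho> by simp
  define M where "M b p = (\<Sum>i\<in>Basis. l i p *\<^sub>R curve_comp (?DX i b) (w p))" for b p
  have contr: "norm (curve_volterra (\<lambda>b. M b p) \<eta>) \<le> norm \<eta> / 2" if "p \<in> ?P" for p \<eta>
  proof -
    have "norm (M b p) \<le> s p * B" if "b \<in> Basis" for b
      unfolding M_def
    proof (intro lsum norm_bound)
      fix i :: 'e and t assume "i \<in> Basis"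
      have "(w p) t \<in> cball 0 \<rho>" using norm_bounded[of "w p" t] w(1)[OF \<open>p \<in> ?P\<close>] by simp
      then show "norm (apply_bcontfun (curve_comp (?DX i b) (w p)) t) \<le> B"
        using BDX[OF \<open>i \<in> Basis\<close> that] by (simp add: curve_comp_apply[OF contDX[OF \<open>i \<in> Basis\<close>] wr[OF \<open>p \<in> ?P\<close>]])
    qed
    then have *: "norm (curve_mult (curve_comp (\<lambda>x. x \<bullet> b) \<eta>) (M b p)) \<le> norm \<eta> * (s p * B)" if "b \<in> Basis" for b
      using norm_curve_mult norm_curve_inner[OF that, of \<eta>] that
      by (meson mult_mono norm_ge_zero order_trans)
    have "norm (curve_volterra (\<lambda>b. M b p) \<eta>) \<le> norm (\<Sum>b\<in>Basis. curve_mult (curve_comp (\<lambda>x. x \<bullet> b) \<eta>) (M b p))"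
      unfolding curve_volterra_def by (rule norm_curve_integral)
    also have "\<dots> \<le> (\<Sum>b\<in>(Basis::'e set). norm \<eta> * (s p * B))"
      by (rule sum_norm_le) (use * in auto)
    also have "\<dots> = norm \<eta> * (s p * (d * B))" by (simp add: d_def)
    also have "\<dots> \<le> norm \<eta> * (1/2)" using sB(1)[OF that] by (intro mult_left_mono) auto
    finally show ?thesis by simp
  qed
  define \<beta> where "\<beta> h p = const_bcontfun h + curve_integral (\<Sum>i\<in>Basis. l i h *\<^sub>R curve_comp (X i) (w p))" for h p
  have "\<exists>D. (w has_derivative D) (at p0) \<and> (\<forall>h. D h = \<beta> h p0 + curve_volterra (\<lambda>b. M b p0) (D h))" if "p0 \<in> ?P" for p0
  proof -
    let ?dN = "\<lambda>i v. \<Sum>b\<in>Basis. curve_mult (curve_comp (\<lambda>x. x \<bullet> b) v) (curve_comp (?DX i b) (w p0))"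
    define T' where "T' = (\<lambda>z. const_bcontfun (fst z) +
      curve_integral (\<Sum>i\<in>Basis. l i p0 *\<^sub>R ?dN i (snd z) + l i (fst z) *\<^sub>R curve_comp (X i) (w p0)))"
    have vol: "curve_volterra (\<lambda>b. M b p0) v = curve_integral (\<Sum>i\<in>Basis. l i p0 *\<^sub>R ?dN i v)" for v
    proof -
      have "(\<Sum>b\<in>Basis. curve_mult (curve_comp (\<lambda>x. x \<bullet> b) v) (M b p0)) = (\<Sum>i\<in>Basis. l i p0 *\<^sub>R ?dN i v)"
        unfolding M_def scaleR_sum_right
          bounded_bilinear.sum_right[OF bounded_bilinear_curve_mult] bounded_bilinear.scaleR_right[OF bounded_bilinear_curve_mult]
        by (rule sum.swap)
      then show ?thesis by (simp add: curve_volterra_def)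
    qed
    have T': "T' (h, v) = \<beta> h p0 + curve_volterra (\<lambda>b. M b p0) v" for h v
      by (simp add: T'_def vol \<beta>_def sum.distrib curve_integral_linear)
    have "\<exists>D. (w has_derivative D) (at p0) \<and> (\<forall>h. D h = T' (h, D h))"
    proof (rule fixed_point_has_derivative[OF open_ball that, where T="\<lambda>z. T (fst z) (snd z)"])
      show "w p = T (fst (p, w p)) (snd (p, w p))" if "p \<in> ?P" for p using w(2)[OF that] by simp
      show "norm (T (fst (p, w p)) (snd (p, w p)) - T (fst (p, w p0)) (snd (p, w p0))) \<le> norm (w p - w p0) / 2"
        if "p \<in> ?P" for p using TT[OF that w(1)[OF that] w(1)[OF \<open>p0 \<in> ?P\<close>]] by simp
      have "\<beta> 0 p0 = 0"
        by (simp add: \<beta>_def linear_0[OF bounded_linear.linear[OF l]] curve_integral_linear)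
      then show "norm (T' (0, \<eta>)) \<le> norm \<eta> / 2" for \<eta>
        using contr[OF \<open>p0 \<in> ?P\<close>] by (simp add: T')
      have 1: "((\<lambda>z::'e \<times> 'e curve. curve_comp (X i) (snd z)) has_derivative (\<lambda>z. ?dN i (snd z))) (at (p0, w p0))"
        if "i \<in> Basis" for i
        by (rule has_derivative_compose[of snd snd "(p0, w p0)" UNIV "curve_comp (X i)"])
          (use curve_comp_has_derivative[OF smooth_onD[OF X[OF that]] wr[OF \<open>p0 \<in> ?P\<close>]] in \<open>auto intro!: derivative_eq_intros\<close>)
      have 2: "((\<lambda>z::'e \<times> 'e curve. l i (fst z)) has_derivative (\<lambda>z. l i (fst z))) (at (p0, w p0))"
        if "i \<in> Basis" for i
        by (rule bounded_linear.has_derivative[OF l[OF that]]) (auto intro!: derivative_eq_intros)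
      have 3: "((\<lambda>z::'e \<times> 'e curve. l i (fst z) *\<^sub>R curve_comp (X i) (snd z)) has_derivative
        (\<lambda>z. l i p0 *\<^sub>R ?dN i (snd z) + l i (fst z) *\<^sub>R curve_comp (X i) (w p0))) (at (p0, w p0))"
        if "i \<in> Basis" for i
        using has_derivative_scaleR[OF 2[OF that] 1[OF that]] by simp
      have 4: "((\<lambda>z::'e \<times> 'e curve. const_bcontfun (fst z) :: 'e curve) has_derivative (\<lambda>z. const_bcontfun (fst z))) (at (p0, w p0))"
        by (rule bounded_linear.has_derivative[OF bounded_linear_const_curve]) (auto intro!: derivative_eq_intros)
      show "((\<lambda>z. T (fst z) (snd z)) has_derivative T') (at (p0, w p0))"
        unfolding T_def T'_def
        by (intro has_derivative_add bounded_linear.has_derivative[OF bounded_linear_curve_integral]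
            has_derivative_sum 3 4)
    qed
    then show ?thesis by (simp add: T')
  qed
  then obtain D where D: "\<And>p. p \<in> ?P \<Longrightarrow> (w has_derivative D p) (at p)"
    "\<And>p h. p \<in> ?P \<Longrightarrow> D p h = \<beta> h p + curve_volterra (\<lambda>b. M b p) (D p h)"
    by metis
  \<comment> \<open>If \<open>w\<close> has order \<open>n\<close>, so do the kernel and the
    inhomogeneous term of the linear equation for its derivative; hence so does
    \<open>D p h\<close>, and \<open>w\<close> has order \<open>n + 1\<close>.\<close>
  have "C_k_on n ?P w" for n
  proof (induction n)
    case 0
    show ?case by (simp add: continuous_at_imp_continuous_on has_derivative_continuous[OF D(1)])
  next
    case (Suc n)
    have cl: "C_k_on n ?P (l i)" if "i \<in> Basis" for i
      using smooth_onD[OF smooth_on_bounded_linear[OF l[OF that] open_ball smooth_on_ident]] by simp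
    have M: "C_k_on n ?P (M b)" for b
      unfolding M_def
      by (intro C_k_on_sum C_k_on_bounded_bilinear[OF bounded_bilinear_scaleR] open_ball cl
          C_k_on_curve_comp[OF open_ball wr Suc DX])
    have \<beta>: "C_k_on n ?P (\<beta> h)" for h
      unfolding \<beta>_def
      by (intro C_k_on_add C_k_on_const C_k_on_bounded_linear[OF bounded_linear_curve_integral]
          C_k_on_sum C_k_on_bounded_linear[OF bounded_linear_scaleR_right] open_ball
          C_k_on_curve_comp[OF open_ball wr Suc X])
    have "C_k_on n ?P (\<lambda>p. D p h)" for h
      by (rule volterra_solution_C_k_on[OF open_ball contr M \<beta>[of h] D(2)])
    from C_k_on_SucI[OF open_ball D(1) this] show ?case .
  qed
  then have "smooth_on ?P w" by (simp add: smooth_on_def)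
  moreover have "\<partial> w p = D p" if "p \<in> ?P" for p
    by (rule frechet_derivative_eqI[OF D(1)[OF that]])
  ultimately show thesis
    using that[of \<delta> w] \<open>\<delta> > 0\<close> wr w(2) D(2) contr unfolding T_def \<beta>_def M_def by simp
qed

text \<open>The integral equations are turned into differential ones. The last clause identifies the
  derivative of the time-1 map from any solution \<open>Q\<close> of the variational equation, so
  that it suffices to guess one.\<close>

lemma ode_smooth_dependence:
  fixes X :: "'e::euclidean_space \<Rightarrow> 'e \<Rightarrow> 'e" and l :: "'e \<Rightarrow> 'e \<Rightarrow> real"
  assumes r: "r > 0" and X: "\<And>i. i \<in> Basis \<Longrightarrow> smooth_on (ball 0 r) (X i)"
    and l: "\<And>i. i \<in> Basis \<Longrightarrow> bounded_linear (l i)"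
  obtains \<delta> W where "\<delta> > 0" "smooth_on (ball 0 \<delta>) (W 1)"
    "\<And>p t. p \<in> ball 0 \<delta> \<Longrightarrow> t \<in> {0..1} \<Longrightarrow> norm (W t p) < r"
    "\<And>p. p \<in> ball 0 \<delta> \<Longrightarrow> W 0 p = p"
    "\<And>p t. p \<in> ball 0 \<delta> \<Longrightarrow> t \<in> {0..1} \<Longrightarrow>
      ((\<lambda>t. W t p) has_vector_derivative (\<Sum>i\<in>Basis. l i p *\<^sub>R X i (W t p))) (at t within {0..1})"
    "\<And>p u Q. p \<in> ball 0 \<delta> \<Longrightarrow> Q 0 = u \<Longrightarrow>
      (\<And>t. t \<in> {0..1} \<Longrightarrow> (Q has_vector_derivative
        ((\<Sum>i\<in>Basis. l i u *\<^sub>R X i (W t p)) +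
         (\<Sum>i\<in>Basis. l i p *\<^sub>R \<partial> (X i) (W t p) (Q t)))) (at t within {0..1})) \<Longrightarrow>
      \<partial> (W (1::real)) p u = Q (1::real)"
proof -
  obtain \<delta> w where "\<delta> > 0" and w: "smooth_on (ball 0 \<delta>) w" "\<And>p. p \<in> ball 0 \<delta> \<Longrightarrow> norm (w p) < r"
    "\<And>p. p \<in> ball 0 \<delta> \<Longrightarrow> w p = const_bcontfun p + curve_integral (\<Sum>i\<in>Basis. l i p *\<^sub>R curve_comp (X i) (w p))"
    "\<And>p h. p \<in> ball 0 \<delta> \<Longrightarrow> \<partial> w p h =
      const_bcontfun h + curve_integral (\<Sum>i\<in>Basis. l i h *\<^sub>R curve_comp (X i) (w p)) +
      curve_volterra (\<lambda>b. \<Sum>i\<in>Basis. l i p *\<^sub>R curve_comp (\<lambda>x. \<partial> (X i) x b) (w p))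
        (\<partial> w p h)"
    "\<And>p \<eta>. p \<in> ball 0 \<delta> \<Longrightarrow>
      norm (curve_volterra (\<lambda>b. \<Sum>i\<in>Basis. l i p *\<^sub>R curve_comp (\<lambda>x. \<partial> (X i) x b) (w p)) \<eta>) \<le> norm \<eta> / 2"
    using ode_smooth_dependence_curve[of r X l, OF assms] by blast
  let ?P = "ball (0::'e) \<delta>"
  let ?DX = "\<lambda>i b x. \<partial> (X i) x b"
  note contX = smooth_on_imp_continuous_on[OF X]
  have contDX: "continuous_on (ball 0 r) (?DX i b)" if "i \<in> Basis" for i b
    by (rule smooth_on_imp_continuous_on[OF smooth_on_frechet_derivative[OF _ X[OF that]]]) auto
  define W where "W t p = apply_bcontfun (w p) t" for t p
  have Wr: "norm (W t p) < r" if "p \<in> ?P" for t p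
    using norm_bounded[of "w p" t] w(2)[OF that] by (simp add: W_def)
  have app_sum: "apply_bcontfun (\<Sum>b\<in>I. F b) t = (\<Sum>b\<in>I. apply_bcontfun (F b) t)"
    for F :: "'e \<Rightarrow> 'e curve" and I t
    by (induction I rule: infinite_finite_induct) (auto simp: plus_bcontfun.rep_eq zero_bcontfun.rep_eq)
  let ?A = "\<lambda>h p. \<Sum>i\<in>Basis. l i h *\<^sub>R curve_comp (X i) (w p)"
  have A: "apply_bcontfun (?A h p) t = (\<Sum>i\<in>Basis. l i h *\<^sub>R X i (W t p))" if "p \<in> ?P" for h p t
    by (simp add: app_sum curve_comp_apply[OF contX w(2)[OF that]] W_def)
  have W: "W t p = p + integral {0..clamp01 t} (?A p p)" if "p \<in> ?P" for p t
    unfolding W_def by (subst w(3)[OF that]) (simp add: curve_integral_apply plus_bcontfun.rep_eq)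
  have der: "((\<lambda>t. W t p) has_vector_derivative (\<Sum>i\<in>Basis. l i p *\<^sub>R X i (W t p))) (at t within {0..1})"
    if "p \<in> ?P" "t \<in> {0..1}" for p t
  proof (rule has_vector_derivative_transform[OF that(2)])
    show "W t p = p + integral {0..t} (?A p p)" if "t \<in> {0..1}" for t
      using W[OF \<open>p \<in> ?P\<close>] clamp01(2)[OF that] by simp
    have "((\<lambda>t. integral {0..t} (?A p p)) has_vector_derivative apply_bcontfun (?A p p) t) (at t within {0..1})"
      by (rule integral_has_vector_derivative[OF _ that(2)]) simp
    then show "((\<lambda>t. p + integral {0..t} (?A p p)) has_vector_derivative (\<Sum>i\<in>Basis. l i p *\<^sub>R X i (W t p))) (at t within {0..1})"
      unfolding A[OF that(1)] by (auto intro!: derivative_eq_intros)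
  qed
  have sm: "smooth_on ?P (W 1)"
    using smooth_on_bounded_linear[OF bounded_linear_apply_curve open_ball w(1), of 1] by (simp add: W_def[abs_def])
  have "\<partial> (W 1) p u = Q 1"
    if p: "p \<in> ?P" and Q0: "Q 0 = u" and Q: "\<And>t. t \<in> {0..1} \<Longrightarrow> (Q has_vector_derivative
        ((\<Sum>i\<in>Basis. l i u *\<^sub>R X i (W t p)) +
         (\<Sum>i\<in>Basis. l i p *\<^sub>R \<partial> (X i) (W t p) (Q t)))) (at t within {0..1})" for p u Q
  proof -
    let ?M = "\<lambda>b. \<Sum>i\<in>Basis. l i p *\<^sub>R curve_comp (?DX i b) (w p)"
    let ?D = "\<partial> w p u"
    have contQ: "continuous_on {0..1} Q"
      unfolding continuous_on_eq_continuous_within using has_vector_derivative_continuous[OF Q] by blast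
    then have "compact (Q ` {0..1})" by (intro compact_continuous_image) auto
    then obtain B where B: "\<And>t. t \<in> {0..1} \<Longrightarrow> norm (Q t) \<le> B"
      by (meson compact_imp_bounded bounded_iff imageI)
    \<comment> \<open>\<open>Q\<close> is controlled on [0, 1] only; constant extension makes it a
      bounded curve on the line.\<close>
    define q where "q = Bcontfun (\<lambda>t. Q (clamp01 t))"
    have q: "apply_bcontfun q t = Q (clamp01 t)" for t
      unfolding q_def
    proof (rule apply_Bcontfun)
      show "continuous_on UNIV (\<lambda>t. Q (clamp01 t))"
        by (rule continuous_on_compose2[OF contQ continuous_on_clamp01]) (use clamp01 in auto)
      show "norm (Q (clamp01 t)) \<le> B" for t by (rule B) (rule clamp01)
    qed
    let ?V = "\<Sum>b\<in>Basis. curve_mult (curve_comp (\<lambda>x. x \<bullet> b) q) (?M b)"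
    have int: "apply_bcontfun (?A u p + ?V) s = (\<Sum>i\<in>Basis. l i u *\<^sub>R X i (W s p)) +
         (\<Sum>i\<in>Basis. l i p *\<^sub>R \<partial> (X i) (W s p) (Q s))" if "s \<in> {0..1}" for s
    proof -
      have diff: "X i differentiable (at (W s p))" if "i \<in> Basis" for i
        using smooth_on_imp_differentiable[OF X[OF that]] Wr[OF p] by simp
      have "apply_bcontfun ?V s = (\<Sum>b\<in>Basis. (Q s \<bullet> b) *\<^sub>R (\<Sum>i\<in>Basis. l i p *\<^sub>R ?DX i b (W s p)))"
        by (simp add: app_sum curve_mult_apply curve_inner_apply q clamp01(2)[OF that] W_def
            curve_comp_apply[OF contDX w(2)[OF p]])
      also have "\<dots> = (\<Sum>i\<in>Basis. l i p *\<^sub>R (\<Sum>b\<in>Basis. (Q s \<bullet> b) *\<^sub>R ?DX i b (W s p)))"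
        unfolding scaleR_sum_right by (subst sum.swap) (simp add: mult.commute)
      also have "\<dots> = (\<Sum>i\<in>Basis. l i p *\<^sub>R \<partial> (X i) (W s p) (Q s))"
        by (intro sum.cong refl) (simp add: frechet_derivative_basis[OF diff, symmetric])
      finally show ?thesis using A[OF p] by (simp add: plus_bcontfun.rep_eq)
    qed
    have "q = const_bcontfun u + curve_integral (?A u p) + curve_volterra ?M q"
    proof (rule bcontfun_eqI)
      fix t
      let ?c = "clamp01 t"
      have c: "?c \<in> {0..1}" by (rule clamp01)
      have "(apply_bcontfun (?A u p + ?V) has_integral Q ?c - Q 0) {0..?c}"
      proof (rule fundamental_theorem_of_calculus)
        show "(Q has_vector_derivative apply_bcontfun (?A u p + ?V) s) (at s within {0..?c})" if "s \<in> {0..?c}" for s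
        proof -
          have s: "s \<in> {0..1}" using that c by auto
          show ?thesis unfolding int[OF s]
            by (rule has_vector_derivative_within_subset[OF Q[OF s]]) (use c in auto)
        qed
      qed (use c in auto)
      then have "apply_bcontfun (curve_integral (?A u p + ?V)) t = Q ?c - Q 0"
        by (simp add: curve_integral_apply integral_unique)
      then show "apply_bcontfun q t = apply_bcontfun (const_bcontfun u + curve_integral (?A u p) + curve_volterra ?M q) t"
        using Q0 by (simp add: q curve_volterra_def curve_integral_linear add.assoc)
    qed
    note qeq = this
    have sub: "a - b = a' - b'" if "a = c + a'" "b = c + b'" for a b c a' b' :: "'e curve"
      using that by simp
    \<comment> \<open>The difference of two solutions satisfies the homogeneous equation, and the
      contraction leaves only 0.\<close>
    have "?D - q = curve_volterra ?M (?D - q)"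
      unfolding curve_volterra_diff by (rule sub[OF w(4)[OF p, of u] qeq])
    from w(5)[OF p, of "?D - q", folded this]
    have "?D = q" by simp
    moreover have "\<partial> (W 1) p u = apply_bcontfun ?D 1"
      using frechet_derivative_bounded_linear[OF bounded_linear_apply_curve smooth_on_imp_differentiable[OF w(1) p], of 1 u]
      by (simp add: W_def[abs_def])
    ultimately show ?thesis by (simp add: q clamp01(2))
  qed
  note deriv = this
  have W0: "W 0 p = p" if "p \<in> ?P" for p
    using W[OF that, of 0] by (simp add: clamp01(2))
  show thesis
  proof (rule that[OF \<open>\<delta> > 0\<close> sm Wr W0 der])
    fix p u Q
    assume "p \<in> ?P" "Q 0 = u" "\<And>t. t \<in> {0..1} \<Longrightarrow> (Q has_vector_derivative
        ((\<Sum>i\<in>Basis. l i u *\<^sub>R X i (W t p)) +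
         (\<Sum>i\<in>Basis. l i p *\<^sub>R \<partial> (X i) (W t p) (Q t)))) (at t within {0..1})"
    then show "\<partial> (W 1) p u = Q 1" by (rule deriv)
  qed
qed

section \<open>Frobenius' theorem\<close>

text \<open>As \<open>\<pi> (P x p) = \<pi> p\<close>, the value of \<pi> along the curve falls
  linearly from \<open>\<pi> p\<close> to 0, so \<open>W 1\<close> slides \<open>p\<close> along its
  leaf into the slice where \<pi> vanishes. Displacing \<open>p\<close> along the leaf does not move
  the end point, and points of the slice stay put.\<close>

lemma frobenius_commuting:
  fixes P :: "'e::euclidean_space \<Rightarrow> 'e \<Rightarrow> 'e" and \<pi> :: "'e \<Rightarrow> 'e"
  assumes r: "r > 0" and smP: "\<And>v. smooth_on (ball 0 r) (\<lambda>x. P x v)"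
    and linP: "\<And>x. x \<in> ball 0 r \<Longrightarrow> linear (P x)" and lin\<pi>: "linear \<pi>"
    and \<pi>P: "\<And>x v. x \<in> ball 0 r \<Longrightarrow> \<pi> (P x v) = \<pi> v" and P\<pi>: "\<And>x v. x \<in> ball 0 r \<Longrightarrow> P x (\<pi> v) = P x v"
    and comm: "\<And>x a b. x \<in> ball 0 r \<Longrightarrow>
      \<partial> (\<lambda>y. P y a) x (P x b) = \<partial> (\<lambda>y. P y b) x (P x a)"
  obtains \<delta> Y where "\<delta> > 0" "smooth_on (ball 0 \<delta>) Y"
    "\<And>x b. x \<in> ball 0 \<delta> \<Longrightarrow> x \<in> ball 0 r \<Longrightarrow> \<partial> Y x (P x b) = 0"
    "\<And>x. x \<in> ball 0 \<delta> \<Longrightarrow> \<pi> x = 0 \<Longrightarrow> Y x = x"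
proof -
  define X where "X i x = - P x i" for i x
  define l where "l i p = \<pi> p \<bullet> i" for i p
  have X: "smooth_on (ball 0 r) (X i)" for i
    unfolding X_def[abs_def] by (rule smooth_on_minus[OF open_ball smP])
  have l: "bounded_linear (l i)" for i
    unfolding l_def[abs_def]
    by (rule bounded_linear_compose[OF bounded_linear_inner_left]) (simp add: lin\<pi> linear_conv_bounded_linear[symmetric])
  have P_exp: "P x v = (\<Sum>i\<in>Basis. (v \<bullet> i) *\<^sub>R P x i)" if "x \<in> ball 0 r" for x v
  proof -
    have "P x (\<Sum>i\<in>Basis. (v \<bullet> i) *\<^sub>R i) = (\<Sum>i\<in>Basis. (v \<bullet> i) *\<^sub>R P x i)"
      by (simp add: linear_sum[OF linP[OF that]] linear_scale[OF linP[OF that]])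
    then show ?thesis by (simp add: euclidean_representation)
  qed
  have lX: "(\<Sum>i\<in>Basis. l i p *\<^sub>R X i x) = - P x p" if "x \<in> ball 0 r" for x p
    using P_exp[OF that, of "\<pi> p"] P\<pi>[OF that, of p] by (simp add: l_def X_def sum_negf)
  have dP: "((\<lambda>y. P y v) has_derivative \<partial> (\<lambda>y. P y v) x) (at x)" if "x \<in> ball 0 r" for x v
    by (rule smooth_on_has_derivative[OF smP that])
  have lDX: "(\<Sum>i\<in>Basis. l i p *\<^sub>R \<partial> (X i) x z) = - \<partial> (\<lambda>y. P y (\<pi> p)) x z"
    if "x \<in> ball 0 r" for x p z
  proof -
    have 1: "\<partial> (X i) x z = - \<partial> (\<lambda>y. P y i) x z" for i
      unfolding X_def[abs_def] by (simp add: frechet_derivative_eqI[OF has_derivative_minus[OF dP[OF that]]])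
    have "((\<lambda>y. P y (\<pi> p)) has_derivative (\<lambda>z. \<Sum>i\<in>Basis. (\<pi> p \<bullet> i) *\<^sub>R \<partial> (\<lambda>y. P y i) x z)) (at x)"
    proof (rule has_derivative_transform_within_open[OF _ open_ball that])
      show "((\<lambda>y. \<Sum>i\<in>Basis. (\<pi> p \<bullet> i) *\<^sub>R P y i) has_derivative
          (\<lambda>z. \<Sum>i\<in>Basis. (\<pi> p \<bullet> i) *\<^sub>R \<partial> (\<lambda>y. P y i) x z)) (at x)"
        by (intro has_derivative_sum has_derivative_scaleR_right dP that)
    qed (rule P_exp[symmetric])
    then show ?thesis by (simp add: 1 l_def sum_negf frechet_derivative_eqI)
  qed
  obtain \<delta> W where "\<delta> > 0" "smooth_on (ball 0 \<delta>) (W 1)"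
    and W: "\<And>p t. p \<in> ball 0 \<delta> \<Longrightarrow> t \<in> {0..1} \<Longrightarrow> norm (W t p) < r"
    "\<And>p. p \<in> ball 0 \<delta> \<Longrightarrow> W 0 p = p"
    "\<And>p t. p \<in> ball 0 \<delta> \<Longrightarrow> t \<in> {0..1} \<Longrightarrow>
      ((\<lambda>t. W t p) has_vector_derivative (\<Sum>i\<in>Basis. l i p *\<^sub>R X i (W t p))) (at t within {0..1})"
    "\<And>p u Q. p \<in> ball 0 \<delta> \<Longrightarrow> Q 0 = u \<Longrightarrow>
      (\<And>t. t \<in> {0..1} \<Longrightarrow> (Q has_vector_derivative
        ((\<Sum>i\<in>Basis. l i u *\<^sub>R X i (W t p)) +
         (\<Sum>i\<in>Basis. l i p *\<^sub>R \<partial> (X i) (W t p) (Q t)))) (at t within {0..1})) \<Longrightarrow>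
      \<partial> (W (1::real)) p u = Q (1::real)"
    using ode_smooth_dependence[of r X l, OF r X l] by blast
  have W': "((\<lambda>t. W t p) has_vector_derivative - P (W t p) p) (at t within {0..1})"
    if "p \<in> ball 0 \<delta>" "t \<in> {0..1}" for p t
    using W(3)[OF that] lX[of "W t p" p] W(1)[OF that] by simp
  show thesis
  proof (rule that[of \<delta> "W 1"])
    \<comment> \<open>In the slice the velocity \<open>- P (W t p) p\<close> vanishes, since
      \<open>P\<close> sees only \<open>\<pi> p\<close>.\<close>
    show "W 1 p = p" if "p \<in> ball 0 \<delta>" "\<pi> p = 0" for p
    proof -
      have "((\<lambda>t. W t p) has_derivative (\<lambda>h. 0)) (at t within {0..1})" if "t \<in> {0..1}" for t
      proof -
        have "W t p \<in> ball 0 r" using W(1)[OF \<open>p \<in> _\<close> that] by simp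
        then have "P (W t p) p = 0"
          using P\<pi>[of "W t p" p] linear_0[OF linP] \<open>\<pi> p = 0\<close> by simp
        then show ?thesis using W'[OF \<open>p \<in> _\<close> that] by (simp add: has_vector_derivative_def)
      qed
      then obtain c where "\<And>t. t \<in> {0..1} \<Longrightarrow> W t p = c"
        using has_derivative_zero_constant[of "{0..1}" "\<lambda>t. W t p"] by auto
      then show ?thesis using W(2)[OF that(1)] by (metis atLeastAtMost_iff order_refl zero_le_one)
    qed
    show "\<partial> (W 1) p (P p b) = 0" if p: "p \<in> ball 0 \<delta>" and pr: "p \<in> ball 0 r" for p b
    proof -
      \<comment> \<open>Commutation keeps the variation a multiple of the field \<open>P x b\<close>
        along the curve. The factor 1 - t reaches 0 together with the curve reaching the slice, so
        the end point does not move.\<close>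
      define Q where "Q t = (1 - t) *\<^sub>R P (W t p) b" for t
      have "\<partial> (W 1) p (P p b) = Q 1"
      proof (rule W(4)[OF p])
        show "Q 0 = P p b" by (simp add: Q_def W(2)[OF p])
        fix t :: real assume t: "t \<in> {0..1}"
        let ?w = "W t p"
        have w: "?w \<in> ball 0 r" using W(1)[OF p t] by simp
        let ?DP = "\<lambda>v. \<partial> (\<lambda>y. P y v) ?w"
        have lin: "linear (?DP v)" for v using dP[OF w] by (rule has_derivative_linear)
        have "((\<lambda>t. P (W t p) b) has_derivative (\<lambda>h. ?DP b (h *\<^sub>R - P ?w p))) (at t within {0..1})"
          by (rule has_derivative_compose[OF W'[OF p t, unfolded has_vector_derivative_def] dP[OF w]])
        then have "((\<lambda>t. P (W t p) b) has_vector_derivative - ?DP b (P ?w p)) (at t within {0..1})"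
          unfolding has_vector_derivative_def by (simp add: linear_scale[OF lin] linear_neg[OF lin])
        moreover have "((\<lambda>t. 1 - t) has_real_derivative -1) (at t within {0..1})"
          by (auto intro!: derivative_eq_intros)
        ultimately have "(Q has_vector_derivative ((1 - t) *\<^sub>R - ?DP b (P ?w p) + (-1) *\<^sub>R P ?w b)) (at t within {0..1})"
          unfolding Q_def by (intro has_vector_derivative_scaleR)
        moreover have "(\<Sum>i\<in>Basis. l i (P p b) *\<^sub>R X i ?w) = - P ?w b"
          using lX[OF w, of "P p b"] P\<pi>[OF w, of "P p b"] \<pi>P[OF pr, of b] P\<pi>[OF w, of b] by simp
        moreover have "(\<Sum>i\<in>Basis. l i p *\<^sub>R \<partial> (X i) ?w (Q t)) = (1 - t) *\<^sub>R - ?DP b (P ?w p)"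
          using lDX[OF w, of p "Q t"] comm[OF w, of "\<pi> p" b] P\<pi>[OF w, of p] linear_scale[OF lin]
          by (simp add: Q_def)
        ultimately show "(Q has_vector_derivative ((\<Sum>i\<in>Basis. l i (P p b) *\<^sub>R X i ?w) +
         (\<Sum>i\<in>Basis. l i p *\<^sub>R \<partial> (X i) ?w (Q t)))) (at t within {0..1})"
          by (simp add: add.commute)
      qed
      then show ?thesis by (simp add: Q_def)
    qed
  qed fact+
qed

section \<open>Adapted projections and first integrals of an involutive distribution\<close>

lemma frechet_derivative_shift:
  assumes "f differentiable (at (a + x))"
  shows "\<partial> (\<lambda>y. f (a + y)) x = \<partial> f (a + x)"
proof (rule frechet_derivative_eqI)
  show "((\<lambda>y. f (a + y)) has_derivative \<partial> f (a + x)) (at x)"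
    by (rule has_derivative_compose[of "\<lambda>y. a + y" "\<lambda>h. h" x UNIV f])
      (use assms in \<open>auto intro!: derivative_eq_intros simp: frechet_derivative_works\<close>)
qed

lemma open_invertible_neighbourhood:
  fixes A :: "'a::real_normed_vector \<Rightarrow> real^'n^'n"
  assumes "open V" "x0 \<in> V" "\<And>i j. smooth_on V (\<lambda>x. A x $ i $ j)" "invertible (A x0)"
  obtains N where "open N" "x0 \<in> N" "N \<subseteq> V" "\<And>x. x \<in> N \<Longrightarrow> invertible (A x)"
proof -
  have "continuous_on V (\<lambda>x. det (A x))"
    by (rule C_k_on_imp_continuous_on[OF C_k_on_det[OF assms(1)]]) (use assms(3) smooth_onD in blast)
  then have "open (V \<inter> (\<lambda>x. det (A x)) -` (- {0}))"
    using assms(1) by (rule continuous_open_preimage) auto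
  then show thesis
    using assms(2,4) by (intro that[of "V \<inter> (\<lambda>x. det (A x)) -` (- {0})"]) (auto simp: invertible_det_nz)
qed

text \<open>The field \<open>P x a\<close> is the value at \<open>a\<close> of the projection onto \<open>L x\<close> along a fixed complement
  of \<open>L x0\<close>.\<close>

lemma distribution_projection:
  fixes L :: "(real^'n) distribution"
  assumes U: "open U" "x0 \<in> U" and L: "smooth_distribution_on U L" and dimL: "\<And>x. x \<in> U \<Longrightarrow> dim (L x) = d"
  obtains N P \<pi> where "open N" "x0 \<in> N" "N \<subseteq> U" "\<And>v. smooth_on N (\<lambda>x. P x v)"
    "\<And>x. x \<in> N \<Longrightarrow> linear (P x)" "linear \<pi>" "\<And>x v. x \<in> N \<Longrightarrow> \<pi> (P x v) = \<pi> v" "\<And>x v. x \<in> N \<Longrightarrow> P x (\<pi> v) = P x v"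
    "\<And>x v. x \<in> N \<Longrightarrow> P x v \<in> L x" "\<And>x v. x \<in> N \<Longrightarrow> v \<in> L x \<Longrightarrow> P x v = v" "\<And>v. \<pi> v \<in> L x0" "\<And>v. \<pi> (\<pi> v) = \<pi> v"
proof -
  obtain V S where V: "open V" "x0 \<in> V" "V \<subseteq> U" and S: "finite S" "\<And>s. s \<in> S \<Longrightarrow> smooth_on V s"
    and span: "\<And>y. y \<in> V \<Longrightarrow> L y = span ((\<lambda>s. s y) ` S)"
    using L U(2) unfolding smooth_distribution_on_def by metis
  obtain B where B: "B \<subseteq> (\<lambda>s. s x0) ` S" "independent B" "(\<lambda>s. s x0) ` S \<subseteq> span B" "card B = dim ((\<lambda>s. s x0) ` S)"
    using basis_exists by blast
  have spanB: "span B = L x0"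
    using span[OF V(2)] B(1,3) by (metis span_mono span_span subset_antisym)
  have cardB: "card B = d"
    using B(4) span[OF V(2)] dimL[OF U(2)] by (simp add: dim_span)
  have "\<exists>s\<in>S. s x0 = b" if "b \<in> B" for b using B(1) that by auto
  then obtain s where s: "\<And>b. b \<in> B \<Longrightarrow> s b \<in> S" "\<And>b. b \<in> B \<Longrightarrow> s b x0 = b" by metis
  obtain B' where "B \<subseteq> B'" "B' \<subseteq> UNIV" "independent B'" "UNIV \<subseteq> span B'"
    by (rule maximal_independent_subset_extend[OF subset_UNIV B(2)])
  then have B': "B \<subseteq> B'" "independent B'" "span B' = (UNIV :: (real^'n) set)" by blast+
  have "finite B'" using B'(2) by (rule independent_imp_finite)
  with finite_subset[OF B'(1)] have fin: "finite B'" "finite B" by simp_all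
  define c where "c b v = representation B' v b" for b v
  have linc: "linear (c b)" for b
  proof (rule linearI)
    have sp: "v \<in> span B'" for v using B'(3) by simp
    show "c b (v + w) = c b v + c b w" "c b (k *\<^sub>R v) = k *\<^sub>R c b v" for v w k
      unfolding c_def using representation_add[OF B'(2) sp sp] representation_scale[OF B'(2) sp]
      by simp_all
  qed
  have exp: "(\<Sum>b\<in>B'. c b v *\<^sub>R b) = v" for v
    unfolding c_def by (rule real_vector.sum_representation_eq) (use B' fin in auto)
  have cb: "c b b' = (if b = b' then 1 else 0)" if "b' \<in> B'" for b b'
    unfolding c_def using representation_basis[OF B'(2) that] by auto
  define \<pi> where "\<pi> v = (\<Sum>b\<in>B. c b v *\<^sub>R b)" for v
  \<comment> \<open>\<open>Q x\<close> replaces the basis vectors of \<open>L x0\<close> by the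
    frame values at \<open>x\<close> and fixes the complementary ones. It is the identity at
    \<open>x0\<close>, hence invertible nearby, and conjugating \<pi> by it gives
    \<open>P x\<close>.\<close>
  define Q where "Q x v = (\<Sum>b\<in>B'. c b v *\<^sub>R (if b \<in> B then s b x else b))" for x v
  have lins: "linear (\<lambda>v. c b v *\<^sub>R w)" for b and w :: "real^'n"
    by (rule linearI) (simp_all add: linear_add[OF linc] linear_scale[OF linc] scaleR_add_left)
  have lin\<pi>: "linear \<pi>" unfolding \<pi>_def[abs_def] by (rule linear_compose_sum) (simp add: lins)
  have linQ: "linear (Q x)" for x unfolding Q_def[abs_def] by (rule linear_compose_sum) (simp add: lins)
  have sms: "smooth_on V (\<lambda>x. if b \<in> B then s b x else b)" for b
    by (cases "b \<in> B") (simp_all add: S(2)[OF s(1)])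
  have smQ: "smooth_on V (\<lambda>x. Q x v)" for v
    unfolding Q_def by (intro smooth_on_sum smooth_on_bounded_linear[OF bounded_linear_scaleR_right] V(1) sms)
  define A where "A x = matrix (Q x)" for x
  have Av: "A x *v v = Q x v" for x v
    unfolding A_def using linQ by (simp add: matrix_works)
  have Ax0: "Q x0 v = v" for v
  proof -
    have "Q x0 v = (\<Sum>b\<in>B'. c b v *\<^sub>R b)" unfolding Q_def using s(2) by (intro sum.cong) auto
    then show ?thesis by (simp add: exp)
  qed
  have smA: "smooth_on V (\<lambda>x. A x $ i $ j)" for i j
    using smooth_on_nth[OF V(1) smQ] by (simp add: A_def matrix_def)
  have "A x0 = mat 1" by (simp add: matrix_eq Av Ax0)
  then have "invertible (A x0)" by (simp add: invertible_det_nz)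
  then obtain N where N: "open N" "x0 \<in> N" "N \<subseteq> V" "\<And>x. x \<in> N \<Longrightarrow> invertible (A x)"
    using open_invertible_neighbourhood[OF V(1,2) smA] by blast
  define R where "R x v = matrix_inv (A x) *v v" for x v
  have RQ: "R x (Q x v) = v" "Q x (R x v) = v" if "x \<in> N" for x v
    using matrix_inv_mult[OF N(4)[OF that]] by (simp_all add: R_def flip: Av)
  have linR: "linear (R x)" for x unfolding R_def[abs_def] by simp
  have Qb: "Q x b = (if b \<in> B then s b x else b)" if "b \<in> B'" for x b
  proof -
    have "Q x b = (\<Sum>b'\<in>B'. if b' = b then (if b \<in> B then s b x else b) else 0)"
      unfolding Q_def using that by (intro sum.cong) (auto simp: cb)
    then show ?thesis using fin that by simp
  qed
  have \<pi>b: "\<pi> b = (if b \<in> B then b else 0)" if "b \<in> B'" for b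
  proof -
    have "\<pi> b = (\<Sum>b'\<in>B. if b' = b then b else 0)"
      unfolding \<pi>_def using that by (intro sum.cong) (auto simp: cb)
    then show ?thesis using fin by simp
  qed
  define P where "P x v = Q x (\<pi> (R x v))" for x v
  have Pexp: "P x v = (\<Sum>b\<in>B. c b (R x v) *\<^sub>R s b x)" if "x \<in> N" for x v
  proof -
    have "P x v = (\<Sum>b\<in>B. c b (R x v) *\<^sub>R Q x b)"
      unfolding P_def \<pi>_def by (simp add: linear_sum[OF linQ] linear_scale[OF linQ])
    then show ?thesis using Qb B'(1) by (auto intro!: sum.cong)
  qed
  \<comment> \<open>\<open>Q x\<close> is the identity on the complement, so \<open>v\<close> and
    \<open>P x v\<close> differ by an element of the kernel of \<pi>.\<close>
  have ker: "Q x v - Q x (\<pi> v) = v - \<pi> v" for x v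
  proof -
    have "Q x v - Q x (\<pi> v) = Q x (v - \<pi> v)" by (simp add: linear_diff[OF linQ])
    also have "v - \<pi> v = (\<Sum>b\<in>B' - B. c b v *\<^sub>R b)"
      using exp[of v] sum.subset_diff[OF B'(1) fin(1), of "\<lambda>b. c b v *\<^sub>R b"] by (simp add: \<pi>_def algebra_simps)
    also have "Q x \<dots> = (\<Sum>b\<in>B' - B. c b v *\<^sub>R Q x b)"
      by (simp add: linear_sum[OF linQ] linear_scale[OF linQ])
    also have "\<dots> = (\<Sum>b\<in>B' - B. c b v *\<^sub>R b)" by (intro sum.cong) (auto simp: Qb)
    also have "\<dots> = v - \<pi> v"
      using exp[of v] sum.subset_diff[OF B'(1) fin(1), of "\<lambda>b. c b v *\<^sub>R b"] by (simp add: \<pi>_def algebra_simps)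
    finally show ?thesis .
  qed
  have \<pi>\<pi>: "\<pi> (\<pi> v) = \<pi> v" for v
  proof -
    have "\<pi> (\<pi> v) = (\<Sum>b\<in>B. c b v *\<^sub>R \<pi> b)"
      unfolding \<pi>_def[of v] by (simp add: linear_sum[OF lin\<pi>] linear_scale[OF lin\<pi>])
    also have "\<dots> = \<pi> v" unfolding \<pi>_def[of v] using \<pi>b B'(1) by (auto intro!: sum.cong)
    finally show ?thesis .
  qed
  have \<pi>P: "\<pi> (P x v) = \<pi> v" if "x \<in> N" for x v
  proof -
    have "v - P x v = R x v - \<pi> (R x v)"
      using ker[of x "R x v"] RQ(2)[OF that] by (simp add: P_def)
    then have "\<pi> (v - P x v) = 0" by (simp add: linear_diff[OF lin\<pi>] \<pi>\<pi>)
    then show ?thesis by (simp add: linear_diff[OF lin\<pi>])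
  qed
  have P\<pi>: "P x (\<pi> v) = P x v" if "x \<in> N" for x v
  proof -
    have "Q x (v - \<pi> v) = v - \<pi> v" using ker[of x v] by (simp add: linear_diff[OF linQ])
    then have "R x (v - \<pi> v) = v - \<pi> v" using RQ(1)[OF that] by metis
    then have "P x (v - \<pi> v) = Q x (\<pi> (v - \<pi> v))" by (simp add: P_def)
    also have "\<dots> = 0" by (simp add: linear_diff[OF lin\<pi>] \<pi>\<pi> linear_0[OF linQ])
    finally show ?thesis
      by (simp add: P_def linear_diff[OF linR] linear_diff[OF lin\<pi>] linear_diff[OF linQ])
  qed
  have PL: "P x v \<in> L x" if "x \<in> N" for x v
  proof -
    have "x \<in> V" using that N by auto
    have "P x v \<in> span ((\<lambda>s. s x) ` S)"
      unfolding Pexp[OF that] using s(1) by (intro span_sum span_scale span_base) auto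
    then show ?thesis using span[OF \<open>x \<in> V\<close>] by simp
  qed
  \<comment> \<open>Constant rank enters here: \<open>d\<close> independent frame values inside the
    \<open>d\<close>-dimensional space \<open>L x\<close> span it.\<close>
  have LP: "P x v = v" if "x \<in> N" "v \<in> L x" for x v
  proof -
    have "x \<in> V" using that N by auto
    have inj: "inj (Q x)" using RQ(1)[OF that(1)] by (metis injI)
    have QB: "Q x ` B \<subseteq> L x"
      using Qb B'(1) s(1) span[OF \<open>x \<in> V\<close>] by (auto intro!: span_base)
    have "independent (Q x ` B)"
      by (rule linear_independent_injective_image[OF linQ B(2) inj_on_subset[OF inj subset_UNIV]])
    then have "dim (span (Q x ` B)) = d"
      using cardB card_image[OF inj_on_subset[OF inj subset_UNIV], of B] by (simp add: dim_eq_card_independent)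
    moreover have "subspace (L x)" using span[OF \<open>x \<in> V\<close>] by simp
    moreover have "dim (L x) = d" using dimL \<open>x \<in> V\<close> V(3) by auto
    ultimately have "span (Q x ` B) = L x"
      using QB by (intro subspace_dim_equal) (auto simp: span_minimal)
    then have "v \<in> Q x ` span B" using that(2) linear_span_image[OF linQ] by metis
    then obtain u where u: "u \<in> span B" "v = Q x u" by auto
    have "\<pi> u = u" using u(1)
    proof (induction rule: span_induct_alt)
      case base then show ?case by (simp add: linear_0[OF lin\<pi>])
    next
      case (step k b y)
      then show ?case using \<pi>b[of b] B'(1) by (simp add: linear_add[OF lin\<pi>] linear_scale[OF lin\<pi>] subset_iff)
    qed
    then show ?thesis using u(2) RQ(1)[OF that(1)] by (simp add: P_def)
  qed
  show thesis
  proof (rule that[OF N(1,2) _ _ _ lin\<pi> \<pi>P P\<pi> PL LP _ \<pi>\<pi>])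
    show "N \<subseteq> U" using N V by auto
    show "linear (P x)" for x unfolding P_def[abs_def]
      using linear_compose[OF linear_compose[OF linR lin\<pi>] linQ] by (simp add: o_def)
    show "\<pi> v \<in> L x0" for v
      unfolding \<pi>_def spanB[symmetric] by (intro span_sum span_scale span_base)
    show "smooth_on N (\<lambda>x. P x v)" for v
    proof (rule smooth_on_cong[OF N(1)])
      have bl: "bounded_linear (c b)" for b using linc by (simp add: linear_conv_bounded_linear)
      have "smooth_on N (\<lambda>x. R x v)"
        unfolding R_def by (rule smooth_on_matrix_inv_mult[OF N(1) smooth_on_subset[OF smA N(3)] _ N(4)]) auto
      then show "smooth_on N (\<lambda>x. \<Sum>b\<in>B. c b (R x v) *\<^sub>R s b x)"
        using s(1) S(2) N
        by (intro smooth_on_sum smooth_on_scaleR smooth_on_bounded_linear[OF bl]) (auto intro: smooth_on_subset)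
    qed (use Pexp in auto)
  qed
qed

text \<open>Since \<open>\<pi> (P x v)\<close> does not depend on \<open>x\<close>, \<pi> kills the
  bracket of two fields \<open>P x a\<close> and \<open>P x b\<close>. Involutivity puts the bracket
  into \<open>L x\<close>, where \<pi> is injective, so the fields commute. The sliding map fixes
  the slice, so its derivative at the base point has no kernel beyond \<open>L x0\<close>.\<close>

theorem frobenius_first_integrals:
  fixes L :: "(real^'n) distribution"
  assumes U: "open U" "x0 \<in> U" and L: "smooth_distribution_on U L" "involutive_on U L"
    and dimL: "\<And>x. x \<in> U \<Longrightarrow> dim (L x) = d"
  obtains N Y where "open N" "x0 \<in> N" "N \<subseteq> U" "smooth_on N (Y :: real^'n \<Rightarrow> real^'n)"
    "\<And>x v. x \<in> N \<Longrightarrow> v \<in> L x \<Longrightarrow> \<partial> Y x v = 0"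
    "\<And>v. \<partial> Y x0 v = 0 \<Longrightarrow> v \<in> L x0"
proof -
  obtain N P \<pi> where N: "open N" "x0 \<in> N" "N \<subseteq> U" and smP: "\<And>v. smooth_on N (\<lambda>x. P x v)"
    and linP: "\<And>x. x \<in> N \<Longrightarrow> linear (P x)" and lin\<pi>: "linear \<pi>"
    and \<pi>P: "\<And>x v. x \<in> N \<Longrightarrow> \<pi> (P x v) = \<pi> v" and P\<pi>: "\<And>x v. x \<in> N \<Longrightarrow> P x (\<pi> v) = P x v"
    and PL: "\<And>x v. x \<in> N \<Longrightarrow> P x v \<in> L x" and LP: "\<And>x v. x \<in> N \<Longrightarrow> v \<in> L x \<Longrightarrow> P x v = v"
    and \<pi>L: "\<And>v. \<pi> v \<in> L x0" and \<pi>\<pi>: "\<And>v. \<pi> (\<pi> v) = \<pi> v"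
    using distribution_projection[OF U L(1) dimL] by blast
  obtain r where r: "r > 0" "ball x0 r \<subseteq> N" using N open_contains_ball by blast
  have comm: "\<partial> (\<lambda>y. P y a) x (P x b) = \<partial> (\<lambda>y. P y b) x (P x a)"
    if x: "x \<in> N" for x a b
  proof -
    let ?br = "lie_bracket (\<lambda>y. P y b) (\<lambda>y. P y a) x"
    have bl: "bounded_linear \<pi>" using lin\<pi> by (simp add: linear_conv_bounded_linear)
    have "section_on N L (\<lambda>y. P y v)" for v
      using N(1) smP PL by (simp add: section_on_def)
    then have "?br \<in> L x" using L(2) N(3) x unfolding involutive_on_def by blast
    have d0: "\<pi> (\<partial> (\<lambda>y. P y v) x z) = 0" for v z
    proof -
      have "((\<lambda>y. \<pi> (P y v)) has_derivative (\<lambda>z. \<pi> (\<partial> (\<lambda>y. P y v) x z))) (at x)"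
        by (rule bounded_linear.has_derivative[OF bl smooth_on_has_derivative[OF smP x]])
      moreover have "((\<lambda>y. \<pi> (P y v)) has_derivative (\<lambda>z. 0)) (at x)"
        by (rule has_derivative_transform_within_open[OF has_derivative_const N(1) x]) (simp add: \<pi>P)
      ultimately have "(\<lambda>z. \<pi> (\<partial> (\<lambda>y. P y v) x z)) = (\<lambda>z. 0)"
        by (rule has_derivative_unique)
      then show ?thesis by (rule fun_cong)
    qed
    have "\<pi> ?br = 0" unfolding lie_bracket_def by (simp add: linear_diff[OF lin\<pi>] d0)
    then have "?br = P x 0" using LP[OF x \<open>?br \<in> L x\<close>] P\<pi>[OF x, of ?br] by simp
    then show ?thesis using linear_0[OF linP[OF x]] by (simp add: lie_bracket_def)
  qed
  have shift: "x0 + y \<in> N" if "y \<in> ball 0 r" for y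
    using that r(2) by (auto simp: subset_iff dist_norm)
  define P0 where "P0 y v = P (x0 + y) v" for y v
  have fdP0: "\<partial> (\<lambda>y. P0 y v) y = \<partial> (\<lambda>y. P y v) (x0 + y)"
    if "y \<in> ball 0 r" for y v
    unfolding P0_def by (rule frechet_derivative_shift[OF smooth_on_imp_differentiable[OF smP shift[OF that]]])
  have sm_shift: "smooth_on (ball 0 r) (\<lambda>y. P0 y v)" for v
    unfolding P0_def
    by (rule smooth_on_compose[OF open_ball N(1) smooth_on_add[OF open_ball smooth_on_const smooth_on_ident] smP])
      (use r(2) in auto)
  obtain \<delta> Y where Y: "\<delta> > 0" "smooth_on (ball 0 \<delta>) Y"
    "\<And>x b. x \<in> ball 0 \<delta> \<Longrightarrow> x \<in> ball 0 r \<Longrightarrow> \<partial> Y x (P0 x b) = 0"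
    "\<And>x. x \<in> ball 0 \<delta> \<Longrightarrow> \<pi> x = 0 \<Longrightarrow> Y x = x"
  proof (rule frobenius_commuting[OF r(1) sm_shift _ lin\<pi>])
    show "linear (P0 x)" "\<pi> (P0 x v) = \<pi> v" "P0 x (\<pi> v) = P0 x v" if "x \<in> ball 0 r" for x v
      using linP[OF shift[OF that]] \<pi>P[OF shift[OF that]] P\<pi>[OF shift[OF that]] by (simp_all add: P0_def[abs_def])
    show "\<partial> (\<lambda>y. P0 y a) x (P0 x b) = \<partial> (\<lambda>y. P0 y b) x (P0 x a)"
      if "x \<in> ball 0 r" for x a b
      unfolding fdP0[OF that] using comm[OF shift[OF that]] by (simp add: P0_def)
  qed blast
  let ?N = "ball x0 (min r \<delta>)"
  have sub: "x - x0 \<in> ball 0 \<delta>" "x - x0 \<in> ball 0 r" if "x \<in> ?N" for x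
    using that by (auto simp: dist_norm norm_minus_commute)
  define Z where "Z x = Y (x - x0)" for x
  have fdZ: "\<partial> Z x = \<partial> Y (x - x0)" if "x \<in> ?N" for x
    using frechet_derivative_shift[of Y "- x0" x] smooth_on_imp_differentiable[OF Y(2) sub(1)[OF that]]
    by (simp add: Z_def[abs_def])
  show thesis
  proof (rule that[of ?N Z])
    show "open ?N" "x0 \<in> ?N" using r Y(1) by auto
    show "?N \<subseteq> U" using r(2) N(3) by (meson min.cobounded1 order_trans subset_ball)
    show "smooth_on ?N Z"
      unfolding Z_def[abs_def]
      by (rule smooth_on_compose[OF open_ball open_ball smooth_on_diff[OF open_ball smooth_on_ident smooth_on_const] Y(2)])
        (use sub in auto)
    show "\<partial> Z x v = 0" if "x \<in> ?N" "v \<in> L x" for x v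
    proof -
      have "P0 (x - x0) v = v" using LP[of x v] that r(2) by (auto simp: P0_def)
      then show ?thesis using Y(3)[OF sub[OF that(1)], of v] fdZ[OF that(1)] by simp
    qed
    note fdZ0 = fdZ[of x0, simplified]
    show "v \<in> L x0" if "\<partial> Z x0 v = 0" for v
    proof -
      have 0: "0 \<in> ball 0 \<delta>" "0 \<in> ball (0::real^'n) r" using Y(1) r(1) by auto
      let ?D = "\<partial> Y 0"
      have D: "(Y has_derivative ?D) (at 0)" by (rule smooth_on_has_derivative[OF Y(2) 0(1)])
      have fd0: "\<partial> Z x0 = ?D" using fdZ[of x0] r Y(1) by simp
      \<comment> \<open>Splitting of \<open>v\<close> into a slice direction, which the derivative
        fixes, and \<open>\<pi> v\<close> in \<open>L x0\<close>, which it kills.\<close>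
      define w where "w = v - \<pi> v"
      have \<pi>w: "\<pi> w = 0" by (simp add: w_def linear_diff[OF lin\<pi>] \<pi>\<pi>)
      have "((\<lambda>t. Y (t *\<^sub>R w)) has_derivative (\<lambda>h. ?D (h *\<^sub>R w))) (at 0)"
        by (rule has_derivative_compose[of "\<lambda>t. t *\<^sub>R w" _ 0 UNIV Y]) (use D in \<open>auto intro!: derivative_eq_intros\<close>)
      moreover have "((\<lambda>t. Y (t *\<^sub>R w)) has_derivative (\<lambda>h. h *\<^sub>R w)) (at 0)"
      proof (rule has_derivative_transform_within_open[of "\<lambda>t. t *\<^sub>R w" _ 0 UNIV "(\<lambda>t. t *\<^sub>R w) -` ball 0 \<delta>"])
        show "open ((\<lambda>t. t *\<^sub>R w) -` ball 0 \<delta>)"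
          by (intro open_vimage continuous_intros) auto
        show "t *\<^sub>R w = Y (t *\<^sub>R w)" if "t \<in> (\<lambda>t. t *\<^sub>R w) -` ball 0 \<delta>" for t
          using Y(4)[of "t *\<^sub>R w"] that by (simp add: linear_scale[OF lin\<pi>] \<pi>w)
      qed (use Y(1) in \<open>auto intro!: derivative_eq_intros\<close>)
      ultimately have "(\<lambda>h. ?D (h *\<^sub>R w)) = (\<lambda>h. h *\<^sub>R w)" by (rule has_derivative_unique)
      then have "?D w = w" by (metis scaleR_one)
      moreover have "?D (\<pi> v) = 0"
      proof -
        have "P0 0 (\<pi> v) = \<pi> v" using LP[OF N(2) \<pi>L] by (simp add: P0_def)
        then show ?thesis using Y(3)[OF 0, of "\<pi> v"] by simp
      qed
      moreover have "?D v = ?D w + ?D (\<pi> v)"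
        by (simp add: w_def linear_diff[OF has_derivative_linear[OF D]])
      ultimately have "w = 0" using that fd0 by simp
      then show ?thesis using \<pi>L[of v] by (simp add: w_def)
    qed
  qed
qed

section \<open>Derived flags in chained coordinates\<close>

text \<open>Cartan's formula for the form df - g dh, whose exterior derivative is - dg \<and> dh, on
  two fields annihilated by the form near \<open>x\<close>. With constant \<open>g\<close> and
  \<open>h\<close> it shows that the kernel of df is involutive.\<close>

lemma contact_bracket:
  fixes f g h :: "'a::euclidean_space \<Rightarrow> real"
  assumes V: "open V" "x \<in> V" and sm: "smooth_on V f" "smooth_on V g" "smooth_on V h" "smooth_on V v" "smooth_on V w"
    and v: "\<And>y. y \<in> V \<Longrightarrow> \<partial> f y (v y) = g y * \<partial> h y (v y)"
    and w: "\<And>y. y \<in> V \<Longrightarrow> \<partial> f y (w y) = g y * \<partial> h y (w y)"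
  shows "\<partial> f x (lie_bracket v w x) - g x * \<partial> h x (lie_bracket v w x) =
    \<partial> g x (v x) * \<partial> h x (w x) -
    \<partial> g x (w x) * \<partial> h x (v x)"
proof -
  have *: "\<partial> (\<lambda>y. \<partial> f y (u y)) x t =
      g x * \<partial> (\<lambda>y. \<partial> h y (u y)) x t +
      \<partial> g x t * \<partial> h x (u x)"
    if u: "smooth_on V u" "\<And>y. y \<in> V \<Longrightarrow> \<partial> f y (u y) = g y * \<partial> h y (u y)" for u t
  proof -
    have "smooth_on V (\<lambda>y. \<partial> h y (u y))"
      by (rule smooth_on_frechet_derivative[OF V(1) sm(3) u(1)])
    from has_derivative_mult[OF smooth_on_has_derivative[OF sm(2) V(2)] smooth_on_has_derivative[OF this V(2)]]
    have "((\<lambda>y. \<partial> f y (u y)) has_derivative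
      (\<lambda>t. g x * \<partial> (\<lambda>y. \<partial> h y (u y)) x t +
        \<partial> g x t * \<partial> h x (u x))) (at x)"
      by (rule has_derivative_transform_within_open[OF _ V]) (simp add: u(2))
    then show ?thesis by (simp add: frechet_derivative_eqI)
  qed
  have v': "\<partial> (\<lambda>y. \<partial> f y (v y)) x t =
      g x * \<partial> (\<lambda>y. \<partial> h y (v y)) x t +
      \<partial> g x t * \<partial> h x (v x)" for t
    using *[OF sm(4)] v by blast
  have w': "\<partial> (\<lambda>y. \<partial> f y (w y)) x t =
      g x * \<partial> (\<lambda>y. \<partial> h y (w y)) x t +
      \<partial> g x t * \<partial> h x (w x)" for t
    using *[OF sm(5)] w by blast
  show ?thesis
    unfolding lie_bracket_derivation[OF V(1) sm(1) V(2) smooth_on_imp_differentiable[OF sm(4) V(2)] smooth_on_imp_differentiable[OF sm(5) V(2)]]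
      lie_bracket_derivation[OF V(1) sm(3) V(2) smooth_on_imp_differentiable[OF sm(4) V(2)] smooth_on_imp_differentiable[OF sm(5) V(2)]]
      v' w'
    by (simp add: algebra_simps)
qed

text \<open>The map is injective on the orthogonal complement of its kernel, and the image of that
  complement is the whole range.\<close>

lemma dim_kernel:
  fixes T :: "'a::euclidean_space \<Rightarrow> 'b::euclidean_space"
  assumes "linear T"
  shows "dim {v. T v = 0} + dim (range T) = DIM('a)"
proof -
  let ?K = "{v. T v = 0}"
  let ?O = "{y \<in> UNIV. \<forall>x\<in>?K. orthogonal x y}"
  have K: "subspace ?K" using assms by (rule linear_subspace_kernel)
  have O: "subspace ?O" using subspace_orthogonal_to_vectors[of ?K] by simp
  have "dim ?O + dim ?K = DIM('a)"
    using dim_subspace_orthogonal_to_vectors[OF K subspace_UNIV subset_UNIV] by simp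
  moreover have "dim (T ` ?O) = dim ?O"
  proof (rule dim_image_eq[OF assms])
    have "inj_on T ?O"
    proof (rule inj_onI)
      fix x y assume xy: "x \<in> ?O" "y \<in> ?O" "T x = T y"
      then have "x - y \<in> ?K" by (simp add: linear_diff[OF assms])
      moreover have "x - y \<in> ?O" using subspace_diff[OF O] xy by blast
      ultimately have "orthogonal (x - y) (x - y)" by blast
      then show "x = y" by (simp add: orthogonal_self)
    qed
    moreover have "span ?O = ?O" using O by (simp only: span_eq_iff)
    ultimately show "inj_on T (span ?O)" by (simp only:)
  qed
  moreover have "T ` ?O = range T"
  proof -
    have "T v \<in> T ` ?O" for v
    proof -
      obtain y z where yz: "y \<in> span ?K" "\<And>w. w \<in> span ?K \<Longrightarrow> orthogonal z w" "v = y + z"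
        using orthogonal_subspace_decomp_exists by metis
      moreover have "span ?K = ?K" using K by (simp only: span_eq_iff)
      ultimately have "T y = 0" by blast
      moreover have "z \<in> ?O" using yz(2) by (auto simp: orthogonal_commute intro: span_base)
      ultimately show ?thesis using yz(3) by (auto simp: linear_add[OF assms])
    qed
    then show ?thesis by auto
  qed
  ultimately show ?thesis by simp
qed

lemma smooth_lie_bracket:
  fixes v w :: "'a::euclidean_space \<Rightarrow> 'a"
  assumes "open V" "smooth_on V v" "smooth_on V w"
  shows "smooth_on V (lie_bracket v w)"
  unfolding lie_bracket_def[abs_def]
  by (intro smooth_on_diff smooth_on_frechet_derivative assms)

lemma derived_subset: "D x \<subseteq> derived D x"
  unfolding derived_def using span_superset by blast

lemma derived_bracket: "x \<in> V \<Longrightarrow> section_on V D v \<Longrightarrow> section_on V D w \<Longrightarrow> lie_bracket v w x \<in> derived D x"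
  unfolding derived_def by (rule span_base) blast

lemma section_on_subset: "section_on V D v \<Longrightarrow> open W \<Longrightarrow> W \<subseteq> V \<Longrightarrow> section_on W D v"
  unfolding section_on_def using smooth_on_subset by blast

lemma subspace_derived_flag:
  assumes "\<And>x. subspace (D x)"
  shows "subspace (derived_flag D i x)"
  using assms by (cases i) (simp_all add: derived_flag_def derived_def)

lemma derived_flag_Suc: "derived_flag D (Suc i) = derived (derived_flag D i)"
  by (simp add: derived_flag_def)

lemma derived_flag_0: "derived_flag D 0 = D"
  by (simp add: derived_flag_def)

lemma vec_eqI_bij:
  assumes "bij_betw c I UNIV" "\<And>i. i \<in> I \<Longrightarrow> v $ c i = w $ c i"
  shows "v = w"
  using assms unfolding bij_betw_def vec_eq_iff by (metis UNIV_I imageE)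

section \<open>Chained coordinates, their frame and their contact distributions\<close>

locale chained_coordinates =
  fixes U :: "(real^'n) set" and k :: nat and c :: "('m::finite \<times> nat) option \<Rightarrow> 'n" and \<phi> :: "real^'n \<Rightarrow> real^'n"
  assumes openU: "open U" and smooth\<phi>: "smooth_on U \<phi>"
    and c: "bij_betw c (insert None (Some ` (UNIV \<times> {1..k}))) UNIV"
    and bij\<phi>: "\<And>x. x \<in> U \<Longrightarrow> bij (\<partial> \<phi> x)"
    and k2: "k \<ge> 2"
begin

definition z0 :: "real^'n \<Rightarrow> real" where "z0 x = \<phi> x $ c None"
definition z :: "'m \<Rightarrow> nat \<Rightarrow> real^'n \<Rightarrow> real" where "z q l x = \<phi> x $ c (Some (q, l))"
definition dz0 :: "real^'n \<Rightarrow> real^'n \<Rightarrow> real" where "dz0 x v = \<partial> \<phi> x v $ c None"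
definition dz :: "'m \<Rightarrow> nat \<Rightarrow> real^'n \<Rightarrow> real^'n \<Rightarrow> real" where
  "dz q l x v = \<partial> \<phi> x v $ c (Some (q, l))"

text \<open>Each bracket costs one contact form, whence the bound \<open>k - 1 - i\<close>; at
  \<open>i = k - 1\<close> the index range is empty and the distribution is the whole space.\<close>

definition contact :: "nat \<Rightarrow> (real^'n) distribution" where
  "contact i x = {v. \<forall>q. \<forall>l\<in>{1..k - 1 - i}. dz q l x v = z q (l + 1) x * dz0 x v}"

definition lift :: "(real^'n \<Rightarrow> real^'n) \<Rightarrow> real^'n \<Rightarrow> real^'n" where
  "lift t x = matrix_inv (matrix (\<partial> \<phi> x)) *v t x"

definition coord_vec :: "real \<Rightarrow> ('m \<Rightarrow> nat \<Rightarrow> real) \<Rightarrow> real^'n" where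
  "coord_vec a b = (\<chi> j. case inv_into (insert None (Some ` (UNIV \<times> {1..k}))) c j of None \<Rightarrow> a | Some (q, l) \<Rightarrow> b q l)"

text \<open>The coordinate field of the function \<open>z q l\<close>, expressed in the original
  space.\<close>

definition E :: "'m \<Rightarrow> nat \<Rightarrow> real^'n \<Rightarrow> real^'n" where
  "E q l = lift (\<lambda>x. coord_vec 0 (\<lambda>q' l'. if q' = q \<and> l' = l then 1 else 0))"

text \<open>The chained-form control field d/dz0 + sum of z^(l+1) d/dz^l over l < k; it lies in
  every contact distribution and is transversal to the kernel of dz0.\<close>

definition G0 :: "real^'n \<Rightarrow> real^'n" where
  "G0 = lift (\<lambda>x. coord_vec 1 (\<lambda>q l. if l < k then z q (l + 1) x else 0))"

lemma coord_vec: "coord_vec a b $ c None = a" "l \<in> {1..k} \<Longrightarrow> coord_vec a b $ c (Some (q, l)) = b q l"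
proof -
  have inj: "inj_on c (insert None (Some ` (UNIV \<times> {1..k})))" using c by (simp add: bij_betw_def)
  show "coord_vec a b $ c None = a"
    using inv_into_f_f[OF inj, of None] by (simp add: coord_vec_def)
  show "coord_vec a b $ c (Some (q, l)) = b q l" if "l \<in> {1..k}"
    using inv_into_f_f[OF inj, of "Some (q, l)"] that by (simp add: coord_vec_def)
qed

lemma vec_eqI:
  assumes "v $ c None = w $ c None" "\<And>q l. l \<in> {1..k} \<Longrightarrow> v $ c (Some (q, l)) = w $ c (Some (q, l))"
  shows "v = w"
  by (rule vec_eqI_bij[OF c]) (use assms in auto)

lemma diff\<phi>: "x \<in> U \<Longrightarrow> \<phi> differentiable (at x)"
  by (rule smooth_on_imp_differentiable[OF smooth\<phi>])

lemma linear\<phi>: "x \<in> U \<Longrightarrow> linear (\<partial> \<phi> x)"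
  by (rule linear_frechet_derivative[OF diff\<phi>])

lemma coord_eqI:
  assumes "x \<in> U" "dz0 x v = dz0 x w" "\<And>q l. l \<in> {1..k} \<Longrightarrow> dz q l x v = dz q l x w"
  shows "v = w"
proof -
  have "\<partial> \<phi> x v = \<partial> \<phi> x w"
    by (rule vec_eqI) (use assms in \<open>simp_all add: dz0_def dz_def\<close>)
  then show ?thesis using bij_is_inj[OF bij\<phi>[OF assms(1)]] by (simp add: inj_eq)
qed

lemma linear_dz: "x \<in> U \<Longrightarrow> linear (dz0 x)" "x \<in> U \<Longrightarrow> linear (dz q l x)"
  unfolding dz0_def[abs_def] dz_def[abs_def]
  using linear_compose[OF linear\<phi> bounded_linear.linear[OF bounded_linear_vec_nth]] by (simp_all add: o_def)

lemma dz_linear: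
  assumes "x \<in> U"
  shows "dz0 x 0 = 0" "dz q l x 0 = 0" "dz0 x (a + b) = dz0 x a + dz0 x b" "dz q l x (a + b) = dz q l x a + dz q l x b"
    "dz0 x (a - b) = dz0 x a - dz0 x b" "dz q l x (a - b) = dz q l x a - dz q l x b"
    "dz0 x (r *\<^sub>R a) = r * dz0 x a" "dz q l x (r *\<^sub>R a) = r * dz q l x a"
    "dz0 x (\<Sum>i\<in>I. t i) = (\<Sum>i\<in>I. dz0 x (t i))" "dz q l x (\<Sum>i\<in>I. t i) = (\<Sum>i\<in>I. dz q l x (t i))"
proof -
  note L = linear_dz[OF assms]
  show "dz0 x 0 = 0" "dz q l x 0 = 0" "dz0 x (a + b) = dz0 x a + dz0 x b" "dz q l x (a + b) = dz q l x a + dz q l x b"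
    "dz0 x (a - b) = dz0 x a - dz0 x b" "dz q l x (a - b) = dz q l x a - dz q l x b"
    "dz0 x (r *\<^sub>R a) = r * dz0 x a" "dz q l x (r *\<^sub>R a) = r * dz q l x a"
    "dz0 x (\<Sum>i\<in>I. t i) = (\<Sum>i\<in>I. dz0 x (t i))" "dz q l x (\<Sum>i\<in>I. t i) = (\<Sum>i\<in>I. dz q l x (t i))"
    by (simp_all add: L[THEN linear_0] L[THEN linear_add] L[THEN linear_diff] L[THEN linear_scale] L[THEN linear_sum])
qed

lemma smooth_z: "smooth_on U z0" "smooth_on U (z q l)"
  unfolding z0_def[abs_def] z_def[abs_def] by (intro smooth_on_nth openU smooth\<phi>)+

lemma dz_eq: "x \<in> U \<Longrightarrow> \<partial> z0 x v = dz0 x v" "x \<in> U \<Longrightarrow> \<partial> (z q l) x v = dz q l x v"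
  unfolding z0_def[abs_def] z_def[abs_def] dz0_def dz_def
  by (simp_all add: frechet_derivative_bounded_linear[OF bounded_linear_vec_nth diff\<phi>])

lemma matrix\<phi>: "x \<in> U \<Longrightarrow> matrix (\<partial> \<phi> x) *v v = \<partial> \<phi> x v"
  using linear\<phi> by (simp add: matrix_works)

lemma invertible\<phi>: "x \<in> U \<Longrightarrow> invertible (matrix (\<partial> \<phi> x))"
  using bij_is_inj[OF bij\<phi>] by (simp add: invertible_left_inverse matrix_left_invertible_injective matrix\<phi> inj_def)

lemma lift: "x \<in> U \<Longrightarrow> \<partial> \<phi> x (lift t x) = t x"
  using matrix_inv_mult(1)[OF invertible\<phi>, of x "t x"] matrix\<phi> by (simp add: lift_def)

lemma smooth_lift:
  assumes "V \<subseteq> U" "open V" "smooth_on V t"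
  shows "smooth_on V (lift t)"
  unfolding lift_def[abs_def]
proof (rule smooth_on_matrix_inv_mult[OF assms(2)])
  show "smooth_on V (\<lambda>x. matrix (\<partial> \<phi> x) $ i $ j)" for i j
    unfolding matrix_def using assms(1) smooth_on_subset[OF smooth\<phi>]
    by (simp, intro smooth_on_nth smooth_on_frechet_derivative assms(2)) simp_all
  show "smooth_on V (\<lambda>x. t x $ i)" for i by (rule smooth_on_nth[OF assms(2,3)])
qed (use assms invertible\<phi> in auto)

lemma smooth_coord_vec:
  assumes "open V" "smooth_on V a" "\<And>q l. smooth_on V (b q l)"
  shows "smooth_on V (\<lambda>x. coord_vec (a x) (\<lambda>q l. b q l x))"
  unfolding coord_vec_def
proof (rule smooth_on_vec[OF assms(1)])
  show "smooth_on V (\<lambda>x. case inv_into (insert None (Some ` (UNIV \<times> {1..k}))) c i of None \<Rightarrow> a x | Some (q, l) \<Rightarrow> b q l x)" for i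
    using assms(2,3) by (cases "inv_into (insert None (Some ` (UNIV \<times> {1..k}))) c i") (auto split: prod.splits)
qed

lemma smooth_E: "smooth_on U (E q l)"
  unfolding E_def by (rule smooth_lift[OF _ openU smooth_on_const]) simp

lemma smooth_G0: "smooth_on U G0"
  unfolding G0_def
proof (rule smooth_lift[OF _ openU smooth_coord_vec[OF openU]])
  show "smooth_on U (\<lambda>x. if l < k then z q (l + 1) x else 0)" for q l
    by (cases "l < k") (simp_all add: smooth_z)
qed auto

lemma dz_E: "x \<in> U \<Longrightarrow> dz0 x (E q l x) = 0"
  "x \<in> U \<Longrightarrow> l' \<in> {1..k} \<Longrightarrow> dz q' l' x (E q l x) = (if q' = q \<and> l' = l then 1 else 0)"
  by (simp_all add: dz0_def dz_def E_def lift coord_vec)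

lemma dz_G0: "x \<in> U \<Longrightarrow> dz0 x (G0 x) = 1"
  "x \<in> U \<Longrightarrow> l \<in> {1..k} \<Longrightarrow> dz q l x (G0 x) = (if l < k then z q (l + 1) x else 0)"
  by (simp_all add: dz0_def dz_def G0_def lift coord_vec)

lemma subspace_contact: "x \<in> U \<Longrightarrow> subspace (contact i x)"
  unfolding contact_def subspace_def
  by (auto simp: dz_linear algebra_simps)

lemma contact_mono: "i \<le> j \<Longrightarrow> contact i x \<subseteq> contact j x"
  by (auto simp: contact_def)

lemma G0_contact: "x \<in> U \<Longrightarrow> G0 x \<in> contact i x"
  by (auto simp: contact_def dz_G0)

lemma E_contact: "x \<in> U \<Longrightarrow> k - 1 - i < l \<Longrightarrow> E q l x \<in> contact i x"
  by (auto simp: contact_def dz_E)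

lemma contact_form_bracket:
  assumes "x \<in> V" "open V" "V \<subseteq> U" "smooth_on V v" "smooth_on V w"
    and "\<And>y. y \<in> V \<Longrightarrow> dz q l y (v y) = z q (l + 1) y * dz0 y (v y)"
    and "\<And>y. y \<in> V \<Longrightarrow> dz q l y (w y) = z q (l + 1) y * dz0 y (w y)"
  shows "dz q l x (lie_bracket v w x) - z q (l + 1) x * dz0 x (lie_bracket v w x) =
    dz q (l + 1) x (v x) * dz0 x (w x) - dz q (l + 1) x (w x) * dz0 x (v x)"
proof -
  have U: "y \<in> U" if "y \<in> V" for y using that assms(3) by auto
  have sm: "smooth_on V (z q l)" "smooth_on V (z q (l + 1))" "smooth_on V z0"
    using smooth_z smooth_on_subset assms(3) by blast+
  show ?thesis
    using contact_bracket[OF assms(2,1) sm assms(4,5)] assms(1,6,7) dz_eq[OF U]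
    by (simp add: U)
qed

section \<open>The derived flag of the contact distribution\<close>

text \<open>If the fields also satisfy the next contact relation, both products on the right of the
  bracket identity equal z^(l+2) dz0(v) dz0(w) and cancel; so at most the last relation is lost. It
  is lost, because the brackets of \<open>E q (l0 + 1)\<close> with \<open>G0\<close> take
  independent values on the last form.\<close>

lemma derived_contact:
  assumes i: "i + 1 \<le> k - 1" and D: "\<And>y. y \<in> U \<Longrightarrow> D y = contact i y" and x: "x \<in> U"
  shows "derived D x = contact (i + 1) x"
proof
  have sub: "D x \<subseteq> contact (i + 1) x" using D[OF x] contact_mono[of i "i + 1"] by auto
  have br: "lie_bracket v w x \<in> contact (i + 1) x" if "x \<in> V" "section_on V D v" "section_on V D w" for v w V
  proof -
    let ?V = "V \<inter> U"
    have V: "x \<in> ?V" "open ?V" "?V \<subseteq> U" using that x openU by (auto simp: section_on_def)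
    have sm: "smooth_on ?V v" "smooth_on ?V w" using that smooth_on_subset[OF _ Int_lower1] by (auto simp: section_on_def)
    have vD: "v y \<in> contact i y" "w y \<in> contact i y" if "y \<in> ?V" for y
      using that \<open>section_on V D v\<close> \<open>section_on V D w\<close> D by (auto simp: section_on_def)
    show ?thesis
      unfolding contact_def
    proof safe
      fix q l assume l: "l \<in> {1..k - 1 - (i + 1)}"
      then have l1: "l \<in> {1..k - 1 - i}" "l + 1 \<in> {1..k - 1 - i}" by auto
      have "dz q l x (lie_bracket v w x) - z q (l + 1) x * dz0 x (lie_bracket v w x) =
          dz q (l + 1) x (v x) * dz0 x (w x) - dz q (l + 1) x (w x) * dz0 x (v x)"
        by (rule contact_form_bracket[OF V sm]) (use vD l1(1) in \<open>auto simp: contact_def\<close>)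
      also have "\<dots> = 0"
        using vD[OF V(1)] l1(2) by (auto simp: contact_def)
      finally show "dz q l x (lie_bracket v w x) = z q (l + 1) x * dz0 x (lie_bracket v w x)" by simp
    qed
  qed
  show "derived D x \<subseteq> contact (i + 1) x"
    unfolding derived_def by (rule span_minimal[OF _ subspace_contact[OF x]]) (use sub br in auto)
  show "contact (i + 1) x \<subseteq> derived D x"
  proof
    fix u assume u: "u \<in> contact (i + 1) x"
    \<comment> \<open>Index of the last form that annihilates \<open>contact i\<close>, the one to
      be given up.\<close>
    define l0 where "l0 = k - 1 - i"
    have l0: "1 \<le> l0" "l0 + 1 \<le> k" "k - 1 - (i + 1) = l0 - 1" using i k2 by (auto simp: l0_def)
    define b where "b q = lie_bracket (E q (l0 + 1)) G0 x" for q
    \<comment> \<open>The values on \<open>u\<close> of the form given up; subtracting these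
      multiples of the brackets brings \<open>u\<close> back into \<open>contact i\<close>.\<close>
    define a where "a q = dz q l0 x u - z q (l0 + 1) x * dz0 x u" for q
    have sec: "section_on U D (E q (l0 + 1))" "section_on U D G0" for q
      using openU smooth_E smooth_G0 D E_contact[of _ i "l0 + 1"] G0_contact[of _ i] by (auto simp: section_on_def l0_def)
    have bd: "b q \<in> derived D x" for q
      unfolding b_def by (rule derived_bracket[OF x sec])
    have form: "dz q' l x (b q) - z q' (l + 1) x * dz0 x (b q) = (if q' = q \<and> l = l0 then 1 else 0)"
      if "l \<in> {1..l0}" for q q' l
    proof -
      have "dz q' l x (b q) - z q' (l + 1) x * dz0 x (b q) =
          dz q' (l + 1) x (E q (l0 + 1) x) * dz0 x (G0 x) - dz q' (l + 1) x (G0 x) * dz0 x (E q (l0 + 1) x)"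
        unfolding b_def
        by (rule contact_form_bracket[OF x openU order_refl smooth_E smooth_G0])
          (use that l0 in \<open>auto simp: dz_E dz_G0\<close>)
      then show ?thesis using that l0 x by (auto simp: dz_E dz_G0)
    qed
    define s where "s = (\<Sum>q\<in>UNIV. a q *\<^sub>R b q)"
    have lin: "dz q' l x s - z q' (l + 1) x * dz0 x s = (\<Sum>q\<in>UNIV. a q * (dz q' l x (b q) - z q' (l + 1) x * dz0 x (b q)))" for q' l
      unfolding s_def
      by (simp add: dz_linear[OF x] sum_distrib_left sum_subtractf algebra_simps)
    have "u - s \<in> contact i x"
      unfolding contact_def
    proof safe
      fix q' l assume "l \<in> {1..k - 1 - i}"
      then have l: "l \<in> {1..l0}" by (simp add: l0_def)
      have "dz q' l x s - z q' (l + 1) x * dz0 x s = (\<Sum>q\<in>UNIV. if q = q' then if l = l0 then a q' else 0 else 0)"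
        unfolding lin using form[OF l] by (intro sum.cong) auto
      also have "\<dots> = dz q' l x u - z q' (l + 1) x * dz0 x u"
        using u l l0 by (auto simp: a_def contact_def)
      finally show "dz q' l x (u - s) = z q' (l + 1) x * dz0 x (u - s)"
        by (simp add: dz_linear[OF x] algebra_simps)
    qed
    then have "u - s \<in> derived D x" using D[OF x] derived_subset by blast
    moreover have "s \<in> derived D x"
      unfolding s_def using bd by (intro subspace_sum subspace_scale) (auto simp: derived_def)
    ultimately have "(u - s) + s \<in> derived D x"
      by (intro subspace_add) (auto simp: derived_def)
    then show "u \<in> derived D x" by simp
  qed
qed

lemma derived_flag_contact:
  assumes "\<And>y. y \<in> U \<Longrightarrow> D y = contact 0 y" "i \<le> k - 1" "x \<in> U"
  shows "derived_flag D i x = contact i x"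
  using assms(2,3)
proof (induction i arbitrary: x)
  case 0
  then show ?case using assms(1) by (simp add: derived_flag_0)
next
  case (Suc i)
  then show ?case
    using derived_contact[of i "derived_flag D i" x] by (simp add: derived_flag_Suc)
qed

lemma contact_last: "contact (k - 2) x = {v. \<forall>q. dz q 1 x v = z q 2 x * dz0 x v}"
proof -
  have "{1..k - 1 - (k - 2)} = {1}" using k2 by auto
  then show ?thesis by (simp add: contact_def numeral_2_eq_2)
qed

section \<open>Coordinate kernels and characteristic sections\<close>

text \<open>It has two uses: for \<open>i \<le> k - 2\<close> it contains the values of all
  characteristic sections of \<open>contact i\<close>, and for \<open>i = k - 1\<close> it is the
  involutive distribution that necessity exhibits as L.\<close>

definition ker_coords :: "nat \<Rightarrow> (real^'n) distribution" where
  "ker_coords i x = {v. dz0 x v = 0 \<and> (\<forall>q. \<forall>l\<in>{1..k - i}. dz q l x v = 0)}"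

lemma ker_coords_last: "ker_coords (k - Suc 0) x = {v. dz0 x v = 0 \<and> (\<forall>q. dz q (Suc 0) x v = 0)}"
proof -
  have "{1..k - (k - Suc 0)} = {1}" using k2 by auto
  then show ?thesis by (simp add: ker_coords_def)
qed

lemma ker_coords_expand:
  assumes x: "x \<in> U" and v: "v \<in> ker_coords i x"
  shows "v = (\<Sum>q\<in>UNIV. \<Sum>l\<in>{k - i + 1..k}. dz q l x v *\<^sub>R E q l x)" (is "v = ?s")
proof (rule coord_eqI[OF x])
  show "dz0 x v = dz0 x ?s"
    using v by (simp add: ker_coords_def dz_linear[OF x] dz_E x)
  fix q' l' assume l': "l' \<in> {1..k}"
  have "dz q' l' x ?s = (\<Sum>q\<in>UNIV. \<Sum>l\<in>{k - i + 1..k}. if q = q' then if l = l' then dz q' l' x v else 0 else 0)"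
    unfolding dz_linear[OF x]
    by (intro sum.cong) (use x l' in \<open>auto simp: dz_E\<close>)
  also have "\<dots> = (\<Sum>q\<in>UNIV. if q = q' then \<Sum>l\<in>{k - i + 1..k}. if l = l' then dz q' l' x v else 0 else 0)"
    by (intro sum.cong) auto
  also have "\<dots> = (if l' \<in> {k - i + 1..k} then dz q' l' x v else 0)" by simp
  also have "\<dots> = dz q' l' x v"
    using v l' by (auto simp: ker_coords_def)
  finally show "dz q' l' x v = dz q' l' x ?s" by simp
qed

text \<open>Testing against \<open>E q (l0 + 1)\<close> forces dz0 to vanish on the section, and
  testing against \<open>G0\<close> forces dz^(l0+1) to vanish; the contact relations then kill the
  lower dz^l. The bound on \<open>i\<close> ensures that a form with index \<open>l0\<close> is
  present.\<close>

lemma characteristic_section_ker_coords: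
  assumes D: "\<And>y. y \<in> U \<Longrightarrow> D y = contact i y" and i: "i + 2 \<le> k"
    and cc: "characteristic_section_on V D cc" "x \<in> V" "x \<in> U"
  shows "cc x \<in> ker_coords i x"
proof -
  let ?V = "V \<inter> U"
  define l0 where "l0 = k - 1 - i"
  have l0: "1 \<le> l0" "l0 + 1 \<le> k" "k - i = l0 + 1" using i by (auto simp: l0_def)
  have sec: "section_on V D cc" using cc(1) by (simp add: characteristic_section_on_def)
  have V: "open ?V" "?V \<subseteq> U" "smooth_on ?V cc"
    using sec openU smooth_on_subset[OF _ Int_lower1] by (auto simp: section_on_def)
  have cD: "cc y \<in> contact i y" if "y \<in> ?V" for y using sec D that by (auto simp: section_on_def)
  have br: "lie_bracket cc w y \<in> contact i y" if "section_on ?V D w" "y \<in> ?V" for w y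
  proof -
    have "lie_bracket cc w y \<in> D y"
      using cc(1) that unfolding characteristic_section_on_def by blast
    then show ?thesis using that D by auto
  qed
  have form: "dz q (l0 + 1) y (cc y) * dz0 y (w y) = dz q (l0 + 1) y (w y) * dz0 y (cc y)"
    if w: "section_on ?V D w" "y \<in> ?V" for w y q
  proof -
    have wD: "w y \<in> contact i y" if "y \<in> ?V" for y using w(1) D that by (auto simp: section_on_def)
    have "dz q l0 y (lie_bracket cc w y) - z q (l0 + 1) y * dz0 y (lie_bracket cc w y) =
      dz q (l0 + 1) y (cc y) * dz0 y (w y) - dz q (l0 + 1) y (w y) * dz0 y (cc y)"
      by (rule contact_form_bracket[OF w(2) V]) (use w(1) wD cD l0 in \<open>auto simp: section_on_def contact_def l0_def\<close>)
    moreover have "dz q l0 y (lie_bracket cc w y) - z q (l0 + 1) y * dz0 y (lie_bracket cc w y) = 0"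
      using br[OF w] l0 by (auto simp: contact_def l0_def)
    ultimately show ?thesis by simp
  qed
  have secE: "section_on ?V D (E q (l0 + 1))" and secG: "section_on ?V D G0" for q
    using V(1) smooth_on_subset[OF smooth_E V(2)] smooth_on_subset[OF smooth_G0 V(2)] D
      E_contact[of _ i "l0 + 1"] G0_contact[of _ i]
    by (auto simp: section_on_def l0_def)
  have x: "x \<in> ?V" using cc by simp
  \<comment> \<open>Any index does for this test; \<open>undefined\<close> picks one from the
    nonempty type.\<close>
  have a: "dz0 x (cc x) = 0"
    using form[OF secE x, of undefined undefined] l0 cc(3) by (simp add: dz_E)
  moreover have "dz q l x (cc x) = 0" if "l \<in> {1..k - i}" for q l
  proof (cases "l = l0 + 1")
    case True
    then show ?thesis using form[OF secG x, of q] a cc(3) by (simp add: dz_G0)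
  next
    case False
    then have "l \<in> {1..k - 1 - i}" using that l0 by auto
    then show ?thesis using cD[OF x] a by (auto simp: contact_def)
  qed
  ultimately show ?thesis by (auto simp: ker_coords_def)
qed

text \<open>The field is killed by dz0 and by every dz^(l'+1) that enters the bracket identity for
  \<open>contact i\<close>, because l' + 1 \<le> k - i < l.\<close>

lemma characteristic_section_E:
  assumes D: "\<And>y. y \<in> U \<Longrightarrow> D y = contact i y" and l: "k - i < l" and i: "i + 1 \<le> k"
  shows "characteristic_section_on U D (E q l)"
  unfolding characteristic_section_on_def
proof (intro conjI allI impI ballI)
  show "section_on U D (E q l)"
    using openU smooth_E D E_contact[of _ i l] l by (auto simp: section_on_def)
  fix W d x assume W: "W \<subseteq> U \<and> section_on W D d" "x \<in> W"
  then have x: "x \<in> U" and op: "open W" and WU: "W \<subseteq> U" and smd: "smooth_on W d" by (auto simp: section_on_def)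
  have dD: "d y \<in> contact i y" if "y \<in> W" for y using W that D[of y] by (auto simp: section_on_def)
  show "lie_bracket (E q l) d x \<in> D x"
    unfolding D[OF x] contact_def
  proof safe
    fix q' l' assume l': "l' \<in> {1..k - 1 - i}"
    have "dz q' l' x (lie_bracket (E q l) d x) - z q' (l' + 1) x * dz0 x (lie_bracket (E q l) d x) =
      dz q' (l' + 1) x (E q l x) * dz0 x (d x) - dz q' (l' + 1) x (d x) * dz0 x (E q l x)"
      by (rule contact_form_bracket[OF W(2) op WU smooth_on_subset[OF smooth_E WU] smd])
        (use dD l' l WU i in \<open>auto simp: contact_def dz_E subset_iff\<close>)
    also have "\<dots> = 0" using l' l i x by (auto simp: dz_E)
    finally show "dz q' l' x (lie_bracket (E q l) d x) = z q' (l' + 1) x * dz0 x (lie_bracket (E q l) d x)" by simp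
  qed
qed

text \<open>The value of the contact form \<open>\<omega>\<^sup>l\<close> on the drift, which feedback does not change.\<close>

definition drift :: "(real^'n \<Rightarrow> real^'n) \<Rightarrow> 'm \<Rightarrow> nat \<Rightarrow> real^'n \<Rightarrow> real" where
  "drift f q l x = dz q l x (f x) - z q (l + 1) x * dz0 x (f x)"

section \<open>Brackets with the drift and the compatibility condition\<close>

lemma smooth_dz:
  assumes "V \<subseteq> U" "open V" "smooth_on V f"
  shows "smooth_on V (\<lambda>x. dz0 x (f x))" "smooth_on V (\<lambda>x. dz q l x (f x))"
  unfolding dz0_def dz_def
  by (intro smooth_on_nth smooth_on_frechet_derivative assms smooth_on_subset[OF smooth\<phi> assms(1)])+

lemma smooth_drift:
  assumes "smooth_on U f"
  shows "smooth_on U (drift f q l)"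
  unfolding drift_def[abs_def]
  by (intro smooth_on_diff smooth_on_mult openU smooth_z smooth_dz assms order_refl)

text \<open>As dz0 and dz^l vanish along \<open>w\<close>, one term of each commutator drops out and
  the derivatives of dz^l(f) and dz0(f) along \<open>w\<close> remain. Differentiating the factor
  z^(l+1) contributes a multiple of dz^(l+1)(w), which is 0 at \<open>x\<close>.\<close>

lemma drift_bracket:
  assumes f: "smooth_on U f" and V: "x \<in> V" "open V" "V \<subseteq> U" "smooth_on V w"
    and w: "\<And>y. y \<in> V \<Longrightarrow> dz0 y (w y) = 0" "\<And>y. y \<in> V \<Longrightarrow> dz q l y (w y) = 0" "dz q (l + 1) x (w x) = 0"
  shows "dz q l x (lie_bracket f w x) - z q (l + 1) x * dz0 x (lie_bracket f w x) =
    - \<partial> (drift f q l) x (w x)"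
proof -
  have x: "x \<in> U" and U: "\<And>y. y \<in> V \<Longrightarrow> y \<in> U" using V by auto
  note df = smooth_on_imp_differentiable[OF f x] and dw = smooth_on_imp_differentiable[OF V(4,1)]
  have zero: "\<partial> (\<lambda>y. \<partial> \<zeta> y (w y)) x u = 0"
    if "\<And>y. y \<in> V \<Longrightarrow> \<partial> \<zeta> y (w y) = 0" for \<zeta> :: "real^'n \<Rightarrow> real" and u
  proof -
    have "((\<lambda>y. \<partial> \<zeta> y (w y)) has_derivative (\<lambda>u. 0)) (at x)"
      by (rule has_derivative_transform_within_open[OF has_derivative_const V(2,1)]) (simp add: that)
    then show ?thesis by (simp add: frechet_derivative_eqI)
  qed
  have tr: "\<partial> (\<lambda>y. \<partial> z0 y (f y)) x = \<partial> (\<lambda>y. dz0 y (f y)) x"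
    "\<partial> (\<lambda>y. \<partial> (z q l) y (f y)) x = \<partial> (\<lambda>y. dz q l y (f y)) x"
    using smooth_on_imp_differentiable[OF smooth_dz(1)[OF order_refl openU f] x]
      smooth_on_imp_differentiable[OF smooth_dz(2)[OF order_refl openU f] x]
    by (intro frechet_derivative_transform_within_open[symmetric, OF _ openU x], simp_all add: dz_eq)+
  have 1: "dz0 x (lie_bracket f w x) = - \<partial> (\<lambda>y. dz0 y (f y)) x (w x)"
    using lie_bracket_derivation[OF openU smooth_z(1) x df dw] zero[of z0] w(1) U
    by (simp add: dz_eq x tr)
  have 2: "dz q l x (lie_bracket f w x) = - \<partial> (\<lambda>y. dz q l y (f y)) x (w x)"
    using lie_bracket_derivation[OF openU smooth_z(2) x df dw, of q l] zero[of "z q l"] w(2) U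
    by (simp add: dz_eq x tr)
  have "(drift f q l has_derivative (\<lambda>u. \<partial> (\<lambda>y. dz q l y (f y)) x u -
     (z q (l + 1) x * \<partial> (\<lambda>y. dz0 y (f y)) x u + \<partial> (z q (l + 1)) x u * dz0 x (f x)))) (at x)"
    unfolding drift_def[abs_def]
    by (intro has_derivative_diff has_derivative_mult smooth_on_has_derivative[OF smooth_dz(1)[OF order_refl openU f] x]
        smooth_on_has_derivative[OF smooth_dz(2)[OF order_refl openU f] x] smooth_on_has_derivative[OF smooth_z(2) x])
  note 3 = frechet_derivative_eqI[OF this]
  show ?thesis unfolding 1 2 3 using w(3) by (simp add: dz_eq x)
qed

text \<open>The fields \<open>E q' l'\<close> with l' > l + 1 are characteristic for the flag of
  index k - 1 - l and span the kernel; the last form of that flag is evaluated on their brackets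
  with \<open>f\<close>.\<close>

lemma drift_of_compatible:
  assumes f: "smooth_on U f" and D: "\<And>i y. i \<le> k - 1 \<Longrightarrow> y \<in> U \<Longrightarrow> D i y = contact i y"
    and comp: "\<And>i. i \<in> {1..k - 2} \<Longrightarrow> field_bracket_subset_on U f (characteristic_distribution (D i)) (D i)"
    and l: "l \<in> {1..k - 1}" and x: "x \<in> U" and v: "v \<in> ker_coords (k - 1 - l) x"
  shows "\<partial> (drift f q l) x v = 0"
proof -
  \<comment> \<open>For \<open>l = k - 1\<close> this is 0 and the kernel is spanned by an empty
    family; the other \<open>l\<close> give exactly the indices 1 to k - 2 of the compatibility
    condition.\<close>
  define i where "i = k - 1 - l"
  have lin: "linear (\<partial> (drift f q l) x)"
    by (rule linear_frechet_derivative[OF smooth_on_imp_differentiable[OF smooth_drift[OF f] x]])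
  have E0: "\<partial> (drift f q l) x (E q' l' x) = 0" if l': "l' \<in> {k - i + 1..k}" for q' l'
  proof -
    have i: "i \<in> {1..k - 2}" "k - 1 - i = l" "k - i = l + 1" using l' l k2 by (auto simp: i_def)
    then have Di: "D i y = contact i y" if "y \<in> U" for y using D[of i] that by auto
    have "characteristic_section_on U (D i) (E q' l')"
      by (rule characteristic_section_E[OF Di]) (use l' i l in auto)
    then have "section_on U (characteristic_distribution (D i)) (E q' l')"
      using openU smooth_E unfolding section_on_def characteristic_distribution_def by blast
    then have "lie_bracket f (E q' l') x \<in> contact i x"
      using comp[OF i(1)] x Di[OF x] unfolding field_bracket_subset_on_def by blast
    then have "dz q l x (lie_bracket f (E q' l') x) - z q (l + 1) x * dz0 x (lie_bracket f (E q' l') x) = 0"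
      using l i by (auto simp: contact_def)
    moreover have "dz q l x (lie_bracket f (E q' l') x) - z q (l + 1) x * dz0 x (lie_bracket f (E q' l') x) =
        - \<partial> (drift f q l) x (E q' l' x)"
      by (rule drift_bracket[OF f x openU order_refl smooth_E]) (use l l' i x in \<open>auto simp: dz_E\<close>)
    ultimately show ?thesis by simp
  qed
  have "v = (\<Sum>q\<in>UNIV. \<Sum>l\<in>{k - i + 1..k}. dz q l x v *\<^sub>R E q l x)"
    using ker_coords_expand[OF x v] by (simp add: i_def)
  also have "\<partial> (drift f q l) x \<dots> = 0"
    by (simp add: linear_sum[OF lin] linear_scale[OF lin] E0)
  finally show ?thesis .
qed

text \<open>A section of the characteristic distribution need not itself be given as a
  characteristic section, but each of its values is a value of one and so lies in the coordinate
  kernel.\<close>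

lemma compatible_of_drift:
  assumes f: "smooth_on U f" and D: "\<And>y. y \<in> U \<Longrightarrow> D y = contact i y" and i: "i \<in> {1..k - 2}"
    and dr: "\<And>x q l v. x \<in> U \<Longrightarrow> l \<in> {1..k - 1} \<Longrightarrow> v \<in> ker_coords (k - 1 - l) x \<Longrightarrow> \<partial> (drift f q l) x v = 0"
  shows "field_bracket_subset_on U f (characteristic_distribution D) D"
  unfolding field_bracket_subset_on_def
proof (intro allI impI ballI)
  fix V w x assume V: "V \<subseteq> U \<and> section_on V (characteristic_distribution D) w" "x \<in> V"
  then have x: "x \<in> U" and op: "open V" and VU: "V \<subseteq> U" and smw: "smooth_on V w" by (auto simp: section_on_def)
  have wK: "w y \<in> ker_coords i y" if "y \<in> V" for y
  proof -
    have "w y \<in> characteristic_distribution D y" using V that by (simp add: section_on_def)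
    then obtain c' W where c': "w y = c' y" "y \<in> W" "characteristic_section_on W D c'"
      unfolding characteristic_distribution_def by auto
    have "c' y \<in> ker_coords i y"
      by (rule characteristic_section_ker_coords[OF D _ c'(3,2)]) (use i k2 that VU in auto)
    then show ?thesis using c'(1) by simp
  qed
  show "lie_bracket f w x \<in> D x"
    unfolding D[OF x] contact_def
  proof safe
    fix q l assume l: "l \<in> {1..k - 1 - i}"
    have li: "l + 1 \<in> {1..k - i}" "l \<in> {1..k - i}" "l \<in> {1..k - 1}" using l i by auto
    \<comment> \<open>Here l + 1 \<le> k - i, so \<open>ker_coords i\<close> is the smaller of the
      two kernels.\<close>
    have "w x \<in> ker_coords (k - 1 - l) x" using wK[OF V(2)] l i by (auto simp: ker_coords_def)
    then have "\<partial> (drift f q l) x (w x) = 0" using dr x li by blast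
    moreover have "dz q l x (lie_bracket f w x) - z q (l + 1) x * dz0 x (lie_bracket f w x) =
        - \<partial> (drift f q l) x (w x)"
      by (rule drift_bracket[OF f V(2) op VU smw]) (use wK V(2) li in \<open>auto simp: ker_coords_def\<close>)
    ultimately show "dz q l x (lie_bracket f w x) = z q (l + 1) x * dz0 x (lie_bracket f w x)" by simp
  qed
qed

section \<open>The involutive subdistribution of corank one\<close>

lemma involutive_ker_coords: "involutive_on U (ker_coords (k - 1))"
  unfolding involutive_on_def
proof (intro allI impI ballI)
  fix V v w x
  assume V: "V \<subseteq> U \<and> section_on V (ker_coords (k - 1)) v \<and> section_on V (ker_coords (k - 1)) w" "x \<in> V"
  then have x: "x \<in> U" and op: "open V" and VU: "V \<subseteq> U" and sm: "smooth_on V v" "smooth_on V w" by (auto simp: section_on_def)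
  have vw: "v y \<in> ker_coords (k - 1) y" "w y \<in> ker_coords (k - 1) y" if "y \<in> V" for y
    using V that by (auto simp: section_on_def)
  \<comment> \<open>The bracket identity with zero functions for \<open>g\<close> and
    \<open>h\<close>: the kernel of an exact form is closed under brackets.\<close>
  have zero: "\<partial> \<zeta> x (lie_bracket v w x) = 0"
    if "smooth_on U \<zeta>" "\<And>y. y \<in> V \<Longrightarrow> \<partial> \<zeta> y (v y) = 0" "\<And>y. y \<in> V \<Longrightarrow> \<partial> \<zeta> y (w y) = 0"
    for \<zeta> :: "real^'n \<Rightarrow> real"
    using contact_bracket[OF op V(2) smooth_on_subset[OF that(1) VU] smooth_on_const smooth_on_const sm, of 0 0] that(2,3)
    by simp
  have U: "y \<in> U" if "y \<in> V" for y using that VU by auto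
  have "dz0 x (lie_bracket v w x) = 0"
    using zero[OF smooth_z(1)] vw U x by (simp add: dz_eq ker_coords_last)
  moreover have "dz q 1 x (lie_bracket v w x) = 0" for q
    using zero[OF smooth_z(2), of q 1] vw U x by (simp add: dz_eq ker_coords_last)
  ultimately show "lie_bracket v w x \<in> ker_coords (k - 1) x" by (simp add: ker_coords_last)
qed

lemma subspace_ker_coords: "x \<in> U \<Longrightarrow> subspace (ker_coords i x)"
  unfolding ker_coords_def subspace_def
  by (auto simp: dz_linear)

lemma smooth_ker_coords: "smooth_distribution_on U (ker_coords (k - 1))"
  unfolding smooth_distribution_on_def
proof
  fix x assume "x \<in> U"
  let ?S = "(\<lambda>(q, l). E q l) ` (UNIV \<times> {2..k})"
  have k1: "k - (k - 1) + 1 = 2" using k2 by simp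
  have "\<forall>y\<in>U. ker_coords (k - 1) y = span ((\<lambda>s. s y) ` ?S)"
  proof (intro ballI subset_antisym)
    fix y assume y: "y \<in> U"
    have "E q l y \<in> ker_coords (k - 1) y" if "l \<in> {2..k}" for q l
      using that y k2 by (auto simp: ker_coords_last dz_E)
    then show "span ((\<lambda>s. s y) ` ?S) \<subseteq> ker_coords (k - 1) y"
      by (intro span_minimal subspace_ker_coords y) auto
    show "ker_coords (k - 1) y \<subseteq> span ((\<lambda>s. s y) ` ?S)"
    proof
      fix v assume "v \<in> ker_coords (k - 1) y"
      then have "v = (\<Sum>q\<in>UNIV. \<Sum>l\<in>{2..k}. dz q l y v *\<^sub>R E q l y)"
        using ker_coords_expand[OF y, of v "k - 1"] unfolding k1 by simp
      also have "\<dots> \<in> span ((\<lambda>s. s y) ` ?S)"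
        by (intro span_sum span_scale span_base) (auto simp: image_image intro!: image_eqI[of _ _ "(_, _)"])
      finally show "v \<in> span ((\<lambda>s. s y) ` ?S)" .
    qed
  qed
  moreover have "\<forall>s\<in>?S. smooth_on U s" using smooth_E by auto
  ultimately show "\<exists>V S. open V \<and> x \<in> V \<and> V \<subseteq> U \<and> finite S \<and> (\<forall>s\<in>S. smooth_on V s) \<and>
      (\<forall>y\<in>V. ker_coords (k - 1) y = span ((\<lambda>s. s y) ` S))"
    using openU \<open>x \<in> U\<close> by (intro exI[of _ U] exI[of _ ?S]) simp
qed

lemma dim_ker_coords:
  assumes x: "x \<in> U"
  shows "dim (ker_coords (k - 1) x) + (CARD('m) + 1) = CARD('n)"
proof -
  define T :: "real^'n \<Rightarrow> real^('m option)" where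
    "T v = (\<chi> j. case j of None \<Rightarrow> dz0 x v | Some q \<Rightarrow> dz q 1 x v)" for v
  have T: "linear T"
    unfolding T_def
    by (rule linearI) (auto simp: vec_eq_iff dz_linear[OF x] split: option.split)
  have "t \<in> range T" for t
  proof -
    have "T (lift (\<lambda>x. coord_vec (t $ None) (\<lambda>q l. t $ Some q)) x) = t"
      using k2 x by (auto simp: T_def vec_eq_iff dz0_def dz_def lift coord_vec split: option.split)
    then show ?thesis by (metis rangeI)
  qed
  then have "range T = UNIV" by auto
  moreover have "{v. T v = 0} = ker_coords (k - 1) x"
    by (auto simp: T_def ker_coords_last vec_eq_iff split: option.splits)
  ultimately show ?thesis using dim_kernel[OF T] by simp
qed

lemma dim_contact:
  assumes x: "x \<in> U"
  shows "dim (contact (k - 2) x) + CARD('m) = CARD('n)"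
proof -
  define T :: "real^'n \<Rightarrow> real^'m" where "T v = (\<chi> q. dz q 1 x v - z q 2 x * dz0 x v)" for v
  have T: "linear T"
    unfolding T_def
    by (rule linearI) (auto simp: vec_eq_iff dz_linear[OF x] algebra_simps)
  have "t \<in> range T" for t
  proof -
    have "T (lift (\<lambda>x. coord_vec 0 (\<lambda>q l. t $ q)) x) = t"
      using k2 x by (auto simp: T_def vec_eq_iff dz0_def dz_def lift coord_vec)
    then show ?thesis by (metis rangeI)
  qed
  then have "range T = UNIV" by auto
  moreover have "{v. T v = 0} = contact (k - 2) x"
    by (auto simp: T_def contact_last vec_eq_iff)
  ultimately show ?thesis using dim_kernel[OF T] by simp
qed

lemma card_coords: "CARD('n) = k * CARD('m) + 1"
proof -
  have "CARD('n) = card (insert None (Some ` ((UNIV :: 'm set) \<times> {1..k})))"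
    using bij_betw_same_card[OF c] by simp
  also have "\<dots> = k * CARD('m) + 1"
    by (subst card_insert_disjoint) (auto simp: card_image card_cartesian_product mult.commute)
  finally show ?thesis .
qed

end

section \<open>Necessity\<close>

lemma linear_control_sum: "linear (\<lambda>w :: real^'c. \<Sum>i\<in>UNIV. (w $ i) *\<^sub>R g i x)"
  by (rule linearI) (simp_all add: scaleR_add_left sum.distrib scaleR_sum_right)

lemma control_distribution_eq_range:
  "control_distribution g x = range (\<lambda>w :: real^'c. \<Sum>i\<in>UNIV. (w $ i) *\<^sub>R g i x)"
proof (rule subset_antisym)
  let ?S = "\<lambda>w :: real^'c. \<Sum>i\<in>UNIV. (w $ i) *\<^sub>R g i x"
  have "g i x \<in> range ?S" for i
  proof
    show "g i x = ?S (axis i 1)"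
      by (simp add: axis_def if_distrib[of "\<lambda>a. a *\<^sub>R _"] cong: if_cong)
  qed simp
  moreover have "subspace (range ?S)"
    by (rule linear_subspace_image[OF linear_control_sum subspace_UNIV])
  ultimately show "control_distribution g x \<subseteq> range ?S"
    unfolding control_distribution_def by (intro span_minimal) auto
  show "range ?S \<subseteq> control_distribution g x"
    unfolding control_distribution_def
    by (rule image_subsetI) (intro span_sum span_scale span_base rangeI)
qed

text \<open>This turns dependence on few coordinates, stated as constancy on fibres, into a
  vanishing derivative.\<close>

lemma frechet_derivative_eq_0_along:
  fixes f :: "'a::real_normed_vector \<Rightarrow> 'b::real_normed_vector"
  assumes "f differentiable (at y)" "open Z" "y \<in> Z" "\<And>t. y + t *\<^sub>R w \<in> Z \<Longrightarrow> f (y + t *\<^sub>R w) = f y"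
  shows "\<partial> f y w = 0"
proof -
  have "((\<lambda>t. f (y + t *\<^sub>R w)) has_derivative (\<lambda>h. \<partial> f y (h *\<^sub>R w))) (at 0)"
    by (rule has_derivative_compose[of "\<lambda>t. y + t *\<^sub>R w" _ 0 UNIV f])
      (use assms(1) in \<open>auto intro!: derivative_eq_intros simp: frechet_derivative_works\<close>)
  moreover have "((\<lambda>t. f (y + t *\<^sub>R w)) has_derivative (\<lambda>h. 0)) (at 0)"
  proof (rule has_derivative_transform_within_open[of "\<lambda>t. f y" _ _ _ "(\<lambda>t. y + t *\<^sub>R w) -` Z"])
    show "open ((\<lambda>t. y + t *\<^sub>R w) -` Z)" using assms(2) by (intro open_vimage continuous_intros)
  qed (use assms in auto)
  ultimately have "(\<lambda>h. \<partial> f y (h *\<^sub>R w)) = (\<lambda>h. 0)" by (rule has_derivative_unique)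
  then show ?thesis by (metis scaleR_one)
qed

lemma smooth_left_inverse_imp_bij:
  fixes \<phi> :: "real^'n \<Rightarrow> real^'n"
  assumes "open U" "x \<in> U" "smooth_on U \<phi>" "smooth_on V \<psi>" "\<phi> x \<in> V" "\<And>y. y \<in> U \<Longrightarrow> \<psi> (\<phi> y) = y"
  shows "\<partial> \<psi> (\<phi> x) (\<partial> \<phi> x v) = v" "bij (\<partial> \<phi> x)"
proof -
  have "((\<lambda>y. \<psi> (\<phi> y)) has_derivative (\<lambda>v. \<partial> \<psi> (\<phi> x) (\<partial> \<phi> x v))) (at x)"
    by (rule has_derivative_compose[OF smooth_on_has_derivative[OF assms(3,2)] smooth_on_has_derivative[OF assms(4,5)]])
  moreover have "((\<lambda>y. \<psi> (\<phi> y)) has_derivative (\<lambda>v. v)) (at x)"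
    by (rule has_derivative_transform_within_open[OF has_derivative_ident assms(1,2)]) (simp add: assms(6))
  ultimately have *: "(\<lambda>v. \<partial> \<psi> (\<phi> x) (\<partial> \<phi> x v)) = (\<lambda>v. v)"
    by (rule has_derivative_unique)
  from fun_cong[OF *] show "\<partial> \<psi> (\<phi> x) (\<partial> \<phi> x v) = v" for v by simp
  have "inj (\<partial> \<phi> x)" using fun_cong[OF *] by (metis injI)
  moreover have "linear (\<partial> \<phi> x)"
    by (rule linear_frechet_derivative[OF smooth_on_imp_differentiable[OF assms(3,2)]])
  ultimately show "bij (\<partial> \<phi> x)"
    using linear_injective_imp_surjective by (auto simp: bij_def)
qed

text \<open>\<open>ker_coords (k - 1)\<close> serves as L. The field \<open>G0\<close>, which lies
  in the control distribution and has dz0 = 1, witnesses the transversality at the base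
  point.\<close>

lemma (in chained_coordinates) chained_form_conditions:
  fixes g :: "'m option \<Rightarrow> real^'n \<Rightarrow> real^'n"
  assumes G: "\<And>y. y \<in> U \<Longrightarrow> control_distribution g y = contact 0 y" and f: "smooth_on U f" and x0: "x0 \<in> U"
    and dr: "\<And>x q l v. x \<in> U \<Longrightarrow> l \<in> {1..k - 1} \<Longrightarrow> v \<in> ker_coords (k - 1 - l) x \<Longrightarrow> \<partial> (drift f q l) x v = 0"
  shows "(\<forall>x\<in>U. derived_flag (control_distribution g) (k - 1) x = UNIV) \<and>
       constant_rank_on U (derived_flag (control_distribution g) (k - 2)) ((k - 1) * CARD('m) + 1) \<and>
       smooth_distribution_on U (ker_coords (k - 1)) \<and>
       involutive_on U (ker_coords (k - 1)) \<and>
       constant_corank_one_in U (ker_coords (k - 1)) (derived_flag (control_distribution g) (k - 2)) \<and>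
       \<not> derived_flag (control_distribution g) 0 x0 \<subseteq> ker_coords (k - 1) x0 \<and>
       (\<forall>i\<in>{1..k - 2}. field_bracket_subset_on U f
          (characteristic_distribution (derived_flag (control_distribution g) i))
          (derived_flag (control_distribution g) i))"
proof (intro conjI)
  have flag: "derived_flag (control_distribution g) i y = contact i y" if "i \<le> k - 1" "y \<in> U" for i y
    by (rule derived_flag_contact[OF G that])
  show "\<forall>x\<in>U. derived_flag (control_distribution g) (k - 1) x = UNIV"
    by (auto simp: flag contact_def)
  have dimc: "dim (contact (k - 2) x) = (k - 1) * CARD('m) + 1" if "x \<in> U" for x
  proof -
    have "k * CARD('m) = (k - 1) * CARD('m) + CARD('m)" using k2 by (cases k) auto
    then show ?thesis using dim_contact[OF that] card_coords by linarith
  qed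
  then show "constant_rank_on U (derived_flag (control_distribution g) (k - 2)) ((k - 1) * CARD('m) + 1)"
    by (simp add: constant_rank_on_def flag)
  show "smooth_distribution_on U (ker_coords (k - 1))" by (rule smooth_ker_coords)
  show "involutive_on U (ker_coords (k - 1))" by (rule involutive_ker_coords)
  show "constant_corank_one_in U (ker_coords (k - 1)) (derived_flag (control_distribution g) (k - 2))"
    unfolding constant_corank_one_in_def
  proof
    fix x assume x: "x \<in> U"
    have "ker_coords (k - 1) x \<subseteq> contact (k - 2) x" by (auto simp: ker_coords_last contact_last)
    then show "ker_coords (k - 1) x \<subseteq> derived_flag (control_distribution g) (k - 2) x \<and>
        dim (ker_coords (k - 1) x) + 1 = dim (derived_flag (control_distribution g) (k - 2) x)"
      using dim_ker_coords[OF x] dim_contact[OF x] x by (simp add: flag)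
  qed
  have "G0 x0 \<in> contact 0 x0" by (rule G0_contact[OF x0])
  moreover have "G0 x0 \<notin> ker_coords (k - 1) x0" using dz_G0(1)[OF x0] by (simp add: ker_coords_def)
  ultimately show "\<not> derived_flag (control_distribution g) 0 x0 \<subseteq> ker_coords (k - 1) x0"
    using flag[OF _ x0, of 0] by auto
  show "\<forall>i\<in>{1..k - 2}. field_bracket_subset_on U f
          (characteristic_distribution (derived_flag (control_distribution g) i))
          (derived_flag (control_distribution g) i)"
  proof
    fix i assume i: "i \<in> {1..k - 2}"
    show "field_bracket_subset_on U f (characteristic_distribution (derived_flag (control_distribution g) i))
          (derived_flag (control_distribution g) i)"
      by (rule compatible_of_drift[OF f flag i dr]) (use i in auto)
  qed
qed

text \<open>The triangular form is not studied on its own space: its coordinates are pulled back by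
  the diffeomorphism and the original fields are compared through dz0 and dz^l.\<close>

lemma TCh_equivalent_imp_conditions:
  fixes X :: "(real ^ 'n) set" and f :: "real ^ 'n \<Rightarrow> real ^ 'n"
    and g :: "'m::finite option \<Rightarrow> real ^ 'n \<Rightarrow> real ^ 'n"
  assumes k: "k \<ge> 2" and X: "smooth_on X f" and eq: "locally_equivalent_to_TCh k X f g xstar"
  shows "\<exists>U L. open U \<and> xstar \<in> U \<and> U \<subseteq> X \<and>
       (\<forall>x\<in>U. derived_flag (control_distribution g) (k - 1) x = UNIV) \<and>
       constant_rank_on U (derived_flag (control_distribution g) (k - 2)) ((k - 1) * CARD('m) + 1) \<and>
       smooth_distribution_on U L \<and>
       involutive_on U L \<and>
       constant_corank_one_in U L (derived_flag (control_distribution g) (k - 2)) \<and>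
       \<not> derived_flag (control_distribution g) 0 xstar \<subseteq> L xstar \<and>
       (\<forall>i\<in>{1..k - 2}. field_bracket_subset_on U f
          (characteristic_distribution (derived_flag (control_distribution g) i))
          (derived_flag (control_distribution g) i))"
proof -
  obtain Z :: "(real^'n) set" and f' g' where "open Z" and T: "TCh_form_on k Z f' g'" and E: "locally_static_feedback_equivalent X f g xstar Z f' g'"
    using eq unfolding locally_equivalent_to_TCh_def by (elim exE conjE) (rule that, assumption+)
  obtain c h where c: "bij_betw c (insert None (Some ` (UNIV \<times> {1..k}))) (UNIV :: 'n set)"
    and h0: "\<forall>i::'m. \<forall>j\<in>{1..<k}. smooth_on Z (h i j) \<and>
           (\<forall>z\<in>Z. \<forall>z'\<in>Z. z $ c None = z' $ c None \<and>
              (\<forall>i'. \<forall>l\<in>{1..j + 1}. z $ c (Some (i', l)) = z' $ c (Some (i', l))) \<longrightarrow> h i j z = h i j z')"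
    and ca0: "\<forall>z\<in>Z. \<forall>v. control_affine f' g' z v $ c None = v $ None \<and>
           (\<forall>i. \<forall>j\<in>{1..<k}. control_affine f' g' z v $ c (Some (i, j)) = h i j z + z $ c (Some (i, j + 1)) * v $ None) \<and>
           (\<forall>i. control_affine f' g' z v $ c (Some (i, k)) = v $ Some i)"
    using T unfolding TCh_form_on_def by (elim exE conjE) (rule that, assumption+)
  have h1: "smooth_on Z (h i j)" if "j \<in> {1..<k}" for i j
    by (rule conjunct1[OF bspec[OF spec[OF h0] that]])
  have h2: "h i j z = h i j z'"
    if "j \<in> {1..<k}" "z \<in> Z" "z' \<in> Z" "z $ c None = z' $ c None"
      "\<forall>i'. \<forall>l\<in>{1..j + 1}. z $ c (Some (i', l)) = z' $ c (Some (i', l))" for i j z z'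
    by (rule mp[OF bspec[OF bspec[OF conjunct2[OF bspec[OF spec[OF h0] that(1)]] that(2)] that(3)] conjI[OF that(4,5)]])
  have ca: "control_affine f' g' z v $ c None = v $ None"
    "j \<in> {1..<k} \<Longrightarrow> control_affine f' g' z v $ c (Some (i, j)) = h i j z + z $ c (Some (i, j + 1)) * v $ None"
    "control_affine f' g' z v $ c (Some (i, k)) = v $ Some i"
    if "z \<in> Z" for z v i j using ca0 that by simp_all
  obtain U V \<phi> \<psi> \<alpha> \<beta> where U: "open U" "xstar \<in> U" "U \<subseteq> X" and V: "open V" "V \<subseteq> Z"
    and hom: "homeomorphism U V \<phi> \<psi>" and sm: "smooth_on U \<phi>" "smooth_on V \<psi>"
    and inv: "\<forall>x\<in>U. invertible (\<beta> x :: real^('m option)^('m option))"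
    and fb: "\<forall>x\<in>U. \<forall>v. \<partial> \<phi> x (control_affine f g x (\<alpha> x + \<beta> x *v v)) = control_affine f' g' (\<phi> x) v"
    using E unfolding locally_static_feedback_equivalent_def by (elim exE conjE) (rule that, assumption+)
  have \<phi>V: "\<phi> x \<in> V" "\<psi> (\<phi> x) = x" if "x \<in> U" for x using hom that by (auto simp: homeomorphism_def)
  interpret chained_coordinates U k c \<phi>
  proof
    show "bij (\<partial> \<phi> x)" if "x \<in> U" for x
      by (rule smooth_left_inverse_imp_bij(2)[OF U(1) that sm \<phi>V(1)[OF that] \<phi>V(2)])
  qed (fact U(1) sm(1) c k)+
  define S where "S x w = (\<Sum>i\<in>UNIV. (w $ i) *\<^sub>R g i x)" for x and w :: "real^('m option)"
  have linS: "linear (S x)" for x unfolding S_def by (rule linear_control_sum)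
  have Ga: "\<phi> x \<in> Z" if "x \<in> U" for x using \<phi>V V that by auto
  have tot: "dz0 x (f x + S x (\<alpha> x + \<beta> x *v v)) = v $ None"
    "l \<in> {1..<k} \<Longrightarrow> dz q l x (f x + S x (\<alpha> x + \<beta> x *v v)) = h q l (\<phi> x) + z q (l + 1) x * v $ None"
    "dz q k x (f x + S x (\<alpha> x + \<beta> x *v v)) = v $ Some q" if "x \<in> U" for x v q l
    using fb[rule_format, OF that, of v] ca[OF Ga[OF that]]
    by (simp_all add: dz0_def dz_def z_def S_def control_affine_def)
  have add0: "dz0 x (a + b) = dz0 x a + dz0 x b" and add: "dz q l x (a + b) = dz q l x a + dz q l x b" if "x \<in> U" for x a b q l
    using dz_linear[OF that] by auto
  \<comment> \<open>Subtracting the equivalence at the zero control isolates the control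
    part.\<close>
  have S\<beta>: "dz0 x (S x (\<beta> x *v v)) = v $ None" "l \<in> {1..<k} \<Longrightarrow> dz q l x (S x (\<beta> x *v v)) = z q (l + 1) x * v $ None"
    "dz q k x (S x (\<beta> x *v v)) = v $ Some q" if "x \<in> U" for x v q l
    using tot[OF that, where v=v] tot[OF that, where v=0]
    by (simp_all add: linear_add[OF linS] add.assoc[symmetric] add[OF that] add0[OF that])
  have contact0: "contact 0 x = {v. \<forall>q. \<forall>l\<in>{1..<k}. dz q l x v = z q (l + 1) x * dz0 x v}" for x
  proof -
    have "{1..k - 1 - 0} = {1..<k}" using k by auto
    then show ?thesis by (simp add: contact_def)
  qed
  have Sc: "S x w \<in> contact 0 x" if "x \<in> U" for x w
  proof -
    have "S x w = S x (\<beta> x *v (matrix_inv (\<beta> x) *v w))"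
      using matrix_inv_mult(1)[OF inv[rule_format, OF that]] by simp
    then show ?thesis using S\<beta>[OF that, where v="matrix_inv (\<beta> x) *v w"] by (auto simp: contact0)
  qed
  have G: "control_distribution g x = contact 0 x" if x: "x \<in> U" for x
  proof
    have rng: "control_distribution g x = range (S x)" by (simp add: control_distribution_eq_range S_def[abs_def])
    show "control_distribution g x \<subseteq> contact 0 x" using Sc[OF x] rng by auto
    show "contact 0 x \<subseteq> control_distribution g x"
    proof
      fix u assume u: "u \<in> contact 0 x"
      \<comment> \<open>A contact vector is determined by dz0 and dz^k, which are the new controls;
        the contact relations supply the other components.\<close>
      define v :: "real^('m option)" where "v = (\<chi> j. case j of None \<Rightarrow> dz0 x u | Some q \<Rightarrow> dz q k x u)"
      have v: "v $ None = dz0 x u" "v $ Some q = dz q k x u" for q by (simp_all add: v_def)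
      have "u = S x (\<beta> x *v v)"
      proof (rule coord_eqI[OF x])
        show "dz0 x u = dz0 x (S x (\<beta> x *v v))" by (simp add: S\<beta>(1)[OF x] v)
        fix q l assume "l \<in> {1..k}"
        then show "dz q l x u = dz q l x (S x (\<beta> x *v v))"
          using u by (cases "l = k") (auto simp: S\<beta>[OF x] v contact0)
      qed
      then show "u \<in> control_distribution g x" using rng by blast
    qed
  qed
  \<comment> \<open>The contact forms kill the control fields, so the feedback term
    \<open>S x (\<alpha> x)\<close> drops out and \<open>f\<close> gives the same value as the
    transformed drift.\<close>
  have drift_h: "drift f q l x = h q l (\<phi> x)" if x: "x \<in> U" and l: "l \<in> {1..k - 1}" for q l x
  proof -
    have l': "l \<in> {1..<k}" using l by auto
    have "dz0 x (f x) = - dz0 x (S x (\<alpha> x))" "dz q l x (f x) = h q l (\<phi> x) - dz q l x (S x (\<alpha> x))"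
      using tot(1)[OF x, where v=0] tot(2)[OF x l', where q=q and v=0] by (simp_all add: add[OF x] add0[OF x])
    then show ?thesis using Sc[OF x, of "\<alpha> x"] l' by (auto simp: drift_def contact0)
  qed
  have dr: "\<partial> (drift f q l) x v = 0"
    if x: "x \<in> U" and l: "l \<in> {1..k - 1}" and v: "v \<in> ker_coords (k - 1 - l) x" for x q l v
  proof -
    have l': "l \<in> {1..<k}" "k - (k - 1 - l) = l + 1" using l by auto
    have dh: "h q l differentiable (at (\<phi> x))"
      by (rule smooth_on_imp_differentiable[OF h1[OF l'(1)] Ga[OF x]])
    have v0: "dz0 x v = 0" "\<forall>q. \<forall>l'\<in>{1..l + 1}. dz q l' x v = 0"
      using v unfolding ker_coords_def l'(2) by auto
    have "((\<lambda>y. h q l (\<phi> y)) has_derivative (\<lambda>v. \<partial> (h q l) (\<phi> x) (\<partial> \<phi> x v))) (at x)"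
      by (rule has_derivative_compose[OF smooth_on_has_derivative[OF sm(1) x] dh[unfolded frechet_derivative_works]])
    then have "(drift f q l has_derivative (\<lambda>v. \<partial> (h q l) (\<phi> x) (\<partial> \<phi> x v))) (at x)"
      by (rule has_derivative_transform_within_open[OF _ U(1) x]) (simp add: drift_h[OF _ l])
    then have "\<partial> (drift f q l) x v = \<partial> (h q l) (\<phi> x) (\<partial> \<phi> x v)"
      by (simp add: frechet_derivative_eqI)
    \<comment> \<open>The direction \<open>\<partial> \<phi> x v\<close> leaves z0, z^1, ...,
      z^(l+1) unchanged, so the line stays in one fibre of \<open>h q l\<close>.\<close>
    also have "\<dots> = 0"
    proof (rule frechet_derivative_eq_0_along[OF dh \<open>open Z\<close> Ga[OF x]])
      fix t assume t: "\<phi> x + t *\<^sub>R \<partial> \<phi> x v \<in> Z"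
      show "h q l (\<phi> x + t *\<^sub>R \<partial> \<phi> x v) = h q l (\<phi> x)"
        by (rule h2[OF l'(1) t Ga[OF x]])
          (use v0 in \<open>auto simp: dz0_def dz_def\<close>)
    qed
    finally show ?thesis .
  qed
  show ?thesis
    using chained_form_conditions[OF G smooth_on_subset[OF X U(3)] U(2) dr] U by blast
qed

section \<open>Sufficiency\<close>

text \<open>Iterated Lie derivatives along \<open>w\<close>; applied to the first integrals they
  become the higher coordinates.\<close>

primrec iter_lie :: "('a::real_normed_vector \<Rightarrow> 'a) \<Rightarrow> ('a \<Rightarrow> real) \<Rightarrow> nat \<Rightarrow> 'a \<Rightarrow> real" where
  "iter_lie w f 0 = f"
| "iter_lie w f (Suc j) = (\<lambda>x. \<partial> (iter_lie w f j) x (w x))"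

section \<open>Extension of tangent vectors to local sections\<close>

text \<open>The bracket identity needs fields, while a distribution of possibly varying rank only
  offers vectors at a point; this property links the two.\<close>

definition extendable_on :: "'a::real_normed_vector set \<Rightarrow> 'a distribution \<Rightarrow> bool" where
  "extendable_on N D \<longleftrightarrow> (\<forall>x\<in>N. \<forall>u\<in>D x. \<exists>V v. x \<in> V \<and> V \<subseteq> N \<and> section_on V D v \<and> v x = u)"

lemma section_on_add:
  assumes "\<And>x. subspace (D x)" "section_on V D v" "section_on W D w"
  shows "section_on (V \<inter> W) D (\<lambda>x. v x + w x)"
  using assms smooth_on_add[of "V \<inter> W" v w] smooth_on_subset[of V v "V \<inter> W"] smooth_on_subset[of W w "V \<inter> W"]
  by (auto simp: section_on_def subspace_add)

lemma section_on_scale: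
  assumes "\<And>x. subspace (D x)" "section_on V D v"
  shows "section_on V D (\<lambda>x. a *\<^sub>R v x)"
  using assms smooth_on_bounded_linear[OF bounded_linear_scaleR_right, of V v a]
  by (auto simp: section_on_def subspace_scale)

text \<open>Vectors of \<open>D\<close> extend by assumption, and a bracket extends as the bracket
  of the same fields at neighbouring points. A linear combination involves finitely many of them,
  whose domains are intersected.\<close>

lemma extendable_on_derived:
  fixes D :: "'a::euclidean_space distribution"
  assumes "open N" "extendable_on N D"
  shows "extendable_on N (derived D)"
  unfolding extendable_on_def
proof (intro ballI)
  fix x u assume x: "x \<in> N" and u: "u \<in> derived D x"
  have sub: "subspace (derived D y)" for y by (simp add: derived_def)
  let ?P = "\<lambda>u. \<exists>V v. x \<in> V \<and> V \<subseteq> N \<and> section_on V (derived D) v \<and> v x = u"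
  have gen: "?P u" if "u \<in> D x \<union> {lie_bracket v w x | v w. \<exists>V. x \<in> V \<and> section_on V D v \<and> section_on V D w}" for u
    using that
  proof
    assume "u \<in> D x"
    then obtain V v where V: "x \<in> V" "V \<subseteq> N" "section_on V D v" "v x = u"
      using assms(2) x unfolding extendable_on_def by blast
    then have "section_on V (derived D) v" using derived_subset[of D] by (auto simp: section_on_def)
    then show ?thesis using V by blast
  next
    assume "u \<in> {lie_bracket v w x | v w. \<exists>V. x \<in> V \<and> section_on V D v \<and> section_on V D w}"
    then obtain v w V where V: "u = lie_bracket v w x" "x \<in> V" "section_on V D v" "section_on V D w" by blast
    let ?V = "V \<inter> N"
    have op: "open ?V" using V assms(1) by (auto simp: section_on_def)
    have sec: "section_on ?V D v" "section_on ?V D w" using section_on_subset[OF _ op] V by auto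
    then have "section_on ?V (derived D) (lie_bracket v w)"
      using smooth_lie_bracket[OF op, of v w] derived_bracket[of _ ?V D v w] by (auto simp: section_on_def)
    then show ?thesis using V x by blast
  qed
  show "?P u"
    using u[unfolded derived_def]
  proof (induction rule: span_induct_alt)
    case base
    have "section_on N (derived D) (\<lambda>_. 0)" using assms(1) sub by (simp add: section_on_def subspace_0)
    then show ?case using x by (intro exI[of _ N] exI[of _ "\<lambda>_. 0"]) simp
  next
    case (step a u u')
    obtain V v where V: "x \<in> V" "V \<subseteq> N" "section_on V (derived D) v" "v x = u" using gen[OF step(1)] by blast
    obtain V' v' where V': "x \<in> V'" "V' \<subseteq> N" "section_on V' (derived D) v'" "v' x = u'" using step(2) by blast
    have "section_on (V \<inter> V') (derived D) (\<lambda>x. a *\<^sub>R v x + v' x)"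
      by (rule section_on_add[OF sub section_on_scale[OF sub V(3)] V'(3)])
    then show ?case using V V' by (intro exI[of _ "V \<inter> V'"] exI[of _ "\<lambda>x. a *\<^sub>R v x + v' x"]) auto
  qed
qed

lemma subspace_control_distribution: "subspace (control_distribution g x)"
  by (simp add: control_distribution_def)

lemma extendable_on_derived_flag:
  fixes g :: "'c::finite \<Rightarrow> 'a::euclidean_space \<Rightarrow> 'a"
  assumes "open N" "\<And>i. smooth_on N (g i)"
  shows "extendable_on N (derived_flag (control_distribution g) i)"
proof (induction i)
  case 0
  show ?case
    unfolding extendable_on_def derived_flag_0
  proof (intro ballI)
    fix x u assume x: "x \<in> N" and "u \<in> control_distribution g x"
    then obtain w :: "real^'c" where w: "u = (\<Sum>i\<in>UNIV. (w $ i) *\<^sub>R g i x)"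
      by (auto simp: control_distribution_eq_range)
    have "smooth_on N (\<lambda>y. \<Sum>i\<in>UNIV. (w $ i) *\<^sub>R g i y)"
      by (intro smooth_on_sum smooth_on_bounded_linear[OF bounded_linear_scaleR_right] assms)
    then have "section_on N (control_distribution g) (\<lambda>y. \<Sum>i\<in>UNIV. (w $ i) *\<^sub>R g i y)"
      using assms(1) by (auto simp: section_on_def control_distribution_eq_range)
    then show "\<exists>V v. x \<in> V \<and> V \<subseteq> N \<and> section_on V (control_distribution g) v \<and> v x = u"
      using x w by blast
  qed
qed (simp add: derived_flag_Suc extendable_on_derived assms(1))

lemma derived_flag_mono: "i \<le> j \<Longrightarrow> derived_flag D i x \<subseteq> derived_flag D j x"
  by (rule lift_Suc_mono_le[of "\<lambda>i. derived_flag D i x"]) (simp_all add: derived_flag_Suc derived_subset)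

section \<open>The chain of iterated derivatives and its independence\<close>

text \<open>What Frobenius' theorem is to supply: m + 1 functions, a normalised control field
  \<open>w\<close>, and the relation \<open>top\<close>, by which the first contact forms annihilate
  the flag of index k - 2. The conditions \<open>full\<close> and \<open>onto\<close> concern the
  base point, as independence there yields local coordinates.\<close>

locale chain_data =
  fixes N :: "(real^'n) set" and k :: nat and g :: "'m::finite option \<Rightarrow> real^'n \<Rightarrow> real^'n"
    and z0 :: "real^'n \<Rightarrow> real" and \<zeta> :: "'m \<Rightarrow> real^'n \<Rightarrow> real" and w :: "real^'n \<Rightarrow> real^'n" and x0 :: "real^'n"
  assumes openN: "open N" and x0: "x0 \<in> N" and k2: "k \<ge> 2"
    and smooth_g: "\<And>i. smooth_on N (g i)" and smooth_z0: "smooth_on N z0" and smooth_\<zeta>: "\<And>q. smooth_on N (\<zeta> q)"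
    and smooth_w: "smooth_on N w" and w: "\<And>x. x \<in> N \<Longrightarrow> w x \<in> control_distribution g x"
    and z0w: "\<And>x. x \<in> N \<Longrightarrow> \<partial> z0 x (w x) = 1"
    and top: "\<And>x u q. x \<in> N \<Longrightarrow> u \<in> derived_flag (control_distribution g) (k - 2) x \<Longrightarrow>
      \<partial> (\<zeta> q) x u = \<partial> (\<zeta> q) x (w x) * \<partial> z0 x u"
    and full: "derived_flag (control_distribution g) (k - 1) x0 = UNIV"
    and onto: "\<And>t. \<exists>u. \<partial> z0 x0 u = 0 \<and> (\<forall>q. \<partial> (\<zeta> q) x0 u = t q)"
begin

abbreviation flag :: "nat \<Rightarrow> (real^'n) distribution" where
  "flag \<equiv> derived_flag (control_distribution g)"

definition z :: "'m \<Rightarrow> nat \<Rightarrow> real^'n \<Rightarrow> real" where "z q l = iter_lie w (\<zeta> q) (l - 1)"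

definition dz :: "'m \<Rightarrow> nat \<Rightarrow> real^'n \<Rightarrow> real^'n \<Rightarrow> real" where "dz q l x = \<partial> (z q l) x"
definition dz0 :: "real^'n \<Rightarrow> real^'n \<Rightarrow> real" where "dz0 x = \<partial> z0 x"

lemma z_Suc: "1 \<le> l \<Longrightarrow> z q (l + 1) x = dz q l x (w x)"
  by (cases l) (simp_all add: z_def dz_def)

lemma smooth_z: "smooth_on N (z q l)"
proof -
  have "smooth_on N (iter_lie w (\<zeta> q) j)" for j
    by (induction j) (simp_all add: smooth_\<zeta> smooth_on_frechet_derivative[OF openN _ smooth_w])
  then show ?thesis by (simp add: z_def)
qed

lemma linear_dz: "x \<in> N \<Longrightarrow> linear (dz q l x)" "x \<in> N \<Longrightarrow> linear (dz0 x)"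
  unfolding dz_def dz0_def
  using smooth_z smooth_z0 smooth_on_imp_differentiable linear_frechet_derivative by blast+

lemma dz_linear:
  assumes "x \<in> N"
  shows "dz0 x 0 = 0" "dz q l x 0 = 0" "dz0 x (a + b) = dz0 x a + dz0 x b" "dz q l x (a + b) = dz q l x a + dz q l x b"
    "dz0 x (a - b) = dz0 x a - dz0 x b" "dz q l x (a - b) = dz q l x a - dz q l x b"
    "dz0 x (r *\<^sub>R a) = r * dz0 x a" "dz q l x (r *\<^sub>R a) = r * dz q l x a"
    "dz0 x (\<Sum>i\<in>I. t i) = (\<Sum>i\<in>I. dz0 x (t i))" "dz q l x (\<Sum>i\<in>I. t i) = (\<Sum>i\<in>I. dz q l x (t i))"
proof -
  note L = linear_dz[OF assms]
  show "dz0 x 0 = 0" "dz q l x 0 = 0" "dz0 x (a + b) = dz0 x a + dz0 x b" "dz q l x (a + b) = dz q l x a + dz q l x b"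
    "dz0 x (a - b) = dz0 x a - dz0 x b" "dz q l x (a - b) = dz q l x a - dz q l x b"
    "dz0 x (r *\<^sub>R a) = r * dz0 x a" "dz q l x (r *\<^sub>R a) = r * dz q l x a"
    "dz0 x (\<Sum>i\<in>I. t i) = (\<Sum>i\<in>I. dz0 x (t i))" "dz q l x (\<Sum>i\<in>I. t i) = (\<Sum>i\<in>I. dz q l x (t i))"
    by (simp_all add: L[THEN linear_0] L[THEN linear_add] L[THEN linear_diff] L[THEN linear_scale] L[THEN linear_sum])
qed

lemma subspace_flag: "subspace (flag i x)"
  by (rule subspace_derived_flag[OF subspace_control_distribution])

lemma w_flag: "x \<in> N \<Longrightarrow> w x \<in> flag i x"
  using derived_flag_mono[of 0 i "control_distribution g" x] w by (auto simp: derived_flag_0)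

lemma extendable_flag: "extendable_on N (flag i)"
  by (rule extendable_on_derived_flag[OF openN]) (rule smooth_g)

lemma form_bracket:
  assumes "x \<in> V" "open V" "V \<subseteq> N" "smooth_on V u" "smooth_on V v"
    and "\<And>y. y \<in> V \<Longrightarrow> dz q l y (u y) = z q (l + 1) y * dz0 y (u y)"
    and "\<And>y. y \<in> V \<Longrightarrow> dz q l y (v y) = z q (l + 1) y * dz0 y (v y)"
  shows "dz q l x (lie_bracket u v x) - z q (l + 1) x * dz0 x (lie_bracket u v x) =
    dz q (l + 1) x (u x) * dz0 x (v x) - dz q (l + 1) x (v x) * dz0 x (u x)"
  using contact_bracket[OF assms(2,1) smooth_on_subset[OF smooth_z assms(3)] smooth_on_subset[OF smooth_z assms(3)]
      smooth_on_subset[OF smooth_z0 assms(3)] assms(4,5), of q l q "l + 1"] assms(6,7)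
  by (simp add: dz_def dz0_def)

text \<open>Extend the vector to a section \<open>v\<close> and bracket it with \<open>w\<close>.
  The form of index l - 1 annihilates \<open>v\<close>, \<open>w\<close> and their bracket, so with
  dz0(w) = 1 and dz^l(w) = z^(l+1) the identity reads dz^l(v) = z^(l+1) dz0(v).\<close>

lemma flag_contact:
  assumes "i \<le> k - 2" "x \<in> N" "u \<in> flag i x" "l \<in> {1..k - 1 - i}"
  shows "dz q l x u = z q (l + 1) x * dz0 x u"
  using assms
\<comment> \<open>Induction on the distance from the flag of index k - 2, whose single relation is
  \<open>top\<close>.\<close>
proof (induction "k - 2 - i" arbitrary: i x u l)
  case 0
  then have "i = k - 2" "l = 1" using k2 by auto
  then show ?case using top[OF \<open>x \<in> N\<close>, of u q] 0 z_Suc[of 1 q x]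
    by (simp add: z_def dz_def dz0_def)
next
  case (Suc j)
  have i: "Suc i \<le> k - 2" "j = k - 2 - Suc i" using Suc(2,3) by auto
  have up: "flag i y \<subseteq> flag (Suc i) y" for y by (rule derived_flag_mono) simp
  show ?case
  proof (cases "l \<le> k - 1 - Suc i")
    case True
    then show ?thesis using Suc(1)[OF i(2,1) Suc.prems(2), of u l] Suc.prems up by auto
  next
    case False
    \<comment> \<open>Smaller \<open>l\<close> are inherited from the larger flag; the new relation
      has l = k - 1 - i and is reached through the form one index below.\<close>
    define l' where "l' = l - 1"
    have l': "l = l' + 1" "l' \<in> {1..k - 1 - Suc i}" using False Suc.prems i by (auto simp: l'_def)
    obtain V v where V: "x \<in> V" "V \<subseteq> N" "section_on V (flag i) v" "v x = u"
      using extendable_flag[of i] Suc.prems(2,3) unfolding extendable_on_def by blast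
    have op: "open V" and smv: "smooth_on V v" using V(3) by (auto simp: section_on_def)
    have secw: "section_on V (flag i) w"
      using op smooth_on_subset[OF smooth_w V(2)] V(2) w_flag by (auto simp: section_on_def)
    have IH: "dz q l' y u = z q (l' + 1) y * dz0 y u" if "y \<in> V" "u \<in> flag (Suc i) y" for y u
      by (rule Suc(1)[OF i(2,1) _ that(2) l'(2)]) (use that V in auto)
    have "lie_bracket v w x \<in> flag (Suc i) x"
      unfolding derived_flag_Suc by (rule derived_bracket[OF V(1,3) secw])
    then have "dz q l' x (lie_bracket v w x) - z q (l' + 1) x * dz0 x (lie_bracket v w x) = 0"
      using IH[OF V(1)] by simp
    moreover have "dz q l' x (lie_bracket v w x) - z q (l' + 1) x * dz0 x (lie_bracket v w x) =
        dz q (l' + 1) x (v x) * dz0 x (w x) - dz q (l' + 1) x (w x) * dz0 x (v x)"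
    proof (rule form_bracket[OF V(1) op V(2) smv])
      show "smooth_on V w" using secw by (simp add: section_on_def)
      show "dz q l' y (v y) = z q (l' + 1) y * dz0 y (v y)" "dz q l' y (w y) = z q (l' + 1) y * dz0 y (w y)" if "y \<in> V" for y
        using IH[OF that] V(3) secw that up[of y] by (auto simp: section_on_def)
    qed
    moreover have "dz0 x (w x) = 1" using z0w[OF Suc.prems(2)] by (simp add: dz0_def)
    moreover have "dz q (l' + 1) x (w x) = z q (l + 1) x" using z_Suc[of l q x] l' by simp
    ultimately show ?thesis using V(4) l'(1) by simp
  qed
qed

text \<open>The identity turns the value of a contact form of index l on a bracket into the value of
  dz^(l+1) on a vector of the smaller flag, so surjectivity passes from l to l + 1. At l = 1 the
  flag is the whole space.\<close>

lemma dz_onto_flag: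
  assumes "l \<in> {1..k}"
  shows "\<exists>u\<in>flag (k - l) x0. dz0 x0 u = 0 \<and> (\<forall>q. dz q l x0 u = t q)"
  using assms
proof (induction l arbitrary: t)
  case (Suc l)
  show ?case
  proof (cases "l = 0")
    case True
    then show ?thesis using onto[of t] full by (auto simp: z_def dz_def dz0_def)
  next
    case False
    then have l: "l \<in> {1..k}" "1 \<le> l" using Suc.prems by auto
    define i where "i = k - Suc l"
    have i: "k - l = Suc i" "i \<le> k - 2" "l \<in> {1..k - 1 - i}" using False Suc.prems by (auto simp: i_def)
    obtain u where u: "u \<in> flag (Suc i) x0" "dz0 x0 u = 0" "\<And>q. dz q l x0 u = t q"
      using Suc.IH[OF l(1), of t] unfolding i(1) by auto
    note lin = dz_linear[OF x0]
    \<comment> \<open>The relation between \<open>u\<close> and \<open>u'\<close> is linear, so it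
      can be built up along a span and needs checking on generators.\<close>
    let ?P = "\<lambda>u. \<exists>u'\<in>flag i x0. dz0 x0 u' = 0 \<and> (\<forall>q. dz q (Suc l) x0 u' = dz q l x0 u - z q (l + 1) x0 * dz0 x0 u)"
    have gen: "?P u" if "u \<in> flag i x0 \<union> {lie_bracket v w x0 | v w. \<exists>V. x0 \<in> V \<and> section_on V (flag i) v \<and> section_on V (flag i) w}" for u
      using that
    proof
      assume "u \<in> flag i x0"
      from flag_contact[OF i(2) x0 this i(3)] show ?thesis
        using subspace_0[OF subspace_flag[of i x0]] lin by (intro bexI[of _ 0]) simp_all
    next
      assume "u \<in> {lie_bracket v w x0 | v w. \<exists>V. x0 \<in> V \<and> section_on V (flag i) v \<and> section_on V (flag i) w}"
      then obtain v v' V where V: "u = lie_bracket v v' x0" "x0 \<in> V" "section_on V (flag i) v" "section_on V (flag i) v'"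
        by blast
      let ?V = "V \<inter> N"
      have op: "open ?V" "x0 \<in> ?V" using V openN x0 by (auto simp: section_on_def)
      have sec: "section_on ?V (flag i) v" "section_on ?V (flag i) v'" using section_on_subset[OF _ op(1)] V by auto
      have fc: "dz q l y (s y) = z q (l + 1) y * dz0 y (s y)" if "section_on ?V (flag i) s" "y \<in> ?V" for q s y
        by (rule flag_contact[OF i(2) _ _ i(3)]) (use that in \<open>auto simp: section_on_def\<close>)
      have br: "dz q l x0 u - z q (l + 1) x0 * dz0 x0 u =
          dz q (l + 1) x0 (v x0) * dz0 x0 (v' x0) - dz q (l + 1) x0 (v' x0) * dz0 x0 (v x0)" for q
        unfolding V(1)
        by (rule form_bracket[OF op(2,1)]) (use sec fc in \<open>auto simp: section_on_def\<close>)
      \<comment> \<open>This combination cancels dz0, and dz^(l+1) of it is the right-hand side of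
        the bracket identity.\<close>
      let ?u = "dz0 x0 (v' x0) *\<^sub>R v x0 - dz0 x0 (v x0) *\<^sub>R v' x0"
      have "?u \<in> flag i x0"
        using sec op by (intro subspace_diff[OF subspace_flag] subspace_scale[OF subspace_flag]) (auto simp: section_on_def)
      moreover have "dz0 x0 ?u = 0"
        by (simp add: lin)
      moreover have "dz q (Suc l) x0 ?u = dz q l x0 u - z q (l + 1) x0 * dz0 x0 u" for q
        unfolding br by (simp add: lin algebra_simps)
      ultimately show ?thesis by blast
    qed
    have "?P u"
      using u(1)[unfolded derived_flag_Suc derived_def]
    proof (induction rule: span_induct_alt)
      case base
      show ?case
        using subspace_0[OF subspace_flag[of i x0]] lin by (intro bexI[of _ 0]) simp_all
    next
      case (step a s s')
      obtain r r' where r: "r \<in> flag i x0" "dz0 x0 r = 0" "\<And>q. dz q (Suc l) x0 r = dz q l x0 s - z q (l + 1) x0 * dz0 x0 s"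
        "r' \<in> flag i x0" "dz0 x0 r' = 0" "\<And>q. dz q (Suc l) x0 r' = dz q l x0 s' - z q (l + 1) x0 * dz0 x0 s'"
        using gen[OF step(1)] step(2) by blast
      show ?case
      proof (intro bexI[of _ "a *\<^sub>R r + r'"] conjI allI)
        show "a *\<^sub>R r + r' \<in> flag i x0"
          by (intro subspace_add[OF subspace_flag] subspace_scale[OF subspace_flag] r)
        show "dz0 x0 (a *\<^sub>R r + r') = 0"
          by (simp add: lin r(2,5))
        fix q
        have "dz q (Suc l) x0 (a *\<^sub>R r + r') = a * dz q (Suc l) x0 r + dz q (Suc l) x0 r'"
          by (simp add: lin)
        also have "\<dots> = dz q l x0 (a *\<^sub>R s + s') - z q (l + 1) x0 * dz0 x0 (a *\<^sub>R s + s')"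
          unfolding r(3,6) by (simp add: lin algebra_simps)
        finally show "dz q (Suc l) x0 (a *\<^sub>R r + r') = dz q l x0 (a *\<^sub>R s + s') - z q (l + 1) x0 * dz0 x0 (a *\<^sub>R s + s')" .
      qed
    qed
    then show ?thesis using u(2,3) by (simp add: i_def)
  qed
qed simp

text \<open>A triangular system: the vector correcting dz^(l+1) lies in the kernel of dz0 and in a
  flag whose contact relations then annihilate dz^1, ..., dz^l, so the values already attained
  stay.\<close>

lemma dz_onto:
  assumes "l \<le> k"
  shows "\<exists>u. dz0 x0 u = a \<and> (\<forall>q. \<forall>l'\<in>{1..l}. dz q l' x0 u = b q l')"
  using assms
proof (induction l)
  case 0
  have "dz0 x0 (a *\<^sub>R w x0) = a"
    using z0w[OF x0, folded dz0_def] by (simp add: dz_linear[OF x0])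
  then show ?case by auto
next
  case (Suc l)
  note lin = dz_linear[OF x0]
  obtain u where u: "dz0 x0 u = a" "\<And>q l'. l' \<in> {1..l} \<Longrightarrow> dz q l' x0 u = b q l'"
    using Suc by auto
  obtain v where v: "v \<in> flag (k - Suc l) x0" "dz0 x0 v = 0" "\<And>q. dz q (Suc l) x0 v = b q (Suc l) - dz q (Suc l) x0 u"
    using dz_onto_flag[of "Suc l" "\<lambda>q. b q (Suc l) - dz q (Suc l) x0 u"] Suc.prems by auto
  have v0: "dz q l' x0 v = 0" if "l' \<in> {1..l}" for q l'
    using flag_contact[OF _ x0 v(1), of l' q] v(2) that Suc.prems by auto
  have "dz q l' x0 (u + v) = b q l'" if "l' \<in> {1..Suc l}" for q l'
    using that v0[of l' q] v(3)[of q] u(2)[of l' q] by (cases "l' = Suc l") (auto simp: lin)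
  moreover have "dz0 x0 (u + v) = a" by (simp add: lin u v)
  ultimately show ?case by blast
qed

end

section \<open>Chart, feedback and triangular form\<close>

lemma field_bracket_subset_on_subset:
  "field_bracket_subset_on U f C D \<Longrightarrow> W \<subseteq> U \<Longrightarrow> field_bracket_subset_on W f C D"
  unfolding field_bracket_subset_on_def by blast

lemma invertible_matrix_inv:
  fixes A :: "real^'n^'n"
  assumes "invertible A"
  shows "invertible (matrix_inv A)"
proof -
  have "A ** matrix_inv A = mat 1"
    using matrix_inv_mult(1)[OF assms] by (simp add: matrix_eq flip: matrix_vector_mul_assoc)
  then show ?thesis unfolding invertible_left_inverse by blast
qed

lemma eq_along_segment:
  fixes h :: "'a::real_normed_vector \<Rightarrow> real"
  assumes B: "convex B" "a \<in> B" "b \<in> B"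
    and h: "\<And>y. y \<in> B \<Longrightarrow> h differentiable (at y)" "\<And>y. y \<in> B \<Longrightarrow> \<partial> h y (b - a) = 0"
  shows "h a = h b"
proof -
  define \<gamma> where "\<gamma> = (\<lambda>t. a + t *\<^sub>R (b - a))"
  have \<gamma>: "\<gamma> t \<in> B" if "t \<in> {0..1}" for t
    using convexD_alt[OF B, of t] that by (simp add: \<gamma>_def algebra_simps)
  have "((\<lambda>t. h (\<gamma> t)) has_derivative (\<lambda>s. 0)) (at t within {0..1})" if "t \<in> {0..1}" for t
  proof -
    have "((\<lambda>t. h (\<gamma> t)) has_derivative (\<lambda>s. \<partial> h (\<gamma> t) (s *\<^sub>R (b - a)))) (at t within {0..1})"
      by (rule has_derivative_compose[of \<gamma> "\<lambda>s. s *\<^sub>R (b - a)" t "{0..1}" h])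
        (use h(1)[OF \<gamma>[OF that]] in \<open>auto simp: \<gamma>_def frechet_derivative_works intro!: derivative_eq_intros\<close>)
    then show ?thesis
      using h(2)[OF \<gamma>[OF that]] linear_scale[OF linear_frechet_derivative[OF h(1)[OF \<gamma>[OF that]]]] by simp
  qed
  then obtain c where "\<And>t. t \<in> {0..1} \<Longrightarrow> h (\<gamma> t) = c"
    using has_derivative_zero_constant[of "{0..1}" "\<lambda>t. h (\<gamma> t)"] by auto
  from this[of 0] this[of 1] show ?thesis by (simp add: \<gamma>_def)
qed

text \<open>The feedback is chosen so that dz0 and dz^k of the closed-loop field are the new
  controls; the contact relations and the drift components give all other components. On a convex
  image, vanishing derivatives of these components mean dependence on the permitted coordinates
  only.\<close>

lemma (in chain_data) imp_TCh_equivalent: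
  assumes X: "N \<subseteq> X" and f: "smooth_on N f" and card: "CARD('n) = k * CARD('m) + 1"
    and comp: "\<And>i. i \<in> {1..k - 2} \<Longrightarrow> field_bracket_subset_on N f (characteristic_distribution (flag i)) (flag i)"
  shows "locally_equivalent_to_TCh k X f g x0"
proof -
  let ?I = "insert None (Some ` ((UNIV :: 'm set) \<times> {1..k}))"
  have "card ?I = k * CARD('m) + 1"
    by (subst card_insert_disjoint) (auto simp: card_image card_cartesian_product mult.commute)
  then have "\<exists>c. bij_betw c ?I (UNIV :: 'n set)"
    using card by (intro finite_same_card_bij) auto
  then obtain c where c: "bij_betw c ?I (UNIV :: 'n set)" by blast
  define \<phi> :: "real^'n \<Rightarrow> real^'n" where
    "\<phi> x = (\<chi> j. case inv_into ?I c j of None \<Rightarrow> z0 x | Some (q, l) \<Rightarrow> z q l x)" for x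
  have inj: "inj_on c ?I" using c by (simp add: bij_betw_def)
  have \<phi>0: "\<phi> x $ c None = z0 x" for x
    using inv_into_f_f[OF inj, of None] by (simp add: \<phi>_def)
  have \<phi>l: "\<phi> x $ c (Some (q, l)) = z q l x" if "l \<in> {1..k}" for x q l
    using inv_into_f_f[OF inj, of "Some (q, l)"] that by (simp add: \<phi>_def)
  have sm\<phi>: "smooth_on N \<phi>"
    unfolding \<phi>_def[abs_def]
  proof (rule smooth_on_vec[OF openN])
    show "smooth_on N (\<lambda>x. case inv_into ?I c i of None \<Rightarrow> z0 x | Some (q, l) \<Rightarrow> z q l x)" for i
      using smooth_z0 smooth_z by (cases "inv_into ?I c i") (auto split: prod.splits)
  qed
  have D0: "\<partial> \<phi> x v $ c None = dz0 x v" if "x \<in> N" for x v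
    using frechet_derivative_bounded_linear[OF bounded_linear_vec_nth smooth_on_imp_differentiable[OF sm\<phi> that], of "c None" v]
    by (simp add: \<phi>0 dz0_def)
  have Dl: "\<partial> \<phi> x v $ c (Some (q, l)) = dz q l x v" if "x \<in> N" "l \<in> {1..k}" for x v q l
    using frechet_derivative_bounded_linear[OF bounded_linear_vec_nth smooth_on_imp_differentiable[OF sm\<phi> that(1)], of "c (Some (q, l))" v]
    by (simp only: \<phi>l[OF that(2)] dz_def)
  have vecI: "v = v'" if "v $ c None = v' $ c None" "\<And>q l. l \<in> {1..k} \<Longrightarrow> v $ c (Some (q, l)) = v' $ c (Some (q, l))"
    for v v' :: "real^'n"
    by (rule vec_eqI_bij[OF c]) (use that in auto)
  have inj0: "inj (\<partial> \<phi> x0)"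
  proof (rule linear_surjective_imp_injective)
    show "linear (\<partial> \<phi> x0)"
      by (rule linear_frechet_derivative[OF smooth_on_imp_differentiable[OF sm\<phi> x0]])
    have "t \<in> range (\<partial> \<phi> x0)" for t
    proof -
      obtain u where u: "dz0 x0 u = t $ c None" "\<And>q l. l \<in> {1..k} \<Longrightarrow> dz q l x0 u = t $ c (Some (q, l))"
        using dz_onto[of k "t $ c None" "\<lambda>q l. t $ c (Some (q, l))"] by auto
      have "t = \<partial> \<phi> x0 u"
        by (rule vecI) (simp_all add: D0[OF x0] Dl[OF x0] u)
      then show ?thesis by blast
    qed
    then show "surj (\<partial> \<phi> x0)" by auto
  qed (rule refl)
  obtain U' V' \<psi> where U': "open U'" "U' \<subseteq> N" "x0 \<in> U'" and V': "open V'" "\<phi> x0 \<in> V'" and hom: "homeomorphism U' V' \<phi> \<psi>"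
    and sm\<psi>: "smooth_on V' \<psi>" and bij: "\<And>x. x \<in> U' \<Longrightarrow> bij (\<partial> \<phi> x)"
    by (rule smooth_inverse_function_theorem[OF openN sm\<phi> x0 inj0]) blast
  define S where "S x v = (\<Sum>i\<in>UNIV. (v $ i) *\<^sub>R g i x)" for x and v :: "real^('m option)"
  have linS: "linear (S x)" for x unfolding S_def by (rule linear_control_sum)
  have rngS: "control_distribution g x = range (S x)" for x by (simp add: control_distribution_eq_range S_def[abs_def])
  \<comment> \<open>Reads off the components that the new controls are to equal.\<close>
  define R where "R x u = (\<chi> j. case j of None \<Rightarrow> dz0 x u | Some q \<Rightarrow> dz q k x u)" for x u
  have R: "R x u $ None = dz0 x u" "R x u $ Some q = dz q k x u" for x u q by (simp_all add: R_def)
  have linR: "linear (R x)" if "x \<in> N" for x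
    by (rule linearI) (auto simp: R_def vec_eq_iff dz_linear[OF that] split: option.split)
  \<comment> \<open>The decoupling matrix: the response of these components to the original
    controls.\<close>
  define M where "M x = matrix (\<lambda>v. R x (S x v))" for x
  have M: "M x *v v = R x (S x v)" if "x \<in> N" for x v
    unfolding M_def using linear_compose[OF linS linR[OF that]] by (simp add: matrix_works o_def)
  have smR: "smooth_on W (\<lambda>x. R x (u x))" if "open W" "W \<subseteq> N" "smooth_on W u" for W u
    unfolding R_def dz_def dz0_def
  proof (rule smooth_on_vec[OF that(1)])
    show "smooth_on W (\<lambda>x. case i of None \<Rightarrow> \<partial> z0 x (u x) | Some q \<Rightarrow> \<partial> (z q k) x (u x))" for i
      using smooth_on_frechet_derivative[OF that(1) smooth_on_subset[OF smooth_z0 that(2)] that(3)]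
        smooth_on_frechet_derivative[OF that(1) smooth_on_subset[OF smooth_z that(2)] that(3)]
      by (cases i) auto
  qed
  have smS: "smooth_on N (\<lambda>x. S x v)" for v
    unfolding S_def by (intro smooth_on_sum smooth_on_bounded_linear[OF bounded_linear_scaleR_right] openN smooth_g)
  have smM: "smooth_on N (\<lambda>x. M x $ i $ j)" for i j
    using smooth_on_nth[OF openN smR[OF openN order_refl smS]] by (simp add: M_def matrix_def)
  have "inj ((*v) (M x0))"
  proof (rule linear_surjective_imp_injective)
    have "t \<in> range ((*v) (M x0))" for t
    proof -
      \<comment> \<open>The flag of index k - k = 0 is the control distribution. A multiple of
        \<open>w\<close> produces the dz0 component, and the subtracted term compensates its
        contribution to dz^k.\<close>
      obtain u where u: "u \<in> flag (k - k) x0" "dz0 x0 u = 0" "\<And>q. dz q k x0 u = t $ Some q - t $ None * dz q k x0 (w x0)"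
        using dz_onto_flag[of k "\<lambda>q. t $ Some q - t $ None * dz q k x0 (w x0)"] k2 by auto
      have "u + (t $ None) *\<^sub>R w x0 \<in> control_distribution g x0"
        using u(1) w[OF x0] by (intro subspace_add subspace_scale subspace_control_distribution) (simp_all add: derived_flag_0)
      then obtain v where v: "S x0 v = u + (t $ None) *\<^sub>R w x0" using rngS by force
      have "dz0 x0 (w x0) = 1" using z0w[OF x0] by (simp add: dz0_def)
      then have "R x0 (S x0 v) = t"
        unfolding v using u(2,3)
        by (auto simp: R_def vec_eq_iff dz_linear[OF x0] split: option.split)
      then show ?thesis using M[OF x0, of v] by (metis rangeI)
    qed
    then show "surj ((*v) (M x0))" by auto
  qed simp_all
  then have "invertible (M x0)" by (simp add: invertible_left_inverse matrix_left_invertible_injective)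
  then obtain N3 where N3: "open N3" "x0 \<in> N3" "N3 \<subseteq> N" "\<And>x. x \<in> N3 \<Longrightarrow> invertible (M x)"
    using open_invertible_neighbourhood[OF openN x0 smM] by blast
  have cont\<psi>: "continuous_on V' \<psi>" and cont\<phi>: "continuous_on U' \<phi>" using hom by (auto simp: homeomorphism_def)
  have \<phi>\<psi>: "\<phi> x \<in> V'" "\<psi> (\<phi> x) = x" if "x \<in> U'" for x using hom that by (auto simp: homeomorphism_def)
  have \<psi>\<phi>: "\<psi> y \<in> U'" "\<phi> (\<psi> y) = y" if "y \<in> V'" for y using hom that by (auto simp: homeomorphism_def)
  have "open (V' \<inter> \<psi> -` N3)" by (rule continuous_open_preimage[OF cont\<psi> V'(1) N3(1)])
  moreover have "\<phi> x0 \<in> V' \<inter> \<psi> -` N3" using V' \<phi>\<psi>[OF U'(3)] N3 by simp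
  ultimately obtain r where r: "r > 0" "ball (\<phi> x0) r \<subseteq> V' \<inter> \<psi> -` N3" using open_contains_ball by blast
  \<comment> \<open>A ball, so that two points of one fibre are joined by a segment inside the
    domain.\<close>
  define B where "B = ball (\<phi> x0) r"
  define U1 where "U1 = U' \<inter> \<phi> -` B"
  have openB: "open B" "convex B" "B \<subseteq> V'" "\<And>y. y \<in> B \<Longrightarrow> \<psi> y \<in> N3" using r by (auto simp: B_def)
  have openU1: "open U1" unfolding U1_def by (rule continuous_open_preimage[OF cont\<phi> U'(1) openB(1)])
  have x0U1: "x0 \<in> U1" using U' r by (simp add: U1_def B_def)
  have U1: "x \<in> U'" "x \<in> N" "x \<in> N3" "\<phi> x \<in> B" if "x \<in> U1" for x
    using that U' openB(4)[of "\<phi> x"] \<phi>\<psi>[of x] by (auto simp: U1_def)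
  have \<psi>U1: "\<psi> y \<in> U1" "\<phi> (\<psi> y) = y" if "y \<in> B" for y
    using that \<psi>\<phi>[of y] openB(3) by (auto simp: U1_def)
  have U1N: "U1 \<subseteq> N" using U1 by auto
  have hom1: "homeomorphism U1 B \<phi> \<psi>"
  proof (rule homeomorphismI)
    show "continuous_on U1 \<phi>" by (rule continuous_on_subset[OF cont\<phi>]) (use U1 in auto)
    show "continuous_on B \<psi>" by (rule continuous_on_subset[OF cont\<psi> openB(3)])
  qed (use U1 \<psi>U1 \<phi>\<psi> in auto)
  note sm\<phi>1 = smooth_on_subset[OF sm\<phi> U1N] and sm\<psi>1 = smooth_on_subset[OF sm\<psi> openB(3)]
  interpret CC: chained_coordinates U1 k c \<phi>
    by unfold_locales (use openU1 sm\<phi>1 c bij U1 k2 in auto)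
  have CCz: "CC.z0 = z0" "l \<in> {1..k} \<Longrightarrow> CC.z q l = z q l" for q l
    by (auto simp: CC.z0_def CC.z_def \<phi>0 \<phi>l)
  have CCd: "CC.dz0 x v = dz0 x v" "l \<in> {1..k} \<Longrightarrow> CC.dz q l x v = dz q l x v" if "x \<in> U1" for x v q l
    using D0 Dl U1[OF that] by (auto simp: CC.dz0_def CC.dz_def)
  have contact0: "CC.contact 0 x = {v. \<forall>q. \<forall>l\<in>{1..<k}. dz q l x v = z q (l + 1) x * dz0 x v}" if "x \<in> U1" for x
  proof -
    have "{1..k - 1 - 0} = {1..<k}" by auto
    then show ?thesis using that by (auto simp: CC.contact_def CCd CCz)
  qed
  have Sc: "dz q l x (S x v) = z q (l + 1) x * dz0 x (S x v)" if "x \<in> U1" "l \<in> {1..<k}" for x v q l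
  proof -
    have "S x v \<in> flag 0 x" using rngS by (auto simp: derived_flag_0)
    then show ?thesis using flag_contact[of 0 x "S x v" l q] U1[OF that(1)] that(2) by auto
  qed
  have G: "control_distribution g x = CC.contact 0 x" if x: "x \<in> U1" for x
  proof
    show "control_distribution g x \<subseteq> CC.contact 0 x" using Sc[OF x] by (auto simp: rngS contact0[OF x])
    show "CC.contact 0 x \<subseteq> control_distribution g x"
    proof
      fix u assume u: "u \<in> CC.contact 0 x"
      \<comment> \<open>The control that gives \<open>u\<close> the right dz0 and dz^k; the contact
        relations make the remaining components agree.\<close>
      define v where "v = matrix_inv (M x) *v R x u"
      have "R x (S x v) = R x u"
        using M[OF U1(2)[OF x], of v] matrix_inv_mult(1)[OF N3(4)[OF U1(3)[OF x]]] by (simp add: v_def)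
      then have Rv: "dz0 x (S x v) = dz0 x u" "dz q k x (S x v) = dz q k x u" for q by (metis R)+
      have "u = S x v"
      proof (rule CC.coord_eqI[OF x])
        show "CC.dz0 x u = CC.dz0 x (S x v)" by (simp add: CCd[OF x] Rv)
        fix q l assume l: "l \<in> {1..k}"
        show "CC.dz q l x u = CC.dz q l x (S x v)"
        proof (cases "l = k")
          case True then show ?thesis using l by (simp add: CCd[OF x] Rv)
        next
          case False
          then have "l \<in> {1..<k}" using l by auto
          then show ?thesis using l u Sc[OF x, of l q v] by (simp add: CCd[OF x] contact0[OF x] Rv)
        qed
      qed
      then show "u \<in> control_distribution g x" using rngS by blast
    qed
  qed
  have flagC: "flag i y = CC.contact i y" if "i \<le> k - 1" "y \<in> U1" for i y
    by (rule CC.derived_flag_contact[OF G that])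
  note f1 = smooth_on_subset[OF f U1N]
  have dr: "\<partial> (CC.drift f q l) x v = 0"
    if "x \<in> U1" "l \<in> {1..k - 1}" "v \<in> CC.ker_coords (k - 1 - l) x" for x q l v
    by (rule CC.drift_of_compatible[OF f1 flagC _ that(2,1,3)])
      (use field_bracket_subset_on_subset[OF comp U1N] in auto)
  \<comment> \<open>Cancels the drift in z0 and z^k, while \<open>\<beta>\<close> inverts the
    decoupling matrix.\<close>
  define \<alpha> where "\<alpha> x = - (matrix_inv (M x) *v R x (f x))" for x
  define \<beta> where "\<beta> x = matrix_inv (M x)" for x
  have invM: "invertible (M x)" if "x \<in> U1" for x using N3(4) U1 that by auto
  have sm\<alpha>: "smooth_on U1 \<alpha>"
    unfolding \<alpha>_def[abs_def]
    by (intro smooth_on_minus openU1 smooth_on_matrix_inv_mult smooth_on_subset[OF smM U1N] invM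
        smooth_on_nth[OF openU1 smR[OF openU1 U1N f1]])
  have sm\<beta>: "smooth_on U1 \<beta>"
    unfolding \<beta>_def[abs_def] by (intro openU1 smooth_on_matrix_inv smooth_on_subset[OF smM U1N] invM)
  \<comment> \<open>The drift component in the new coordinates; being invariant under feedback, it
    can be computed from the original \<open>f\<close>.\<close>
  define h where "h q l y = CC.drift f q l (\<psi> y)" for q l y
  define f' where "f' y = CC.coord_vec 0 (\<lambda>q l. if l < k then h q l y else 0)" for y
  define g' where "g' i y = CC.coord_vec (if i = None then 1 else 0) (\<lambda>q l. if l < k then (if i = None then y $ c (Some (q, l + 1)) else 0)
    else (if i = Some q then 1 else 0))" for i :: "'m option" and y
  have smh: "smooth_on B (h q l)" for q l
    unfolding h_def[abs_def]
    by (rule smooth_on_compose[OF openB(1) openU1 sm\<psi>1 CC.smooth_drift[OF f1]]) (use \<psi>U1 in auto)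
  have ca_nth: "control_affine f' g' y v $ j = f' y $ j + (\<Sum>i\<in>UNIV. v $ i * g' i y $ j)" for y v j
    by (simp add: control_affine_def)
  have ca: "control_affine f' g' y v $ c None = v $ None"
    "l \<in> {1..<k} \<Longrightarrow> control_affine f' g' y v $ c (Some (q, l)) = h q l y + y $ c (Some (q, l + 1)) * v $ None"
    "control_affine f' g' y v $ c (Some (q, k)) = v $ Some q" for y v q l
  proof -
    have "(\<Sum>i\<in>UNIV. v $ i * g' i y $ c None) = (\<Sum>i\<in>UNIV. if i = None then v $ i else 0)"
      by (intro sum.cong) (simp_all add: g'_def CC.coord_vec)
    then show "control_affine f' g' y v $ c None = v $ None"
      by (simp add: ca_nth f'_def CC.coord_vec)
    have kk: "k \<in> {1..k}" using k2 by simp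
    have "(\<Sum>i\<in>UNIV. v $ i * g' i y $ c (Some (q, k))) = (\<Sum>i\<in>UNIV. if i = Some q then v $ i else 0)"
      by (intro sum.cong) (simp_all add: g'_def CC.coord_vec(2)[OF kk])
    then show "control_affine f' g' y v $ c (Some (q, k)) = v $ Some q"
      by (simp add: ca_nth f'_def CC.coord_vec(2)[OF kk])
    assume l: "l \<in> {1..<k}"
    then have l': "l \<in> {1..k}" by simp
    have "(\<Sum>i\<in>UNIV. v $ i * g' i y $ c (Some (q, l))) =
        (\<Sum>i\<in>UNIV. if i = None then v $ i * y $ c (Some (q, l + 1)) else 0)"
      using l by (intro sum.cong) (simp_all add: g'_def CC.coord_vec(2)[OF l'])
    then show "control_affine f' g' y v $ c (Some (q, l)) = h q l y + y $ c (Some (q, l + 1)) * v $ None"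
      using l by (simp add: ca_nth f'_def CC.coord_vec(2)[OF l'])
  qed
  \<comment> \<open>The direction of the segment from \<open>y\<close> to \<open>y'\<close>,
    transported by \<psi>, is killed by dz0 and dz^1, ..., dz^(l+1); the drift component has zero
    derivative along it.\<close>
  have fibre: "h q l y = h q l y'"
    if l: "l \<in> {1..<k}" and y: "y \<in> B" "y' \<in> B" and e: "y $ c None = y' $ c None"
      "\<And>i' l'. l' \<in> {1..l + 1} \<Longrightarrow> y $ c (Some (i', l')) = y' $ c (Some (i', l'))" for q l y y'
  proof (rule eq_along_segment[OF openB(2) y smooth_on_imp_differentiable[OF smh]])
    fix s assume s: "s \<in> B"
    let ?d = "\<partial> \<psi> s (y' - y)"
    have ps: "\<psi> s \<in> U1" by (rule \<psi>U1(1)[OF s])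
    have d: "\<partial> \<phi> (\<psi> s) ?d = y' - y"
      by (rule smooth_left_inverse_imp_bij(1)[OF openB(1) s sm\<psi>1 sm\<phi>1 ps \<psi>U1(2)])
    have "k - (k - 1 - l) = l + 1" using l by auto
    then have "?d \<in> CC.ker_coords (k - 1 - l) (\<psi> s)"
      using e by (simp add: CC.ker_coords_def CC.dz0_def CC.dz_def d)
    then have "\<partial> (CC.drift f q l) (\<psi> s) ?d = 0"
      by (intro dr ps) (use l in auto)
    moreover have "(h q l has_derivative (\<lambda>v. \<partial> (CC.drift f q l) (\<psi> s) (\<partial> \<psi> s v))) (at s)"
      unfolding h_def[abs_def]
      by (rule has_derivative_compose[OF smooth_on_has_derivative[OF sm\<psi>1 s] smooth_on_has_derivative[OF CC.smooth_drift[OF f1] ps]])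
    ultimately show "\<partial> (h q l) s (y' - y) = 0"
      by (simp add: frechet_derivative_eqI)
  qed
  have TCh: "TCh_form_on k B f' g'"
    unfolding TCh_form_on_def
  proof (intro exI[of _ c] exI[of _ h] conjI allI ballI impI)
    show "h i j y = h i j y'" if "j \<in> {1..<k}" "y \<in> B" "y' \<in> B"
      "y $ c None = y' $ c None \<and> (\<forall>i'. \<forall>l\<in>{1..j + 1}. y $ c (Some (i', l)) = y' $ c (Some (i', l)))" for i j y y'
      by (rule fibre[OF that(1-3)]) (use that(4) in auto)
  qed (rule c smh ca; assumption?)+
  have eqv: "\<partial> \<phi> x (control_affine f g x (\<alpha> x + \<beta> x *v v)) = control_affine f' g' (\<phi> x) v"
    if x: "x \<in> U1" for x v
  proof -
    define u where "u = \<alpha> x + \<beta> x *v v"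
    note lin = dz_linear[OF U1(2)[OF x]]
    have "R x (S x u) = M x *v u" using M[OF U1(2)[OF x]] by simp
    also have "\<dots> = v - R x (f x)"
      using matrix_inv_mult(1)[OF invM[OF x]]
      by (simp add: u_def \<alpha>_def \<beta>_def matrix_vector_mult_diff_distrib)
    finally have Ru: "R x (S x u) $ j = v $ j - R x (f x) $ j" for j by simp
    have u0: "dz0 x (S x u) = v $ None - dz0 x (f x)" and uk: "dz q k x (S x u) = v $ Some q - dz q k x (f x)" for q
      using Ru[of None] Ru[of "Some q"] by (simp_all add: R)
    have ca': "control_affine f g x u = f x + S x u" by (simp add: control_affine_def S_def)
    show ?thesis
      unfolding u_def[symmetric] ca'
    proof (rule vecI)
      show "\<partial> \<phi> x (f x + S x u) $ c None = control_affine f' g' (\<phi> x) v $ c None"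
        by (simp add: D0[OF U1(2)[OF x]] ca lin u0)
      fix q l assume l: "l \<in> {1..k}"
      show "\<partial> \<phi> x (f x + S x u) $ c (Some (q, l)) = control_affine f' g' (\<phi> x) v $ c (Some (q, l))"
      proof (cases "l = k")
        case True
        then show ?thesis using l by (simp add: Dl[OF U1(2)[OF x]] ca lin uk)
      next
        case False
        then have l': "l \<in> {1..<k}" "l + 1 \<in> {1..k}" using l by auto
        have "h q l (\<phi> x) = dz q l x (f x) - z q (l + 1) x * dz0 x (f x)"
          using \<phi>\<psi>(2)[OF U1(1)[OF x]] l l' by (simp add: h_def CC.drift_def CCd[OF x] CCz)
        then show ?thesis
          using Sc[OF x l'(1), of q u] l l'
          by (simp add: Dl[OF U1(2)[OF x]] ca(2)[OF l'(1)] lin u0 \<phi>l algebra_simps)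
      qed
    qed
  qed
  have "locally_static_feedback_equivalent X f g x0 B f' g'"
    unfolding locally_static_feedback_equivalent_def
  proof (intro exI conjI)
    show "open U1" "x0 \<in> U1" "open B" "homeomorphism U1 B \<phi> \<psi>" "smooth_on U1 \<phi>" "smooth_on B \<psi>" "smooth_on U1 \<alpha>" "smooth_on U1 \<beta>"
      by fact+
    show "U1 \<subseteq> X" using U1N X by auto
    show "B \<subseteq> B" by simp
    show "\<forall>x\<in>U1. invertible (\<beta> x)" using invM invertible_matrix_inv by (auto simp: \<beta>_def)
    show "\<forall>x\<in>U1. \<forall>v. \<partial> \<phi> x (control_affine f g x (\<alpha> x + \<beta> x *v v)) = control_affine f' g' (\<phi> x) v"
      using eqv by blast
  qed
  then show ?thesis
    unfolding locally_equivalent_to_TCh_def using openB(1) TCh by blast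
qed

section \<open>From the geometric conditions to the chain\<close>

text \<open>The first integrals have rank (k m + 1) - (k - 1) m = m + 1 at \<open>x0\<close>. By
  (m-Ch3) some control field is outside L there, so some first integral has nonzero derivative along
  it; that integral becomes z0 and the field is rescaled to \<open>w\<close>.\<close>

lemma conditions_imp_chain_data:
  fixes g :: "'m::finite option \<Rightarrow> real^'n \<Rightarrow> real^'n"
  assumes k: "k \<ge> 2" and U: "open U" "x0 \<in> U" and g: "\<And>i. smooth_on U (g i)"
    and card: "CARD('n) = k * CARD('m) + 1"
    and full: "\<forall>x\<in>U. derived_flag (control_distribution g) (k - 1) x = UNIV"
    and rank: "constant_rank_on U (derived_flag (control_distribution g) (k - 2)) ((k - 1) * CARD('m) + 1)"
    and L: "smooth_distribution_on U L" "involutive_on U L"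
    and corank: "constant_corank_one_in U L (derived_flag (control_distribution g) (k - 2))"
    and trans: "\<not> derived_flag (control_distribution g) 0 x0 \<subseteq> L x0"
  shows "\<exists>N z0 \<zeta> w. N \<subseteq> U \<and> chain_data N k g z0 \<zeta> w x0"
proof -
  let ?flag = "derived_flag (control_distribution g)"
  define d where "d = (k - 1) * CARD('m)"
  have subL: "subspace (L x)" if "x \<in> U" for x
  proof -
    obtain V S where "x \<in> V" "\<forall>y\<in>V. L y = span ((\<lambda>s. s y) ` S)"
      using L(1) \<open>x \<in> U\<close> unfolding smooth_distribution_on_def by meson
    then show ?thesis by simp
  qed
  have Lflag: "L x \<subseteq> ?flag (k - 2) x" and dimL: "dim (L x) = d" and dimF: "dim (?flag (k - 2) x) = d + 1" if "x \<in> U" for x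
    using corank rank that by (auto simp: constant_corank_one_in_def constant_rank_on_def d_def)
  obtain N0 Y where N0: "open N0" "x0 \<in> N0" "N0 \<subseteq> U" and Y: "smooth_on N0 (Y :: real^'n \<Rightarrow> real^'n)"
    and YL: "\<And>x v. x \<in> N0 \<Longrightarrow> v \<in> L x \<Longrightarrow> \<partial> Y x v = 0"
    and LY: "\<And>v. \<partial> Y x0 v = 0 \<Longrightarrow> v \<in> L x0"
    using frobenius_first_integrals[OF U L dimL] by blast
  let ?DY = "\<lambda>x. \<partial> Y x"
  have linY: "linear (?DY x)" if "x \<in> N0" for x
    by (rule linear_frechet_derivative[OF smooth_on_imp_differentiable[OF Y that]])
  have "{v. ?DY x0 v = 0} = L x0" using YL[OF N0(2)] LY by auto
  then have "dim (range (?DY x0)) = CARD('m) + 1"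
    using dim_kernel[OF linY[OF N0(2)]] dimL[OF U(2)] card k by (cases k) (auto simp: d_def)
  then have "dim (range (?DY x0)) = dim (UNIV :: (real^('m option)) set)" by simp
  \<comment> \<open>\<open>Y\<close> has more components than its rank at \<open>x0\<close>;
    composing with \<open>T\<close> leaves m + 1 functions whose differentials at \<open>x0\<close>
    are jointly onto.\<close>
  then obtain T where T: "linear T" "T ` range (?DY x0) = (UNIV :: (real^('m option)) set)" "inj_on T (range (?DY x0))"
    using subspace_isomorphism[OF linear_subspace_image[OF linY[OF N0(2)] subspace_UNIV] subspace_UNIV] by blast
  have "\<exists>i. g i x0 \<notin> L x0"
  proof (rule ccontr)
    assume "\<nexists>i. g i x0 \<notin> L x0"
    then have "control_distribution g x0 \<subseteq> L x0"
      unfolding control_distribution_def by (intro span_minimal subL U(2)) auto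
    then show False using trans by (simp add: derived_flag_0)
  qed
  then obtain i0 where i0: "g i0 x0 \<notin> L x0" by blast
  have "T (?DY x0 (g i0 x0)) \<noteq> 0"
  proof
    assume "T (?DY x0 (g i0 x0)) = 0"
    then have "T (?DY x0 (g i0 x0)) = T (?DY x0 0)" by (simp add: linear_0[OF T(1)] linear_0[OF linY[OF N0(2)]])
    then have "?DY x0 (g i0 x0) = ?DY x0 0" using inj_onD[OF T(3)] by blast
    then show False using LY i0 by (simp add: linear_0[OF linY[OF N0(2)]])
  qed
  then obtain j0 where j0: "T (?DY x0 (g i0 x0)) $ j0 \<noteq> 0" by (auto simp: vec_eq_iff)
  \<comment> \<open>The transposition of \<open>None\<close> and \<open>j0\<close>: it puts the
    chosen function in the place of z0 and lets the type \<open>'m\<close> index the others.\<close>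
  define \<sigma> where "\<sigma> i = (if i = None then j0 else if i = j0 then None else i)" for i
  have \<sigma>\<sigma>: "\<sigma> (\<sigma> i) = i" for i by (cases j0; cases i) (auto simp: \<sigma>_def)
  have \<sigma>0: "\<sigma> None = j0" by (simp add: \<sigma>_def)
  define Q where "Q i x = T (Y x) $ i" for i x
  have blT: "bounded_linear (\<lambda>v. T v $ i)" for i
    using bounded_linear_compose[OF bounded_linear_vec_nth] T(1) by (simp add: linear_conv_bounded_linear)
  have smQ: "smooth_on N0 (Q i)" for i
    unfolding Q_def[abs_def] by (rule smooth_on_bounded_linear[OF blT N0(1) Y])
  have DQ: "\<partial> (Q i) x v = T (?DY x v) $ i" if "x \<in> N0" for i x v
    unfolding Q_def[abs_def] by (rule frechet_derivative_bounded_linear[OF blT smooth_on_imp_differentiable[OF Y that]])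
  have QL: "\<partial> (Q i) x v = 0" if "x \<in> N0" "v \<in> L x" for i x v
    using YL[OF that] by (simp add: DQ[OF that(1)] linear_0[OF T(1)])
  have linQ: "linear (\<partial> (Q i) x)" if "x \<in> N0" for i x
    by (rule linear_frechet_derivative[OF smooth_on_imp_differentiable[OF smQ that]])
  define p where "p x = \<partial> (Q j0) x (g i0 x)" for x
  have smg0: "smooth_on N0 (g i)" for i by (rule smooth_on_subset[OF g N0(3)])
  have smp: "smooth_on N0 p" unfolding p_def[abs_def] by (rule smooth_on_frechet_derivative[OF N0(1) smQ smg0])
  define N where "N = N0 \<inter> p -` (- {0})"
  have N: "open N" "x0 \<in> N" "N \<subseteq> N0" "\<And>x. x \<in> N \<Longrightarrow> p x \<noteq> 0"
    using continuous_open_preimage[OF smooth_on_imp_continuous_on[OF smp] N0(1), of "- {0}"] N0(2) j0 DQ[OF N0(2)]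
    by (auto simp: N_def p_def)
  define w where "w x = inverse (p x) *\<^sub>R g i0 x" for x
  have wG: "w x \<in> control_distribution g x" for x
    unfolding w_def control_distribution_def by (intro span_scale span_base) auto
  have DQw: "\<partial> (Q j0) x (w x) = 1" if "x \<in> N" for x
    using N(3,4) that by (simp add: w_def linear_scale[OF linQ] p_def subset_iff)
  have "chain_data N k g (Q j0) (\<lambda>q. Q (\<sigma> (Some q))) w x0"
  proof
    show "smooth_on N w"
      unfolding w_def[abs_def]
      by (intro smooth_on_scaleR smooth_on_inverse N(1,4) smooth_on_subset[OF smp N(3)] smooth_on_subset[OF smg0 N(3)])
    show "?flag (k - 1) x0 = UNIV" using full U(2) by blast
    show "\<exists>u. \<partial> (Q j0) x0 u = 0 \<and> (\<forall>q. \<partial> (Q (\<sigma> (Some q))) x0 u = t q)" for t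
    proof -
      define s :: "real^('m option)" where "s = (\<chi> i. case \<sigma> i of None \<Rightarrow> 0 | Some q \<Rightarrow> t q)"
      have "s \<in> T ` range (?DY x0)" using T(2) by simp
      then obtain u where u: "T (?DY x0 u) = s" by auto
      have "s $ j0 = 0" "s $ \<sigma> (Some q) = t q" for q
        using \<sigma>\<sigma>[of None] by (simp_all add: s_def \<sigma>\<sigma> \<sigma>0)
      then show ?thesis using DQ[OF N0(2)] u by auto
    qed
    fix x u q assume x: "x \<in> N" and u: "u \<in> ?flag (k - 2) x"
    have xU: "x \<in> N0" "x \<in> U" using x N N0 by auto
    \<comment> \<open>With \<open>w x\<close> outside \<open>L x\<close>, a dimension count shows
      that the two span the flag of index k - 2. Modulo L every vector of that flag is a multiple of
      \<open>w x\<close>, which gives the relation \<open>top\<close>.\<close>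
    have wL: "w x \<notin> L x" using QL[OF xU(1), of "w x" j0] DQw[OF x] by auto
    have "w x \<in> ?flag (k - 2) x"
      using derived_flag_mono[of 0 "k - 2" "control_distribution g" x] wG by (auto simp: derived_flag_0)
    then have sub: "span (insert (w x) (L x)) \<subseteq> ?flag (k - 2) x"
      using Lflag[OF xU(2)] by (intro span_minimal subspace_derived_flag subspace_control_distribution) auto
    have spL: "span (L x) = L x" using subL[OF xU(2)] by (simp only: span_eq_iff)
    have "dim (span (insert (w x) (L x))) = d + 1"
      using wL dimL[OF xU(2)] by (simp add: dim_insert spL)
    then have "span (insert (w x) (L x)) = ?flag (k - 2) x"
      using sub dimF[OF xU(2)]
      by (intro subspace_dim_equal subspace_span subspace_derived_flag subspace_control_distribution) auto
    then obtain a where "u - a *\<^sub>R w x \<in> L x" using u spL by (metis span_breakdown_eq)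
    from QL[OF xU(1) this] have a: "\<partial> (Q i) x u = a * \<partial> (Q i) x (w x)" for i
      by (simp add: linear_diff[OF linQ[OF xU(1)]] linear_scale[OF linQ[OF xU(1)]])
    show "\<partial> (Q (\<sigma> (Some q))) x u =
        \<partial> (Q (\<sigma> (Some q))) x (w x) * \<partial> (Q j0) x u"
      using a[of "\<sigma> (Some q)"] a[of j0] DQw[OF x] by simp
  qed (use N k wG DQw smooth_on_subset[OF smQ N(3)] smooth_on_subset[OF smg0 N(3)] in simp_all)
  then show ?thesis using N(3) N0(3) by blast
qed

theorem theorem2:
  fixes X :: "(real ^ 'n) set"
    and f :: "real ^ 'n \<Rightarrow> real ^ 'n"
    and g :: "'m::finite option \<Rightarrow> real ^ 'n \<Rightarrow> real ^ 'n"
    and k :: nat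
    and xstar :: "real ^ 'n"
  assumes "CARD('m) \<ge> 2" and "k \<ge> 2"
    and "CARD('n) = k * CARD('m) + 1"
    and "open X" and "xstar \<in> X"
    and "smooth_on X f" and "\<And>i. smooth_on X (g i)"
  shows "locally_equivalent_to_TCh k X f g xstar \<longleftrightarrow>
    (\<exists>U L. open U \<and> xstar \<in> U \<and> U \<subseteq> X \<and>
       (\<forall>x\<in>U. derived_flag (control_distribution g) (k - 1) x = UNIV) \<and>
       constant_rank_on U (derived_flag (control_distribution g) (k - 2)) ((k - 1) * CARD('m) + 1) \<and>
       smooth_distribution_on U L \<and>
       involutive_on U L \<and>
       constant_corank_one_in U L (derived_flag (control_distribution g) (k - 2)) \<and>
       \<not> derived_flag (control_distribution g) 0 xstar \<subseteq> L xstar \<and>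
       (\<forall>i\<in>{1..k - 2}. field_bracket_subset_on U f
          (characteristic_distribution (derived_flag (control_distribution g) i))
          (derived_flag (control_distribution g) i)))"
    (is "?equiv \<longleftrightarrow> (\<exists>U L. ?cond U L)")
proof
  show "\<exists>U L. ?cond U L" if ?equiv
    by (rule TCh_equivalent_imp_conditions[OF assms(2,6) that])
  assume "\<exists>U L. ?cond U L"
  then obtain U L where U: "open U" "xstar \<in> U" "U \<subseteq> X"
    and cond: "\<forall>x\<in>U. derived_flag (control_distribution g) (k - 1) x = UNIV"
       "constant_rank_on U (derived_flag (control_distribution g) (k - 2)) ((k - 1) * CARD('m) + 1)"
       "smooth_distribution_on U L" "involutive_on U L"
       "constant_corank_one_in U L (derived_flag (control_distribution g) (k - 2))"
       "\<not> derived_flag (control_distribution g) 0 xstar \<subseteq> L xstar"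
    and comp: "\<forall>i\<in>{1..k - 2}. field_bracket_subset_on U f
          (characteristic_distribution (derived_flag (control_distribution g) i))
          (derived_flag (control_distribution g) i)"
    by (elim exE conjE) (rule that)
  have "\<And>i. smooth_on U (g i)" by (rule smooth_on_subset[OF assms(7) U(3)])
  from conditions_imp_chain_data[OF assms(2) U(1,2) this assms(3) cond]
  obtain N z0 \<zeta> w where N: "N \<subseteq> U" and "chain_data N k g z0 \<zeta> w xstar" by blast
  then interpret chain_data N k g z0 \<zeta> w xstar by simp
  show ?equiv
    by (rule imp_TCh_equivalent)
      (use N U(3) smooth_on_subset[OF assms(6)] assms(3) field_bracket_subset_on_subset[OF comp[rule_format] N] in auto)
qed

end
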